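(* Let $\delta\in(0,1)$ and for $t\in[\delta,1]$ let $$Z_m(t)=\sqrt{m}\,\bigl(\Gamma_m(t)-Q(t)\bigr).$$ Let $Z$ be a Gaussian process on $(0,1]$ with mean $0$ and covariance kernel $$K_\Gamma(s,t)=a(1-a)\,\frac{(1-a)\,s\,t\,F(s\wedge t)+a\,F(s)F(t)\,(s\wedge t)}{G^2(s)\,G^2(t)}.$$ Then, as $m\to\infty$, $Z_m\rightsquigarrow Z$ on $[\delta,1]$.
   Context: Model: for each $m$, the pairs $(P_i,H_i)$, $i=1,\dots,m$, are i.i.d. with $H_i\sim\text{Bernoulli}(a)$, $0\le a\le 1$; conditionally on $H_i=0$, $P_i$ is Uniform$(0,1)$; conditionally on $H_i=1$, $P_i$ has distribution function $F$ on $[0,1]$ with $F(t)\ge t$ for all $t$. ($H_i=0$ means the $i$th null hypothesis is true; $P_i$ is the $i$th $p$-value.) The marginal distribution function of $P_i$ is $G(t)=(1-a)t+aF(t)$. Standing assumption: $G$ is strictly concave with density $g=G'$. The false discovery proportion (FDP) process is $$\Gamma_m(t)=\Gamma(t)=\frac{\sum_{i=1}^m \mathbf 1\{P_i\le t\}(1-H_i)}{\sum_{i=1}^m \mathbf 1\{P_i\le t\}+\mathbf 1\{\text{all }P_i>t\}},$$ and $Q(t)=(1-a)t/G(t)$ for $t\in(0,1]$. The symbol $\rightsquigarrow$ denotes convergence in distribution (weak convergence of processes, in the space $\ell^\infty$ of bounded functions on the indicated interval with the sup norm). *)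

theory Defs
  imports "HOL-Probability.Probability"
begin

section \<open>The space of bounded functions with the supremum distance\<close>

definition linf_space :: "'t set \<Rightarrow> ('t \<Rightarrow> real) set" where
  "linf_space T = {f \<in> extensional T. bounded (f ` T)}"

text \<open>Inserting \<open>0\<close> only matters for \<open>T = {}\<close>.\<close>

definition linf_dist :: "'t set \<Rightarrow> ('t \<Rightarrow> real) \<Rightarrow> ('t \<Rightarrow> real) \<Rightarrow> real" where
  "linf_dist T f g = Sup (insert 0 ((\<lambda>t. \<bar>f t - g t\<bar>) ` T))"

definition linf_metric :: "'t set \<Rightarrow> ('t \<Rightarrow> real) metric" where
  "linf_metric T = metric (linf_space T, \<lambda>f g. if f \<in> linf_space T \<and> g \<in> linf_space T
                                               then linf_dist T f g else 0)"

lemma linf_dist_bdd: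
  assumes "f \<in> linf_space T" "g \<in> linf_space T"
  shows "bdd_above (insert 0 ((\<lambda>t. \<bar>f t - g t\<bar>) ` T))"
proof -
  obtain b c where b: "\<And>t. t \<in> T \<Longrightarrow> \<bar>f t\<bar> \<le> b" and c: "\<And>t. t \<in> T \<Longrightarrow> \<bar>g t\<bar> \<le> c"
    using assms unfolding linf_space_def bounded_iff by auto
  have "\<bar>f t - g t\<bar> \<le> b + c" if "t \<in> T" for t
    using b[OF that] c[OF that] by linarith
  then show ?thesis
    by (auto intro!: bdd_aboveI[of _ "b + c"])
qed

lemma linf_dist_ge:
  assumes "f \<in> linf_space T" "g \<in> linf_space T" "t \<in> T"
  shows "\<bar>f t - g t\<bar> \<le> linf_dist T f g"
  unfolding linf_dist_def using assms by (intro cSup_upper linf_dist_bdd) auto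

lemma linf_dist_nonneg:
  assumes "f \<in> linf_space T" "g \<in> linf_space T"
  shows "0 \<le> linf_dist T f g"
  unfolding linf_dist_def using assms by (intro cSup_upper linf_dist_bdd) auto

lemma linf_dist_le:
  assumes "0 \<le> c" "\<And>t. t \<in> T \<Longrightarrow> \<bar>f t - g t\<bar> \<le> c"
  shows "linf_dist T f g \<le> c"
  unfolding linf_dist_def using assms by (intro cSup_least) auto

lemma Metric_space_linf:
  "Metric_space (linf_space T) (\<lambda>f g. if f \<in> linf_space T \<and> g \<in> linf_space T
                                      then linf_dist T f g else 0)"
proof (unfold_locales, goal_cases)
  case (1 f g) then show ?case by (auto intro: linf_dist_nonneg)
next
  case (2 f g) then show ?case by (auto simp: linf_dist_def abs_minus_commute)
next
  case (3 f g)
  have "f = g" if "linf_dist T f g = 0"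
  proof (rule extensionalityI[of _ T])
    show "f \<in> extensional T" "g \<in> extensional T" using 3 by (auto simp: linf_space_def)
    show "f t = g t" if "t \<in> T" for t
      using linf_dist_ge[OF 3 that] \<open>linf_dist T f g = 0\<close> by simp
  qed
  moreover have "linf_dist T f f = 0"
    using 3 linf_dist_nonneg[of f T f] linf_dist_le[of 0 T f f] by auto
  ultimately show ?case using 3 by auto
next
  case (4 f g h)
  have "linf_dist T f h \<le> linf_dist T f g + linf_dist T g h"
  proof (rule linf_dist_le)
    show "0 \<le> linf_dist T f g + linf_dist T g h"
      using 4 by (intro add_nonneg_nonneg linf_dist_nonneg)
    show "\<bar>f t - h t\<bar> \<le> linf_dist T f g + linf_dist T g h" if "t \<in> T" for t
      using linf_dist_ge[of f T g t] linf_dist_ge[of g T h t] 4 that by linarith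
  qed
  with 4 show ?case by simp
qed

lemma mspace_linf_metric [simp]: "mspace (linf_metric T) = linf_space T"
  unfolding linf_metric_def by (rule Metric_space.mspace_metric[OF Metric_space_linf])

lemma mdist_linf_metric:
  "f \<in> linf_space T \<Longrightarrow> g \<in> linf_space T \<Longrightarrow> mdist (linf_metric T) f g = linf_dist T f g"
  unfolding linf_metric_def by (simp add: Metric_space.mdist_metric[OF Metric_space_linf])


section \<open>Weak convergence of processes\<close>

text \<open>
  Weak convergence is taken in the sense of Hoffmann-Jorgensen: the converging maps need not be
  Borel measurable (empirical processes in the nonseparable space of bounded functions are not),
  so their expectations are outer expectations.
\<close>

definition outer_expectation :: "'w measure \<Rightarrow> ('w \<Rightarrow> real) \<Rightarrow> real" where
  "outer_expectation M f =
     Inf {integral\<^sup>L M u |u. integrable M u \<and> (\<forall>\<omega>\<in>space M. f \<omega> \<le> u \<omega>)}"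

lemma outer_expectation_integrable:
  assumes "integrable M f"
  shows "outer_expectation M f = integral\<^sup>L M f"
  unfolding outer_expectation_def
proof (rule cInf_eq_minimum)
  show "integral\<^sup>L M f \<in> {integral\<^sup>L M u |u. integrable M u \<and> (\<forall>\<omega>\<in>space M. f \<omega> \<le> u \<omega>)}"
    using assms by auto
qed (use assms in \<open>auto intro!: integral_mono\<close>)

definition metric_borel :: "'x metric \<Rightarrow> 'x measure" where
  "metric_borel X = sigma (mspace X) {U. openin (mtopology_of X) U}"

definition tight_borel_law :: "'x metric \<Rightarrow> 'x measure \<Rightarrow> bool" where
  "tight_borel_law X L \<longleftrightarrow>
     prob_space L \<and> sets L = sets (metric_borel X) \<and>
     (\<forall>\<epsilon>>0. \<exists>K. compactin (mtopology_of X) K \<and> measure L K > 1 - \<epsilon>)"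

definition weak_conv_law ::
  "'x metric \<Rightarrow> (nat \<Rightarrow> 'w measure) \<Rightarrow> (nat \<Rightarrow> 'w \<Rightarrow> 'x) \<Rightarrow> 'x measure \<Rightarrow> bool" where
  "weak_conv_law X M Y L \<longleftrightarrow>
     (\<forall>m. Y m \<in> space (M m) \<rightarrow> mspace X) \<and>
     (\<forall>h. continuous_map (mtopology_of X) euclideanreal h \<and> bounded (h ` mspace X) \<longrightarrow>
        (\<lambda>m. outer_expectation (M m) (\<lambda>\<omega>. h (Y m \<omega>))) \<longlonglongrightarrow> integral\<^sup>L L h)"

text \<open>
  \<open>L\<close> has the finite-dimensional distributions of the process \<open>Z\<close>, i.e. the coordinate process
  under \<open>L\<close> is a version of \<open>Z\<close> restricted to \<open>T\<close>.
\<close>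

definition law_of_version ::
  "'t set \<Rightarrow> 'z measure \<Rightarrow> ('t \<Rightarrow> 'z \<Rightarrow> real) \<Rightarrow> ('t \<Rightarrow> real) measure \<Rightarrow> bool" where
  "law_of_version T N Z L \<longleftrightarrow>
     (\<forall>S. finite S \<and> S \<subseteq> T \<longrightarrow>
        distr L (Pi\<^sub>M S (\<lambda>_. borel)) (\<lambda>f. restrict f S) =
        distr N (Pi\<^sub>M S (\<lambda>_. borel)) (\<lambda>\<omega>. \<lambda>s\<in>S. Z s \<omega>))"

text \<open>
  A stochastic process is determined by its finite-dimensional distributions only, and need not
  itself have bounded paths.  The limit is therefore the law of its tight Borel version
  in the space of bounded functions; this law is unique if it exists, and its existence is part
  of what is asserted.
\<close>

definition weak_conv_process ::
  "'t set \<Rightarrow> (nat \<Rightarrow> 'w measure) \<Rightarrow> (nat \<Rightarrow> 't \<Rightarrow> 'w \<Rightarrow> real) \<Rightarrow>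
   'z measure \<Rightarrow> ('t \<Rightarrow> 'z \<Rightarrow> real) \<Rightarrow> bool" where
  "weak_conv_process T M Y N Z \<longleftrightarrow>
     (\<exists>L. tight_borel_law (linf_metric T) L \<and> law_of_version T N Z L \<and>
          weak_conv_law (linf_metric T) M (\<lambda>m \<omega>. \<lambda>t\<in>T. Y m t \<omega>) L)"


section \<open>Gaussian processes\<close>

text \<open>Degenerate (point mass) normal laws are included.\<close>

definition normal_law :: "real \<Rightarrow> real \<Rightarrow> real measure" where
  "normal_law \<mu> \<sigma> = (if \<sigma> = 0 then return borel \<mu> else density lborel (normal_density \<mu> \<sigma>))"

definition gaussian_process ::
  "'z measure \<Rightarrow> 't set \<Rightarrow> ('t \<Rightarrow> 'z \<Rightarrow> real) \<Rightarrow> ('t \<Rightarrow> real) \<Rightarrow> ('t \<Rightarrow> 't \<Rightarrow> real) \<Rightarrow> bool" where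
  "gaussian_process N T Z \<mu> K \<longleftrightarrow>
     prob_space N \<and>
     (\<forall>t\<in>T. Z t \<in> borel_measurable N) \<and>
     (\<forall>S c. finite S \<and> S \<subseteq> T \<longrightarrow>
        (\<exists>\<nu> \<sigma>. \<sigma> \<ge> 0 \<and> distr N borel (\<lambda>\<omega>. \<Sum>s\<in>S. c s * Z s \<omega>) = normal_law \<nu> \<sigma>)) \<and>
     (\<forall>t\<in>T. integral\<^sup>L N (Z t) = \<mu> t) \<and>
     (\<forall>s\<in>T. \<forall>t\<in>T. integral\<^sup>L N (\<lambda>\<omega>. (Z s \<omega> - \<mu> s) * (Z t \<omega> - \<mu> t)) = K s t)"


section \<open>The mixture model and the false discovery proportion\<close>

definition strictly_concave_on :: "real set \<Rightarrow> (real \<Rightarrow> real) \<Rightarrow> bool" where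
  "strictly_concave_on S f \<longleftrightarrow>
     convex S \<and>
     (\<forall>x\<in>S. \<forall>y\<in>S. \<forall>u. x \<noteq> y \<and> 0 < u \<and> u < 1 \<longrightarrow>
        u * f x + (1 - u) * f y < f (u * x + (1 - u) * y))"

definition distribution_function_01 :: "(real \<Rightarrow> real) \<Rightarrow> bool" where
  "distribution_function_01 F \<longleftrightarrow>
     (\<exists>D. real_distribution D \<and> measure D {0..1} = 1 \<and> F = cdf D)"

text \<open>
  A sample of size \<open>m\<close>; \<open>H i \<omega>\<close> being true encodes the value \<open>1\<close>, i.e. a false null hypothesis.
  The pairs are identically distributed because their common law is prescribed.
  Conditioning on an event is \<^const>\<open>uniform_measure\<close>; a conditional law is prescribed only if
  the conditioning event has positive probability.
\<close>

locale fdr_mixture_sample = prob_space M for M :: "'w measure" +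
  fixes m :: nat and a :: real and F :: "real \<Rightarrow> real"
    and P :: "nat \<Rightarrow> 'w \<Rightarrow> real" and H :: "nat \<Rightarrow> 'w \<Rightarrow> bool"
  assumes indep_pairs:
      "indep_vars (\<lambda>_. borel \<Otimes>\<^sub>M count_space UNIV) (\<lambda>i \<omega>. (P i \<omega>, H i \<omega>)) {1..m}"
    and law_H:
      "\<And>i. i \<in> {1..m} \<Longrightarrow> distr M (count_space UNIV) (H i) = measure_pmf (bernoulli_pmf a)"
    and law_P_null:
      "\<And>i. i \<in> {1..m} \<Longrightarrow> a < 1 \<Longrightarrow>
         distr (uniform_measure M {\<omega> \<in> space M. \<not> H i \<omega>}) borel (P i) =
         uniform_measure lborel {0<..<1}"
    and law_P_alternative:
      "\<And>i. i \<in> {1..m} \<Longrightarrow> 0 < a \<Longrightarrow>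
         cdf (distr (uniform_measure M {\<omega> \<in> space M. H i \<omega>}) borel (P i)) = F"

definition mixture_cdf :: "real \<Rightarrow> (real \<Rightarrow> real) \<Rightarrow> real \<Rightarrow> real" where
  "mixture_cdf a F t = (1 - a) * t + a * F t"

definition fdp ::
  "nat \<Rightarrow> (nat \<Rightarrow> 'w \<Rightarrow> real) \<Rightarrow> (nat \<Rightarrow> 'w \<Rightarrow> bool) \<Rightarrow> real \<Rightarrow> 'w \<Rightarrow> real" where
  "fdp m P H t \<omega> =
     (\<Sum>i=1..m. of_bool (P i \<omega> \<le> t) * (1 - of_bool (H i \<omega>))) /
     ((\<Sum>i=1..m. of_bool (P i \<omega> \<le> t)) + of_bool (\<forall>i\<in>{1..m}. P i \<omega> > t))"

definition fdp_limit :: "real \<Rightarrow> (real \<Rightarrow> real) \<Rightarrow> real \<Rightarrow> real" where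
  "fdp_limit a F t = (1 - a) * t / mixture_cdf a F t"

definition fdp_kernel :: "real \<Rightarrow> (real \<Rightarrow> real) \<Rightarrow> real \<Rightarrow> real \<Rightarrow> real" where
  "fdp_kernel a F s t =
     a * (1 - a) * (((1 - a) * s * t * F (min s t) + a * F s * F t * min s t) /
                    ((mixture_cdf a F s)\<^sup>2 * (mixture_cdf a F t)\<^sup>2))"

end

theory Submission
  imports Defs
begin

text \<open>
  Write \<open>G\<close> for the marginal distribution function of a \<open>p\<close>-value, \<open>Q t = (1 - a) * t / G t\<close>, and let \<open>U\<close> and
  \<open>V\<close> be the empirical processes of the false rejections, centred by \<open>(1 - a) * t\<close>, and of all rejections,
  centred by \<open>G\<close>. The process of interest is \<open>Y = (U - Q * V) / (G + V / sqrt m)\<close>, at every threshold at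
  which something is rejected. On \<open>{\<delta>..1}\<close> one has \<open>G t \<ge> t \<ge> \<delta>\<close>, so if \<open>U\<close> and \<open>V\<close> are bounded in
  probability, uniformly in \<open>t\<close>, then \<open>Y\<close> differs from \<open>X = (U - Q * V) / G\<close> uniformly by a term of order
  \<open>1 / sqrt m\<close> (\<open>fdp_linearization\<close>). Two things remain to be shown about \<open>X\<close>.

  The finite-dimensional distributions converge. Each \<open>X m t\<close> is a normalized sum of independent,
  bounded, centred scores, the covariances of which are those of the kernel (\<open>score_moments\<close>). By a
  central limit theorem for triangular arrays (\<open>char_normalized_sum_tendsto\<close>), the characteristic
  functions of linear combinations of values of \<open>X m\<close> converge to those of the Gaussian process.

  The paths are asymptotically equicontinuous: for large \<open>m\<close>, with high probability, replacing every
  \<open>t\<close> by the grid point on its left moves the path only slightly, once the grid is fine enough. Strict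
  concavity makes \<open>G\<close> Lipschitz on \<open>{\<delta>..1}\<close> (\<open>strictly_concave_increment\<close>). For a Lipschitz distribution
  function the increments of an empirical process over a dyadic cell that is not shorter than \<open>1 / m\<close> have
  exponential tails at the scale of the square root of the length of the cell, and summing over the dyadic levels proves
  equicontinuity (\<open>empirical_chaining\<close>, \<open>empirical_equicontinuous\<close>) and, as a consequence, uniform
  boundedness (\<open>empirical_bounded\<close>) of \<open>U\<close> and of \<open>V\<close>. Dividing by \<open>G\<close> and multiplying by \<open>Q\<close> preserves
  equicontinuity because both functions are continuous.

  Convergence of the finite-dimensional distributions and asymptotic equicontinuity imply weak
  convergence in the space of bounded functions (\<open>weak_conv_process_if_equicontinuous\<close>). The process
  \<open>Z\<close> is given without any path regularity, so its tight version has to be constructed: for a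
  sequence of ever finer grids, the processes that are constant on the grid cells are determined by
  finitely many values of \<open>Z\<close>, the bounds on the increments of \<open>Y\<close> are inherited by \<open>Z\<close> through the
  finite-dimensional convergence (\<open>increment_bound\<close>), and by summability these step processes converge
  uniformly, almost surely. Their limit has the finite-dimensional distributions of \<open>Z\<close>
  (\<open>Zlim_AE\<close>), its law is tight since its paths are uniform limits of step paths at a controlled rate
  (\<open>tight_L\<close>), and outer expectations of bounded continuous functionals of \<open>Y\<close> are compared with those
  of its step processes (\<open>weak_conv_L\<close>). The latter converge because bounded continuous functions of
  finitely many coordinates do (\<open>cramer_wold\<close>), which follows from the Stone-Weierstrass theorem and from
  Levy's continuity theorem in each coordinate.
\<close>

section \<open>Finite-dimensional convergence from linear combinations\<close>

text \<open>
  Finite sums of waves in the first \<open>k\<close> coordinates. The phase \<open>b\<close> makes this set contain the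
  constants and the sines; the product formula for cosines makes it an algebra. Integrals of its
  members are controlled by the characteristic functions of linear combinations of coordinates.
\<close>

inductive_set trig_sums :: "nat \<Rightarrow> ((nat \<Rightarrow> real) \<Rightarrow> real) set" for k where
  wave: "(\<lambda>x. a * cos ((\<Sum>j<k. c j * x j) + b)) \<in> trig_sums k"
| add: "f \<in> trig_sums k \<Longrightarrow> g \<in> trig_sums k \<Longrightarrow> (\<lambda>x. f x + g x) \<in> trig_sums k"

lemma trig_sums_const: "(\<lambda>x. a) \<in> trig_sums k"
  using trig_sums.wave[of a "\<lambda>_. 0" k 0] by simp

lemma trig_sums_sin:
  assumes "i < k"
  shows "(\<lambda>x. sin (x i / r)) \<in> trig_sums k"
proof -
  have "(\<Sum>j<k. (if j = i then 1 / r else 0) * x j) = x i / r" for x :: "nat \<Rightarrow> real"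
    using assms by (simp add: if_distrib[of "\<lambda>u. u * _"] cong: if_cong)
  then show ?thesis
    using trig_sums.wave[of 1 "\<lambda>j. if j = i then 1 / r else 0" k "- (pi / 2)"]
    by (simp add: cos_diff)
qed

lemma trig_sums_mult:
  assumes "f \<in> trig_sums k" "g \<in> trig_sums k"
  shows "(\<lambda>x. f x * g x) \<in> trig_sums k"
  using assms
proof (induction arbitrary: g)
  case (wave a c b)
  note f = this
  from f show ?case
  proof (induction)
    case (wave a' c' b')
    have eq: "a * cos ((\<Sum>j<k. c j * x j) + b) * (a' * cos ((\<Sum>j<k. c' j * x j) + b')) =
       (a * a' / 2) * cos ((\<Sum>j<k. (c j - c' j) * x j) + (b - b')) +
       (a * a' / 2) * cos ((\<Sum>j<k. (c j + c' j) * x j) + (b + b'))" for x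
    proof -
      have *: "cos u * cos v = cos (u - v) / 2 + cos (u + v) / 2" for u v :: real
        by (simp add: cos_diff cos_add field_simps)
      have sums:
        "(\<Sum>j<k. (c j - c' j) * x j) + (b - b') = ((\<Sum>j<k. c j * x j) + b) - ((\<Sum>j<k. c' j * x j) + b')"
        "(\<Sum>j<k. (c j + c' j) * x j) + (b + b') = ((\<Sum>j<k. c j * x j) + b) + ((\<Sum>j<k. c' j * x j) + b')"
        by (simp_all add: left_diff_distrib distrib_right sum_subtractf sum.distrib)
      have scale: "a * u * (a' * v) = (a * a' / 2) * p + (a * a' / 2) * q" if "u * v = p / 2 + q / 2"
        for u v p q :: real
      proof -
        have "a * u * (a' * v) = a * a' * (u * v)" by simp
        then show ?thesis unfolding that by (simp add: field_simps)
      qed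
      show ?thesis unfolding sums by (rule scale, rule *)
    qed
    show ?case unfolding eq by (intro trig_sums.intros)
  next
    case (add g h)
    then show ?case by (simp add: distrib_left trig_sums.add)
  qed
next
  case (add f h)
  then show ?case by (simp add: distrib_right trig_sums.add)
qed

lemma integral_cos_eq_char:
  assumes "prob_space M" and [measurable]: "X \<in> borel_measurable M"
  shows "(\<integral>\<omega>. a * cos (X \<omega> + b) \<partial>M) = a * Re (cis b * char (distr M borel X) 1)"
proof -
  interpret prob_space M by fact
  have int: "integrable M (\<lambda>\<omega>. cis (X \<omega>))"
    by (rule integrable_const_bound[of _ 1]) (auto simp: cis_conv_exp)
  have "char (distr M borel X) 1 = (\<integral>\<omega>. cis (X \<omega>) \<partial>M)"
    unfolding char_def by (subst integral_distr) (auto simp: cis_conv_exp)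
  then have "cis b * char (distr M borel X) 1 = (\<integral>\<omega>. cis (X \<omega> + b) \<partial>M)"
    by (simp add: cis_mult[symmetric] mult.commute)
  moreover have "integrable M (\<lambda>\<omega>. cis (X \<omega> + b))"
    by (rule integrable_const_bound[of _ 1]) (auto simp: cis_conv_exp)
  then have "Re (\<integral>\<omega>. cis (X \<omega> + b) \<partial>M) = (\<integral>\<omega>. cos (X \<omega> + b) \<partial>M)"
    by (subst integral_Re[symmetric]) auto
  ultimately show ?thesis by simp
qed

lemma trig_sums_integrable:
  assumes "prob_space M" "\<And>j. (\<lambda>\<omega>. U \<omega> j) \<in> borel_measurable M" "h \<in> trig_sums k"
  shows "integrable M (\<lambda>\<omega>. h (U \<omega>))"
proof -
  interpret prob_space M by fact
  note [measurable] = assms(2)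
  from assms(3) show ?thesis
  proof induction
    case (wave a c b)
    show ?case
      by (rule integrable_const_bound[of _ "\<bar>a\<bar>"]) (auto simp: abs_mult mult_left_le)
  qed auto
qed

context
  fixes M :: "nat \<Rightarrow> 'w measure" and N :: "'z measure" and k :: nat
    and U :: "nat \<Rightarrow> 'w \<Rightarrow> nat \<Rightarrow> real" and V :: "'z \<Rightarrow> nat \<Rightarrow> real"
  assumes M: "\<And>m. prob_space (M m)" and N: "prob_space N"
    and U: "\<And>m j. (\<lambda>\<omega>. U m \<omega> j) \<in> borel_measurable (M m)"
    and V: "\<And>j. (\<lambda>\<omega>. V \<omega> j) \<in> borel_measurable N"
    and conv: "\<And>c. (\<lambda>m. char (distr (M m) borel (\<lambda>\<omega>. \<Sum>j<k. c j * U m \<omega> j)) 1)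
                 \<longlonglongrightarrow> char (distr N borel (\<lambda>\<omega>. \<Sum>j<k. c j * V \<omega> j)) 1"
begin

lemma trig_sums_integral_tendsto:
  assumes h: "h \<in> trig_sums k"
  shows "(\<lambda>m. \<integral>\<omega>. h (U m \<omega>) \<partial>M m) \<longlonglongrightarrow> (\<integral>\<omega>. h (V \<omega>) \<partial>N)"
  using h
proof induction
  case (wave a c b)
  note [measurable] = U V
  show ?case
    by (subst (1 2) integral_cos_eq_char) (auto intro!: M N tendsto_intros conv)
next
  case (add f g)
  then show ?case
    by (auto simp: trig_sums_integrable M N U V intro!: tendsto_add)
qed

text \<open>
  In a single coordinate, scaling the linear combination gives the characteristic function at every
  argument, so Levy's continuity theorem applies. This is what controls the mass far away from \<open>0\<close>.
\<close>

lemma weak_conv_coordinate: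
  assumes i: "i < k"
    and g: "\<And>x. isCont g x" "\<And>x. norm (g x) \<le> B"
  shows "(\<lambda>m. \<integral>\<omega>. g (U m \<omega> i) \<partial>M m) \<longlonglongrightarrow> (\<integral>\<omega>. (g (V \<omega> i) :: real) \<partial>N)"
proof -
  note [measurable] = U V
  have [measurable]: "g \<in> borel_measurable borel"
    using g(1) by (auto intro!: borel_measurable_continuous_onI continuous_at_imp_continuous_on)
  have sum: "(\<Sum>j<k. (if j = i then t else 0) * x j) = t * x i" for t and x :: "nat \<Rightarrow> real"
    using i by (simp add: if_distrib[of "\<lambda>u. u * _"] cong: if_cong)
  have char_eq: "char (distr K borel (\<lambda>\<omega>. t * X \<omega>)) 1 = char (distr K borel X) t"
    if [measurable]: "X \<in> borel_measurable K" for K :: "'c measure" and X t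
    unfolding char_def by (subst (1 2) integral_distr) auto
  have "real_distribution (distr (M m) borel (\<lambda>\<omega>. U m \<omega> i))" for m
    using prob_space.real_distribution_distr[OF M U] .
  moreover have "real_distribution (distr N borel (\<lambda>\<omega>. V \<omega> i))"
    using prob_space.real_distribution_distr[OF N V] .
  moreover have "(\<lambda>m. char (distr (M m) borel (\<lambda>\<omega>. U m \<omega> i)) t)
      \<longlonglongrightarrow> char (distr N borel (\<lambda>\<omega>. V \<omega> i)) t" for t
    using conv[of "\<lambda>j. if j = i then t else 0"] unfolding sum by (simp add: char_eq)
  ultimately have "(\<lambda>m. integral\<^sup>L (distr (M m) borel (\<lambda>\<omega>. U m \<omega> i)) g) \<longlonglongrightarrow>
      integral\<^sup>L (distr N borel (\<lambda>\<omega>. V \<omega> i)) g"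
    using g by (intro weak_conv_imp_integral_bdd_continuous_conv levy_continuity)
  then show ?thesis
    by (simp add: integral_distr)
qed

text \<open>
  The Cramer-Wold device for arbitrary bounded continuous functions. For large \<open>r\<close> the map
  \<open>x \<mapsto> sin (x / r)\<close> is invertible by \<open>arcsin\<close> on the box where almost all the mass lies, so there
  \<open>f x = F (sin (x / r))\<close> with \<open>F\<close> continuous on the compact cube, and \<open>F\<close> has the same bound as
  \<open>f\<close>. A polynomial that approximates \<open>F\<close> on the cube becomes a member of \<^const>\<open>trig_sums\<close>
  that is close to \<open>F (sin (x / r))\<close> everywhere, also outside of the box.
\<close>

theorem cramer_wold:
  fixes f :: "(nat \<Rightarrow> real) \<Rightarrow> real"
  assumes f: "continuous_on UNIV f" "\<And>x. \<bar>f x\<bar> \<le> B" "\<And>x. f x = f (\<lambda>j. if j < k then x j else 0)"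
  shows "(\<lambda>m. \<integral>\<omega>. f (U m \<omega>) \<partial>M m) \<longlonglongrightarrow> (\<integral>\<omega>. f (V \<omega>) \<partial>N)"
proof (rule LIMSEQ_I)
  fix e :: real assume "e > 0"
  interpret N: prob_space N by fact
  interpret Mm: prob_space "M m" for m by fact
  note [measurable] = U V measurable_coordinatewise_then_product[OF U] measurable_coordinatewise_then_product[OF V]
  have [measurable]: "f \<in> borel_measurable borel"
    by (rule borel_measurable_continuous_onI[OF f(1)])
  have "B \<ge> 0" using f(2)[of "\<lambda>_. 0"] by simp
  \<comment> \<open>continuous majorant of the indicator of \<open>\<bar>x\<bar> > r + 1\<close>, to control the mass outside of the box\<close>
  define cut :: "real \<Rightarrow> real \<Rightarrow> real" where "cut r x = min 1 (max 0 (\<bar>x\<bar> - r))" for r x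
  have cut_cont: "isCont (cut r) x" for r x
    unfolding cut_def by (intro continuous_intros)
  have [measurable]: "cut r \<in> borel_measurable borel" for r
    unfolding cut_def by measurable
  have cut01: "0 \<le> cut r x" "cut r x \<le> 1" "norm (cut r x) \<le> 1" for r x
    unfolding cut_def by auto
  have cut_int: "integrable (M m) (\<lambda>\<omega>. cut r (U m \<omega> i))" "integrable N (\<lambda>\<omega>. cut r (V \<omega> i))" for m r i
    by (auto intro!: Mm.integrable_const_bound[of _ 1] N.integrable_const_bound[of _ 1] simp: cut01)
  have "(\<lambda>n. \<integral>\<omega>. cut (real n) (V \<omega> i) \<partial>N) \<longlonglongrightarrow> (\<integral>\<omega>. 0 \<partial>N)" for i
  proof (rule integral_dominated_convergence[of _ _ _ "\<lambda>_. 1"])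
    have "(\<lambda>n. cut (real n) x) \<longlonglongrightarrow> 0" for x
    proof (rule tendsto_eventually)
      show "eventually (\<lambda>n. cut (real n) x = 0) sequentially"
        using eventually_ge_at_top[of "nat \<lceil>\<bar>x\<bar>\<rceil>"]
        by eventually_elim (auto simp: cut_def nat_le_iff ceiling_le_iff)
    qed
    then show "AE \<omega> in N. (\<lambda>n. cut (real n) (V \<omega> i)) \<longlonglongrightarrow> 0" by simp
  qed (auto simp: cut01)
  then have "(\<lambda>n. \<Sum>i<k. \<integral>\<omega>. cut (real n) (V \<omega> i) \<partial>N) \<longlonglongrightarrow> (\<Sum>i<k. 0)"
    by (intro tendsto_sum) simp
  \<comment> \<open>tail mass \<open>d\<close> costs \<open>2 B d \<le> e / 6\<close> for either process; with \<open>e / 12\<close> for each approximation the total stays below \<open>e\<close>\<close>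
  moreover define d where "d = e / (12 * (B + 1))"
  moreover have "d > 0" using \<open>e > 0\<close> \<open>B \<ge> 0\<close> unfolding d_def by simp
  ultimately have "eventually (\<lambda>n. (\<Sum>i<k. \<integral>\<omega>. cut (real n) (V \<omega> i) \<partial>N) < d) sequentially"
    by (intro order_tendstoD) auto
  then obtain n where n: "(\<Sum>i<k. \<integral>\<omega>. cut (real n) (V \<omega> i) \<partial>N) < d"
    by (auto simp: eventually_sequentially)
  define r where "r = real n + 1"
  have "r > 0" unfolding r_def by simp
  \<comment> \<open>the cube, with the irrelevant coordinates collapsed so that the sines of the first \<open>k\<close> separate its points\<close>
  define S :: "(nat \<Rightarrow> real) set" where "S = PiE UNIV (\<lambda>j. if j < k then {-1..1} else {0})"
  define w :: "(nat \<Rightarrow> real) \<Rightarrow> nat \<Rightarrow> real" where "w x = (\<lambda>j. if j < k then sin (x j / r) else 0)" for x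
  have w_S: "w x \<in> S" for x unfolding S_def w_def by auto
  define F where "F z = f (\<lambda>j. r * arcsin (z j))" for z
  have "compact S"
  proof -
    have "compactin (product_topology (\<lambda>i. euclidean) UNIV) S"
      unfolding S_def by (subst compactin_PiE) auto
    then show ?thesis by (simp add: euclidean_product_topology)
  qed
  have F_cont: "continuous_on S F"
    unfolding F_def
  proof (rule continuous_on_compose2[OF f(1)])
    have coord: "continuous_on S (\<lambda>z. z i)" for i
      by (rule continuous_on_subset[OF continuous_on_product_coordinates]) simp
    have "z i \<in> {-1..1}" if "z \<in> S" for z i
      using PiE_mem[OF that[unfolded S_def], of i] by (auto split: if_splits)
    then have "continuous_on S (\<lambda>z. r * arcsin (z i))" for i
      by (intro continuous_intros coord) auto
    then show "continuous_on S (\<lambda>z j. r * arcsin (z j))"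
      by (rule continuous_on_coordinatewise_then_product)
  qed auto
  \<comment> \<open>the continuous functions on the cube that pull back along \<open>w\<close> to sums of waves\<close>
  define trig where "trig p \<longleftrightarrow> continuous_on S p \<and> (\<exists>h\<in>trig_sums k. \<forall>x. p (w x) = h x)" for p
  have trigE: "\<exists>h\<in>trig_sums k. \<forall>x. p (w x) = h x" "continuous_on S p" if "trig p" for p
    using that unfolding trig_def by auto
  have "\<exists>P. trig P \<and> (\<forall>z\<in>S. \<bar>F z - P z\<bar> < e / 12)"
  proof (rule Stone_Weierstrass_HOL)
    show "trig (\<lambda>x. c)" for c
      unfolding trig_def using trig_sums_const[of c k] by (auto intro: bexI[of _ "\<lambda>_. c"])
    show "trig (\<lambda>x. p x + q x)" if pq: "trig p \<and> trig q" for p q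
    proof -
      obtain g h where "g \<in> trig_sums k" "h \<in> trig_sums k" "\<And>x. p (w x) = g x" "\<And>x. q (w x) = h x"
        using pq unfolding trig_def by auto
      then show ?thesis
        using pq unfolding trig_def by (auto intro!: continuous_intros bexI[OF _ trig_sums.add[of g k h]])
    qed
    show "trig (\<lambda>x. p x * q x)" if pq: "trig p \<and> trig q" for p q
    proof -
      obtain g h where "g \<in> trig_sums k" "h \<in> trig_sums k" "\<And>x. p (w x) = g x" "\<And>x. q (w x) = h x"
        using pq unfolding trig_def by auto
      then show ?thesis
        using pq unfolding trig_def by (auto intro!: continuous_intros bexI[OF _ trig_sums_mult[of g k h]])
    qed
    show "\<exists>p. trig p \<and> p x \<noteq> p y" if "x \<in> S \<and> y \<in> S \<and> x \<noteq> y" for x y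
    proof -
      from that obtain j where j: "x j \<noteq> y j" by auto
      with that have "j < k" unfolding S_def PiE_iff by (metis UNIV_I singletonD)
      then have "\<exists>h\<in>trig_sums k. \<forall>x. w x j = h x"
        using trig_sums_sin[of j k r] by (auto simp: w_def)
      then show ?thesis using j unfolding trig_def
        by (intro exI[of _ "\<lambda>x. x j"]) (auto intro!: continuous_on_product_coordinates continuous_on_subset[of UNIV])
    qed
    show "e / 12 > 0" using \<open>e > 0\<close> by simp
  qed (use \<open>compact S\<close> F_cont trigE(2) in auto)
  then obtain P where P: "\<exists>h\<in>trig_sums k. \<forall>x. P (w x) = h x" "\<And>z. z \<in> S \<Longrightarrow> \<bar>F z - P z\<bar> < e / 12"
    using trigE(1) by blast
  from P(1) obtain h where h: "h \<in> trig_sums k" "\<And>x. P (w x) = h x" by blast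
  have h_close: "\<bar>F (w x) - h x\<bar> \<le> e / 12" for x
    using P(2)[OF w_S[of x]] h(2)[of x] by simp
  have F_eq: "\<bar>f x - F (w x)\<bar> \<le> 2 * B * (\<Sum>i<k. cut (real n) (x i))" for x
  proof (cases "\<forall>i<k. \<bar>x i\<bar> \<le> r")
    case True
    have "F (w x) = f (\<lambda>j. if j < k then x j else 0)"
      unfolding F_def
    proof (rule arg_cong[of _ _ f], rule ext)
      fix j
      show "r * arcsin (w x j) = (if j < k then x j else 0)"
      proof (cases "j < k")
        case j: True
        then have "\<bar>x j / r\<bar> \<le> 1" using True \<open>r > 0\<close> by (simp add: abs_divide)
        moreover have "1 \<le> pi / 2" using pi_ge_two by simp
        ultimately have "- (pi / 2) \<le> x j / r" "x j / r \<le> pi / 2" by linarith+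
        then show ?thesis using j \<open>r > 0\<close> by (simp add: w_def arcsin_sin)
      qed (simp add: w_def)
    qed
    then have "f x - F (w x) = 0" using f(3)[of x] by simp
    then show ?thesis using \<open>B \<ge> 0\<close> by (auto intro!: mult_nonneg_nonneg sum_nonneg cut01)
  next
    case False
    then obtain i where i: "i < k" "\<bar>x i\<bar> > r" by auto
    then have "cut (real n) (x i) = 1" unfolding cut_def r_def by auto
    then have "1 \<le> (\<Sum>i<k. cut (real n) (x i))"
      using i by (metis cut01(1) finite_lessThan lessThan_iff member_le_sum)
    moreover have "\<bar>f x - F (w x)\<bar> \<le> 2 * B"
      using f(2)[of x] f(2)[of "\<lambda>j. r * arcsin (w x j)"] unfolding F_def by linarith
    ultimately show ?thesis using \<open>B \<ge> 0\<close>
      by (smt (verit) mult_left_le_imp_le mult_le_cancel_left1)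
  qed
  \<comment> \<open>on the box the two functions agree up to the polynomial approximation; outside, both are bounded by \<open>B\<close>\<close>
  have fh: "\<bar>f x - h x\<bar> \<le> e / 12 + 2 * B * (\<Sum>i<k. cut (real n) (x i))" for x
    using F_eq[of x] h_close[of x] by linarith
  have gen: "\<bar>(\<integral>\<omega>. f (X \<omega>) \<partial>K) - (\<integral>\<omega>. h (X \<omega>) \<partial>K)\<bar> \<le> e / 12 + 2 * B * (\<Sum>i<k. \<integral>\<omega>. cut (real n) (X \<omega> i) \<partial>K)"
    if K: "prob_space K" and X: "\<And>j. (\<lambda>\<omega>. X \<omega> j) \<in> borel_measurable K"
    for K :: "'c measure" and X
  proof -
    interpret K: prob_space K by fact
    note [measurable] = X measurable_coordinatewise_then_product[OF X]
    have i1: "integrable K (\<lambda>\<omega>. f (X \<omega>))"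
      using f(2) by (auto intro!: K.integrable_const_bound[of _ B])
    have i2: "integrable K (\<lambda>\<omega>. h (X \<omega>))"
      by (rule trig_sums_integrable[OF K X h(1)])
    have i3: "integrable K (\<lambda>\<omega>. cut (real n) (X \<omega> i))" for i
      by (auto intro!: K.integrable_const_bound[of _ 1] simp: cut01)
    have "\<bar>(\<integral>\<omega>. f (X \<omega>) \<partial>K) - (\<integral>\<omega>. h (X \<omega>) \<partial>K)\<bar> = \<bar>\<integral>\<omega>. f (X \<omega>) - h (X \<omega>) \<partial>K\<bar>"
      using i1 i2 by simp
    also have "\<dots> \<le> (\<integral>\<omega>. \<bar>f (X \<omega>) - h (X \<omega>)\<bar> \<partial>K)"
      by (rule integral_abs_bound)
    also have "\<dots> \<le> (\<integral>\<omega>. e / 12 + 2 * B * (\<Sum>i<k. cut (real n) (X \<omega> i)) \<partial>K)"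
      using i1 i2 i3 fh by (intro integral_mono) auto
    also have "\<dots> = e / 12 + 2 * B * (\<Sum>i<k. \<integral>\<omega>. cut (real n) (X \<omega> i) \<partial>K)"
      using i3 by (simp add: K.prob_space)
    finally show ?thesis .
  qed
  have "(\<lambda>m. \<Sum>i<k. \<integral>\<omega>. cut (real n) (U m \<omega> i) \<partial>M m) \<longlonglongrightarrow> (\<Sum>i<k. \<integral>\<omega>. cut (real n) (V \<omega> i) \<partial>N)"
    by (intro tendsto_sum weak_conv_coordinate[OF _ cut_cont, where B = 1] cut01(3)) auto
  then have ev1: "eventually (\<lambda>m. (\<Sum>i<k. \<integral>\<omega>. cut (real n) (U m \<omega> i) \<partial>M m) < d) sequentially"
    using n by (rule order_tendstoD)
  have ev2: "eventually (\<lambda>m. \<bar>(\<integral>\<omega>. h (U m \<omega>) \<partial>M m) - (\<integral>\<omega>. h (V \<omega>) \<partial>N)\<bar> < e / 12) sequentially"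
    using tendstoD[OF trig_sums_integral_tendsto[OF h(1)], of "e / 12"] \<open>e > 0\<close>
    by (simp add: dist_real_def)
  have Bd: "2 * B * x \<le> e / 6" if "x < d" for x
  proof -
    have "2 * B * x \<le> 2 * (B + 1) * d"
      using that \<open>B \<ge> 0\<close> \<open>d > 0\<close>
      by (smt (verit) mult_left_mono mult_nonneg_nonneg mult_right_mono)
    also have "\<dots> = e / 6" using \<open>B \<ge> 0\<close> unfolding d_def by (simp add: field_simps)
    finally show ?thesis .
  qed
  have "eventually (\<lambda>m. norm ((\<integral>\<omega>. f (U m \<omega>) \<partial>M m) - (\<integral>\<omega>. f (V \<omega>) \<partial>N)) < e) sequentially"
    using ev1 ev2
  proof eventually_elim
    case (elim m)
    have "\<bar>(\<integral>\<omega>. f (U m \<omega>) \<partial>M m) - (\<integral>\<omega>. h (U m \<omega>) \<partial>M m)\<bar> \<le> e / 12 + e / 6"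
      using gen[of "M m" "U m", OF M U] Bd[OF elim(1)] by linarith
    moreover have "\<bar>(\<integral>\<omega>. f (V \<omega>) \<partial>N) - (\<integral>\<omega>. h (V \<omega>) \<partial>N)\<bar> \<le> e / 12 + e / 6"
      using gen[of N V, OF N V] Bd[OF n] by linarith
    ultimately show ?case using elim(2) \<open>e > 0\<close> unfolding real_norm_def by linarith
  qed
  then show "\<exists>no. \<forall>m\<ge>no. norm ((\<integral>\<omega>. f (U m \<omega>) \<partial>M m) - (\<integral>\<omega>. f (V \<omega>) \<partial>N)) < e"
    by (simp add: eventually_sequentially)
qed

end

section \<open>The space of bounded functions\<close>

abbreviation linf_topology :: "'t set \<Rightarrow> ('t \<Rightarrow> real) topology" where
  "linf_topology T \<equiv> mtopology_of (linf_metric T)"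

abbreviation linf_continuous :: "'t set \<Rightarrow> (('t \<Rightarrow> real) \<Rightarrow> real) \<Rightarrow> bool" where
  "linf_continuous T h \<equiv> continuous_map (linf_topology T) euclideanreal h"

lemma Metric_space_linf_mdist: "Metric_space (linf_space T) (mdist (linf_metric T))"
  using Metric_space_mspace_mdist[of "linf_metric T"] by simp

lemma mtopology_of_linf:
  "linf_topology T = Metric_space.mtopology (linf_space T) (mdist (linf_metric T))"
  by (simp add: mtopology_of_def)

lemma linf_spaceI: "f \<in> extensional T \<Longrightarrow> (\<And>t. t \<in> T \<Longrightarrow> \<bar>f t\<bar> \<le> B) \<Longrightarrow> f \<in> linf_space T"
  unfolding linf_space_def by (auto simp: bounded_iff)

lemma linf_dist_commute: "linf_dist T f g = linf_dist T g f"
  by (simp add: linf_dist_def abs_minus_commute)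

lemma linf_dist_triangle:
  assumes "f \<in> linf_space T" "g \<in> linf_space T" "h \<in> linf_space T"
  shows "linf_dist T f h \<le> linf_dist T f g + linf_dist T g h"
  using mdist_triangle[of f "linf_metric T" g h] assms by (simp add: mdist_linf_metric)

lemma linf_dist_self: "f \<in> linf_space T \<Longrightarrow> linf_dist T f f = 0"
  using mdist_zero[of f "linf_metric T" f] by (simp add: mdist_linf_metric)

lemma linf_metric_eq_funspace: "linf_metric T = funspace T euclidean_metric"
proof -
  have space: "linf_space T = Met_TC.fspace T"
    by (auto simp: linf_space_def Met_TC.fspace_def)
  have "(if f \<in> linf_space T \<and> g \<in> linf_space T then linf_dist T f g else 0) = Met_TC.fdist T f g" for f g
  proof (cases "f \<in> linf_space T \<and> g \<in> linf_space T \<and> T \<noteq> {}")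
    case True
    then obtain t where t: "t \<in> T" by blast
    have bdd: "bdd_above ((\<lambda>t. \<bar>f t - g t\<bar>) ` T)" using linf_dist_bdd[of f T g] True by simp
    have "0 \<le> Sup ((\<lambda>t. \<bar>f t - g t\<bar>) ` T)"
      using t by (intro cSUP_upper2[OF bdd, of t]) auto
    then have "linf_dist T f g = Sup ((\<lambda>t. \<bar>f t - g t\<bar>) ` T)"
      unfolding linf_dist_def using t bdd by (subst cSup_insert) (auto simp: sup_max)
    then show ?thesis using True by (simp add: Met_TC.fdist_def space[symmetric] dist_real_def)
  qed (auto simp: Met_TC.fdist_def space[symmetric] linf_dist_def)
  then show ?thesis
    unfolding linf_metric_def funspace_def by (simp add: space)
qed

text \<open>
  Completeness is what makes the closure of a totally bounded set of paths compact.
\<close>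

lemma mcomplete_linf: "Metric_space.mcomplete (linf_space T) (mdist (linf_metric T))"
proof -
  have "mcomplete_of (linf_metric T)"
    using Met_TC.mcomplete_funspace[of T, where ?'a = real] complete_UNIV
    unfolding linf_metric_eq_funspace Met_TC.Self_def euclidean_metric_def by auto
  then show ?thesis by (simp add: mcomplete_of_def)
qed

lemma continuous_map_linf_real:
  "linf_continuous T h \<longleftrightarrow>
     (\<forall>f\<in>linf_space T. \<forall>e>0. \<exists>d>0. \<forall>g\<in>linf_space T. linf_dist T f g < d \<longrightarrow> \<bar>h f - h g\<bar> < e)"
proof -
  interpret L: Metric_space "linf_space T" "mdist (linf_metric T)" by (rule Metric_space_linf_mdist)
  have "continuous_map L.mtopology Met_TC.mtopology h \<longleftrightarrow>
     h ` linf_space T \<subseteq> UNIV \<and> (\<forall>f\<in>linf_space T. \<forall>e>0. \<exists>d>0. \<forall>g. g \<in> linf_space T \<and> mdist (linf_metric T) f g < d \<longrightarrow> dist (h f) (h g) < e)"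
    by (rule L.metric_continuous_map) unfold_locales
  then show ?thesis
    by (auto simp: mtopology_of_linf mdist_linf_metric dist_real_def) (metis mdist_linf_metric)+
qed

lemma space_metric_borel: "space (metric_borel X) = mspace X"
  unfolding metric_borel_def by (subst space_measure_of) (use openin_subset in force)+

lemma sets_metric_borel: "sets (metric_borel X) = sigma_sets (mspace X) {U. openin (mtopology_of X) U}"
  unfolding metric_borel_def by (subst sets_measure_of) (use openin_subset in force)+

lemma borel_measurable_metric_borel:
  assumes "continuous_map (mtopology_of X) euclideanreal h"
  shows "h \<in> borel_measurable (metric_borel X)"
proof (rule borel_measurableI)
  fix S :: "real set" assume "open S"
  have "openin (mtopology_of X) {x \<in> topspace (mtopology_of X). h x \<in> S}"
    using assms \<open>open S\<close> by (intro openin_continuous_map_preimage) auto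
  then have "{x \<in> mspace X. h x \<in> S} \<in> sets (metric_borel X)"
    unfolding sets_metric_borel by (intro sigma_sets.Basic) simp
  then show "h -` S \<inter> space (metric_borel X) \<in> sets (metric_borel X)"
    by (simp add: space_metric_borel vimage_def Int_def conj_commute)
qed

lemma closedin_sets_metric_borel:
  assumes "closedin (mtopology_of X) C"
  shows "C \<in> sets (metric_borel X)"
proof -
  have "mspace X - C \<in> sets (metric_borel X)"
    unfolding sets_metric_borel using assms by (intro sigma_sets.Basic) (simp add: closedin_def)
  from sets.compl_sets[OF this] show ?thesis
    using closedin_subset[OF assms] by (simp add: space_metric_borel double_diff)
qed

lemma continuous_evaluation: "t \<in> T \<Longrightarrow> linf_continuous T (\<lambda>f. f t)"
  unfolding continuous_map_linf_real by (meson linf_dist_ge le_less_trans)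

text \<open>
  The distance to a set is Lipschitz, and a closed set is its zero set. This reduces questions about
  the Borel sets of a nonseparable space to questions about continuous real functions.
\<close>

definition linf_setdist :: "'t set \<Rightarrow> ('t \<Rightarrow> real) set \<Rightarrow> ('t \<Rightarrow> real) \<Rightarrow> real" where
  "linf_setdist T C f = Inf (linf_dist T f ` C)"

context
  fixes T :: "'t set" and C :: "('t \<Rightarrow> real) set"
  assumes C: "C \<subseteq> linf_space T" "C \<noteq> {}"
begin

lemma linf_setdist_bdd: "f \<in> linf_space T \<Longrightarrow> bdd_below (linf_dist T f ` C)"
  using C by (intro bdd_belowI[of _ 0]) (auto intro!: linf_dist_nonneg)

lemma linf_setdist_le: "f \<in> linf_space T \<Longrightarrow> g \<in> C \<Longrightarrow> linf_setdist T C f \<le> linf_dist T f g"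
  unfolding linf_setdist_def by (intro cInf_lower linf_setdist_bdd) auto

lemma linf_setdist_nonneg: "f \<in> linf_space T \<Longrightarrow> 0 \<le> linf_setdist T C f"
  unfolding linf_setdist_def using C by (intro cInf_greatest) (auto intro!: linf_dist_nonneg)

lemma linf_setdist_lessD: "linf_setdist T C f < r \<Longrightarrow> \<exists>g\<in>C. linf_dist T f g < r"
  unfolding linf_setdist_def using C cInf_lessD[of "linf_dist T f ` C" r] by auto

lemma linf_setdist_triangle:
  assumes "f \<in> linf_space T" "g \<in> linf_space T"
  shows "linf_setdist T C f \<le> linf_dist T f g + linf_setdist T C g"
proof (rule field_le_epsilon)
  fix e :: real assume "e > 0"
  then have "linf_setdist T C g < linf_setdist T C g + e" by simp
  from linf_setdist_lessD[OF this] obtain c where c: "c \<in> C" "linf_dist T g c < linf_setdist T C g + e" by auto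
  have "linf_setdist T C f \<le> linf_dist T f c" using assms c(1) by (intro linf_setdist_le)
  also have "\<dots> \<le> linf_dist T f g + linf_dist T g c" using assms c(1) C by (intro linf_dist_triangle) auto
  finally show "linf_setdist T C f \<le> linf_dist T f g + linf_setdist T C g + e" using c(2) by linarith
qed

lemma linf_setdist_lipschitz:
  assumes "f \<in> linf_space T" "g \<in> linf_space T"
  shows "\<bar>linf_setdist T C f - linf_setdist T C g\<bar> \<le> linf_dist T f g"
  using linf_setdist_triangle[OF assms] linf_setdist_triangle[OF assms(2,1)]
  by (simp add: linf_dist_commute[of T g f] abs_le_iff)

lemma continuous_linf_setdist: "linf_continuous T (linf_setdist T C)"
  unfolding continuous_map_linf_real using linf_setdist_lipschitz by (meson le_less_trans)

lemma linf_setdist_eq_0_iff: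
  assumes "closedin (linf_topology T) C" "f \<in> linf_space T"
  shows "linf_setdist T C f = 0 \<longleftrightarrow> f \<in> C"
proof
  assume "f \<in> C"
  then show "linf_setdist T C f = 0"
    using linf_setdist_le[of f f] linf_setdist_nonneg[of f] linf_dist_self[of f T] assms by simp
next
  interpret L: Metric_space "linf_space T" "mdist (linf_metric T)" by (rule Metric_space_linf_mdist)
  assume 0: "linf_setdist T C f = 0"
  show "f \<in> C"
  proof (rule ccontr)
    assume "f \<notin> C"
    then obtain r where r: "r > 0" "disjnt C (L.mball f r)"
      using assms unfolding mtopology_of_linf L.closedin_metric by blast
    with 0 linf_setdist_lessD[of f r] obtain g where "g \<in> C" "linf_dist T f g < r" by auto
    with r C assms show False
      by (auto simp: disjnt_iff mdist_linf_metric)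
  qed
qed

end

text \<open>
  Paths that take finitely many values, \<open>x j\<close> at the times with index \<open>j\<close>. They depend continuously on
  these values, which is the bridge from finite-dimensional distributions to the space of paths.
\<close>

definition step_path :: "'t set \<Rightarrow> ('t \<Rightarrow> nat) \<Rightarrow> (nat \<Rightarrow> real) \<Rightarrow> 't \<Rightarrow> real" where
  "step_path T \<iota> x = (\<lambda>t\<in>T. x (\<iota> t))"

lemma step_path_in_linf:
  assumes "\<And>t. t \<in> T \<Longrightarrow> \<iota> t < k"
  shows "step_path T \<iota> x \<in> linf_space T"
proof (rule linf_spaceI)
  show "\<bar>step_path T \<iota> x t\<bar> \<le> (\<Sum>j<k. \<bar>x j\<bar>)" if "t \<in> T" for t
    using that assms[OF that] member_le_sum[of "\<iota> t" "{..<k}" "\<lambda>j. \<bar>x j\<bar>"] by (simp add: step_path_def)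
qed (simp add: step_path_def)

lemma continuous_step_path:
  assumes k: "\<And>t. t \<in> T \<Longrightarrow> \<iota> t < k"
  shows "continuous_map euclidean (linf_topology T) (step_path T \<iota>)"
proof -
  interpret L: Metric_space "linf_space T" "mdist (linf_metric T)" by (rule Metric_space_linf_mdist)
  show ?thesis
    unfolding mtopology_of_linf L.continuous_map_to_metric
  proof (intro ballI allI impI)
    fix x :: "nat \<Rightarrow> real" and e :: real assume "e > 0"
    define U where "U = (\<Inter>j\<in>{..<k}. {y. \<bar>y j - x j\<bar> < e / 2})"
    have "open U"
      unfolding U_def by (intro open_INT ballI finite_lessThan open_Collect_less continuous_intros continuous_on_product_coordinates)
    moreover have "x \<in> U" using \<open>e > 0\<close> by (simp add: U_def)
    moreover have "step_path T \<iota> y \<in> L.mball (step_path T \<iota> x) e" if "y \<in> U" for y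
    proof -
      have "linf_dist T (step_path T \<iota> x) (step_path T \<iota> y) \<le> e / 2"
      proof (rule linf_dist_le)
        fix t assume "t \<in> T"
        then show "\<bar>step_path T \<iota> x t - step_path T \<iota> y t\<bar> \<le> e / 2"
          using that k[of t] unfolding U_def step_path_def by (auto simp: abs_minus_commute intro: less_imp_le)
      qed (use \<open>e > 0\<close> in simp)
      then show ?thesis
        using \<open>e > 0\<close> step_path_in_linf[of T \<iota> k, OF k] by (simp add: mdist_linf_metric)
    qed
    ultimately show "\<exists>U. openin euclidean U \<and> x \<in> U \<and> (\<forall>y\<in>U. step_path T \<iota> y \<in> L.mball (step_path T \<iota> x) e)"
      by auto
  qed
qed

lemma continuous_on_step_path:
  assumes "\<And>t. t \<in> T \<Longrightarrow> \<iota> t < k"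
    and "linf_continuous T h"
  shows "continuous_on UNIV (\<lambda>x. h (step_path T \<iota> x))"
  using continuous_map_compose[OF continuous_step_path assms(2), of \<iota> k] assms(1)
  by (simp add: comp_def)

text \<open>
  The constant \<open>3\<close> is the one that the increments of the step processes below will satisfy.
\<close>

lemma dyadic_increments_limit:
  fixes a :: "nat \<Rightarrow> real"
  assumes inc: "\<And>n. n \<ge> k \<Longrightarrow> \<bar>a (Suc n) - a n\<bar> \<le> 3 * (1/2) ^ n" and n: "n \<ge> k"
  shows "\<bar>lim a - a n\<bar> \<le> 6 * (1/2) ^ n"
proof -
  define b where "b j = a (Suc (j + n)) - a (j + n)" for j
  have b: "norm (b j) \<le> 3 * (1/2) ^ n * (1/2) ^ j" for j
    using inc[of "j + n"] n by (simp add: b_def power_add mult.commute mult.left_commute)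
  have geom: "(\<lambda>j. 3 * (1/2) ^ n * (1/2::real) ^ j) sums (6 * (1/2) ^ n)"
    using sums_mult[OF geometric_sums[of "1/2::real"], of "3 * (1/2) ^ n"] by simp
  have summ: "summable b" by (rule summable_comparison_test'[OF sums_summable[OF geom] b])
  have "(\<lambda>j. a n + (\<Sum>i<j. b i)) \<longlonglongrightarrow> a n + suminf b"
    by (intro tendsto_add tendsto_const summable_LIMSEQ[OF summ])
  moreover have "a n + (\<Sum>i<j. b i) = a (j + n)" for j
    unfolding b_def using sum_lessThan_telescope[of "\<lambda>i. a (i + n)" j] by simp
  ultimately have lim: "a \<longlonglongrightarrow> a n + suminf b" by (simp add: LIMSEQ_offset)
  show ?thesis
    unfolding limI[OF lim] using norm_suminf_le[OF b sums_summable[OF geom]] sums_unique[OF geom] by simp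
qed
text \<open>
  A Lebesgue number argument. This is stronger than uniform continuity on \<open>K\<close>: the point \<open>g\<close> ranges
  over the whole space, as it must when \<open>g\<close> is a path of a process that never visits \<open>K\<close>.
\<close>

lemma continuous_map_uniform_near_compact:
  assumes K: "compactin (linf_topology T) K"
    and h: "linf_continuous T h" and "e > 0"
  shows "\<exists>r>0. \<forall>f\<in>K. \<forall>g\<in>linf_space T. linf_dist T f g < r \<longrightarrow> \<bar>h f - h g\<bar> < e"
proof -
  interpret L: Metric_space "linf_space T" "mdist (linf_metric T)" by (rule Metric_space_linf_mdist)
  have Ks: "K \<subseteq> linf_space T" using compactin_subset_topspace[OF K] by simp
  define V where "V f = {g \<in> topspace (linf_topology T). h g \<in> ball (h f) (e/2)}" for f
  have "\<exists>r>0. \<forall>x\<in>K. \<exists>U\<in>V ` K. L.mball x r \<subseteq> U"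
  proof (rule L.lebesgue_number)
    show "compactin L.mtopology K" using K by (simp add: mtopology_of_linf)
    show "K \<subseteq> \<Union> (V ` K)" using Ks \<open>e > 0\<close> by (auto simp: V_def)
    show "openin L.mtopology U" if "U \<in> V ` K" for U
      using that openin_continuous_map_preimage[OF h, of "ball (h _) (e/2)"]
      unfolding V_def mtopology_of_linf[symmetric] by auto
  qed
  then obtain r where r: "r > 0" "\<And>x. x \<in> K \<Longrightarrow> \<exists>U\<in>V ` K. L.mball x r \<subseteq> U" by auto
  have "\<bar>h f - h g\<bar> < e" if fg: "f \<in> K" "g \<in> linf_space T" "linf_dist T f g < r" for f g
  proof -
    obtain c where c: "c \<in> K" "L.mball f r \<subseteq> V c" using r(2)[OF fg(1)] by auto
    have "f \<in> L.mball f r" "g \<in> L.mball f r"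
      using fg Ks r(1) by (auto simp: mdist_linf_metric linf_dist_self)
    with c have "f \<in> V c" "g \<in> V c" by auto
    then have "\<bar>h c - h f\<bar> < e / 2" "\<bar>h c - h g\<bar> < e / 2"
      unfolding V_def by (auto simp: dist_real_def)
    then show ?thesis by linarith
  qed
  with r(1) show ?thesis by auto
qed

text \<open>
  The centres of the covering balls need not belong to \<open>S\<close>: doubling the radius, each ball that meets
  \<open>S\<close> may be recentred at a point of \<open>S\<close>.
\<close>

lemma (in Metric_space) mtotally_bounded_if_covered:
  assumes S: "S \<subseteq> M" and cover: "\<And>e. e > 0 \<Longrightarrow> \<exists>F. finite F \<and> S \<subseteq> (\<Union>x\<in>F. mball x e)"
  shows "mtotally_bounded S"
  unfolding mtotally_bounded_def
proof (intro allI impI)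
  fix e :: real assume "e > 0"
  then obtain F where F: "finite F" "S \<subseteq> (\<Union>x\<in>F. mball x (e / 2))" using cover[of "e / 2"] by auto
  define c where "c x = (SOME y. y \<in> S \<and> y \<in> mball x (e / 2))" for x
  define F' where "F' = {x \<in> F. \<exists>y. y \<in> S \<and> y \<in> mball x (e / 2)}"
  have c: "c x \<in> S" "c x \<in> mball x (e / 2)" if "x \<in> F'" for x
    using someI_ex[of "\<lambda>y. y \<in> S \<and> y \<in> mball x (e / 2)"] that unfolding F'_def c_def by auto
  have "y \<in> (\<Union>x\<in>c ` F'. mball x e)" if y: "y \<in> S" for y
  proof -
    obtain x where x: "x \<in> F'" "y \<in> mball x (e / 2)" using F(2) y unfolding F'_def by blast
    then have "d (c x) y < e"
      using c(2)[OF x(1)] triangle[of "c x" x y] by (simp add: commute)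
    then show ?thesis using x(1) c(1)[OF x(1)] S y by auto
  qed
  then show "\<exists>K. finite K \<and> K \<subseteq> S \<and> S \<subseteq> (\<Union>x\<in>K. mball x e)"
    using F(1) c(1) by (intro exI[of _ "c ` F'"]) (auto simp: F'_def)
qed

text \<open>
  A nonmeasurable function is handled by comparison with an integrable one: \<open>w + d\<close> is among the
  majorants of \<open>f\<close>, and every majorant of \<open>f\<close> lies above \<open>w - d\<close>.
\<close>

lemma outer_expectation_close:
  assumes w: "integrable M w" and d: "integrable M d"
    and close: "\<And>\<omega>. \<omega> \<in> space M \<Longrightarrow> \<bar>f \<omega> - w \<omega>\<bar> \<le> d \<omega>"
  shows "\<bar>outer_expectation M f - integral\<^sup>L M w\<bar> \<le> integral\<^sup>L M d"
proof -
  let ?S = "{integral\<^sup>L M u |u. integrable M u \<and> (\<forall>\<omega>\<in>space M. f \<omega> \<le> u \<omega>)}"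
  have up: "f \<omega> \<le> w \<omega> + d \<omega>" and lo: "w \<omega> - d \<omega> \<le> f \<omega>" if "\<omega> \<in> space M" for \<omega>
    using close[OF that] by linarith+
  have lower: "integral\<^sup>L M w - integral\<^sup>L M d \<le> x" if "x \<in> ?S" for x
  proof -
    from that obtain u where u: "x = integral\<^sup>L M u" "integrable M u" "\<And>\<omega>. \<omega> \<in> space M \<Longrightarrow> f \<omega> \<le> u \<omega>" by auto
    have "(\<integral>\<omega>. w \<omega> - d \<omega> \<partial>M) \<le> integral\<^sup>L M u"
      using w d u by (intro integral_mono) (auto intro: order_trans[OF lo])
    then show ?thesis using w d u(1) by simp
  qed
  have "integral\<^sup>L M (\<lambda>\<omega>. w \<omega> + d \<omega>) \<in> ?S" using w d up by blast
  then have mem: "integral\<^sup>L M w + integral\<^sup>L M d \<in> ?S" using w d by simp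
  have "Inf ?S \<le> integral\<^sup>L M w + integral\<^sup>L M d"
    using lower by (intro cInf_lower mem bdd_belowI)
  moreover have "integral\<^sup>L M w - integral\<^sup>L M d \<le> Inf ?S"
    using mem lower by (intro cInf_greatest) auto
  ultimately show ?thesis unfolding outer_expectation_def by linarith
qed

text \<open>
  Suprema of empirical processes over a continuum of times need not be measurable, so bounds on them
  that hold with high probability are stated through a measurable exceptional set.
\<close>

definition nearly_surely :: "'w measure \<Rightarrow> real \<Rightarrow> ('w \<Rightarrow> bool) \<Rightarrow> bool" where
  "nearly_surely M e \<Phi> \<longleftrightarrow> (\<exists>A\<in>sets M. measure M A \<le> e \<and> (\<forall>\<omega>\<in>space M - A. \<Phi> \<omega>))"

lemma nearly_surely_mono:
  assumes "nearly_surely M e \<Phi>" "e \<le> e'" "\<And>\<omega>. \<omega> \<in> space M \<Longrightarrow> \<Phi> \<omega> \<Longrightarrow> \<Psi> \<omega>"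
  shows "nearly_surely M e' \<Psi>"
  using assms unfolding nearly_surely_def by (meson DiffD1 order_trans)

lemma nearly_surely_conj:
  assumes "nearly_surely M e \<Phi>" "nearly_surely M e' \<Psi>"
  shows "nearly_surely M (e + e') (\<lambda>\<omega>. \<Phi> \<omega> \<and> \<Psi> \<omega>)"
proof -
  obtain A B where A: "A \<in> sets M" "measure M A \<le> e" "\<forall>\<omega>\<in>space M - A. \<Phi> \<omega>"
    and B: "B \<in> sets M" "measure M B \<le> e'" "\<forall>\<omega>\<in>space M - B. \<Psi> \<omega>"
    using assms unfolding nearly_surely_def by blast
  show ?thesis
    unfolding nearly_surely_def using A B measure_Un_le[OF A(1) B(1)] by (intro bexI[of _ "A \<union> B"]) auto
qed

section \<open>Weak convergence from marginals and asymptotic equicontinuity\<close>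

text \<open>
  At level \<open>n\<close> the times are divided into \<open>K n\<close> classes by \<open>\<iota> n\<close>, the class \<open>j\<close> having the representative
  \<open>p n j\<close>. Asymptotic equicontinuity says that, for large \<open>m\<close> and up to an event of probability
  \<open>(1/2) ^ n\<close>, replacing every time by its representative moves the path by at most \<open>(1/2) ^ n\<close>. Of the
  process \<open>Z\<close> nothing but its finite-dimensional distributions is known; they are given through the
  characteristic functions of linear combinations.
\<close>

locale asymptotically_equicontinuous =
  fixes T :: "'t set" and M :: "nat \<Rightarrow> 'w measure" and Y :: "nat \<Rightarrow> 't \<Rightarrow> 'w \<Rightarrow> real"
    and N :: "'z measure" and Z :: "'t \<Rightarrow> 'z \<Rightarrow> real"
    and K :: "nat \<Rightarrow> nat" and p :: "nat \<Rightarrow> nat \<Rightarrow> 't" and \<iota> :: "nat \<Rightarrow> 't \<Rightarrow> nat"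
  assumes M: "\<And>m. prob_space (M m)" and N: "prob_space N"
    and Y_meas: "\<And>m t. t \<in> T \<Longrightarrow> Y m t \<in> borel_measurable (M m)"
    and Z_meas: "\<And>t. t \<in> T \<Longrightarrow> Z t \<in> borel_measurable N"
    and Y_bdd: "\<And>m \<omega>. \<omega> \<in> space (M m) \<Longrightarrow> bounded ((\<lambda>t. Y m t \<omega>) ` T)"
    and fidi: "\<And>(k::nat) q c. (\<And>j. q j \<in> T) \<Longrightarrow>
        (\<lambda>m. char (distr (M m) borel (\<lambda>\<omega>. \<Sum>j<k. c j * Y m (q j) \<omega>)) 1)
          \<longlonglongrightarrow> char (distr N borel (\<lambda>\<omega>. \<Sum>j<k. c j * Z (q j) \<omega>)) 1"
    and p: "\<And>n j. p n j \<in> T" and \<iota>: "\<And>n t. t \<in> T \<Longrightarrow> \<iota> n t < K n"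
    and equi: "\<And>n. eventually (\<lambda>m. nearly_surely (M m) ((1/2) ^ n)
        (\<lambda>\<omega>. \<forall>t\<in>T. \<bar>Y m t \<omega> - Y m (p n (\<iota> n t)) \<omega>\<bar> \<le> (1/2) ^ n)) sequentially"
begin

sublocale N: prob_space N by (rule N)

lemma measurable_vector_Y [measurable]:
  "(\<And>j. q j \<in> T) \<Longrightarrow> (\<lambda>\<omega> j. Y m (q j) \<omega>) \<in> borel_measurable (M m)" for q :: "nat \<Rightarrow> 't"
  by (rule measurable_coordinatewise_then_product) (rule Y_meas)

lemma measurable_vector_Z [measurable]:
  "(\<And>j. q j \<in> T) \<Longrightarrow> (\<lambda>\<omega> j. Z (q j) \<omega>) \<in> borel_measurable N" for q :: "nat \<Rightarrow> 't"
  by (rule measurable_coordinatewise_then_product) (rule Z_meas)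

lemma fidi_continuous:
  fixes q :: "nat \<Rightarrow> 't" and f :: "(nat \<Rightarrow> real) \<Rightarrow> real"
  assumes "\<And>j. q j \<in> T" and "continuous_on UNIV f" "\<And>x. \<bar>f x\<bar> \<le> B"
    and "\<And>x. f x = f (\<lambda>j. if j < k then x j else 0)"
  shows "(\<lambda>m. \<integral>\<omega>. f (\<lambda>j. Y m (q j) \<omega>) \<partial>M m) \<longlonglongrightarrow> (\<integral>\<omega>. f (\<lambda>j. Z (q j) \<omega>) \<partial>N)"
proof (rule cramer_wold[of M N "\<lambda>m \<omega> j. Y m (q j) \<omega>" "\<lambda>\<omega> j. Z (q j) \<omega>" k f B])
  show "(\<lambda>m. char (distr (M m) borel (\<lambda>\<omega>. \<Sum>j<k. c j * Y m (q j) \<omega>)) 1)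
          \<longlonglongrightarrow> char (distr N borel (\<lambda>\<omega>. \<Sum>j<k. c j * Z (q j) \<omega>)) 1" for c
    by (rule fidi[OF assms(1)])
qed (use assms in \<open>auto intro!: M N Y_meas Z_meas\<close>)

text \<open>
  The processes frozen at the representatives of level \<open>n\<close>. They are images of finite-dimensional vectors
  under a continuous map, so for fixed \<open>n\<close> the convergence of the first to the second is a
  finite-dimensional matter.
\<close>

definition Yn :: "nat \<Rightarrow> nat \<Rightarrow> 'w \<Rightarrow> 't \<Rightarrow> real" where
  "Yn n m \<omega> = step_path T (\<iota> n) (\<lambda>j. Y m (p n j) \<omega>)"

definition Zn :: "nat \<Rightarrow> 'z \<Rightarrow> 't \<Rightarrow> real" where
  "Zn n \<omega> = step_path T (\<iota> n) (\<lambda>j. Z (p n j) \<omega>)"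

lemma Yn_in: "Yn n m \<omega> \<in> linf_space T" and Zn_in: "Zn n \<omega>' \<in> linf_space T"
  unfolding Yn_def Zn_def by (auto intro!: step_path_in_linf \<iota>)

context
  fixes h
  assumes h: "linf_continuous T h"
begin

lemma measurable_h_step: "(\<lambda>x. h (step_path T (\<iota> n) x)) \<in> borel_measurable borel"
  by (rule borel_measurable_continuous_onI[OF continuous_on_step_path[OF \<iota> h]])

lemma measurable_h_Yn: "(\<lambda>\<omega>. h (Yn n m \<omega>)) \<in> borel_measurable (M m)"
  unfolding Yn_def by (rule measurable_compose[OF _ measurable_h_step]) (simp add: p measurable_vector_Y)

lemma measurable_h_Zn: "(\<lambda>\<omega>. h (Zn n \<omega>)) \<in> borel_measurable N"
  unfolding Zn_def by (rule measurable_compose[OF _ measurable_h_step]) (simp add: p measurable_vector_Z)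

lemma fidi_step:
  assumes B: "\<And>f. f \<in> linf_space T \<Longrightarrow> \<bar>h f\<bar> \<le> B"
  shows "(\<lambda>m. \<integral>\<omega>. h (Yn n m \<omega>) \<partial>M m) \<longlonglongrightarrow> (\<integral>\<omega>. h (Zn n \<omega>) \<partial>N)"
  unfolding Yn_def Zn_def
proof (rule fidi_continuous[of "p n" "\<lambda>x. h (step_path T (\<iota> n) x)" B "K n"])
  show "continuous_on UNIV (\<lambda>x. h (step_path T (\<iota> n) x))"
    by (rule continuous_on_step_path[OF \<iota> h])
  show "\<bar>h (step_path T (\<iota> n) x)\<bar> \<le> B" for x
    by (rule B[OF step_path_in_linf[OF \<iota>]])
  show "h (step_path T (\<iota> n) x) = h (step_path T (\<iota> n) (\<lambda>j. if j < K n then x j else 0))" for x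
    by (rule arg_cong[of _ _ h]) (auto simp: step_path_def \<iota> restrict_def fun_eq_iff)
qed (rule p)

end

text \<open>
  The regularity of the processes \<open>Y m\<close> passes to \<open>Z\<close>, one finite set of pairs of times at a time: a
  bounded continuous function of the increments that vanishes if all of them are at most \<open>\<epsilon>\<close>, and is
  \<open>1\<close> if one of them exceeds \<open>2 * \<epsilon>\<close>, has expectation at most \<open>\<eta>\<close> under \<open>Y m\<close> for large \<open>m\<close>, hence also
  under \<open>Z\<close>. The bound does not depend on the number of pairs.
\<close>

lemma increment_bound:
  assumes I: "finite I" "I \<subseteq> T \<times> T" and "\<epsilon> > 0"
    and ev: "eventually (\<lambda>m. nearly_surely (M m) \<eta> (\<lambda>\<omega>. \<forall>(s, t)\<in>I. \<bar>Y m s \<omega> - Y m t \<omega>\<bar> \<le> \<epsilon>)) sequentially"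
  shows "{\<omega> \<in> space N. \<exists>(s, t)\<in>I. \<bar>Z s \<omega> - Z t \<omega>\<bar> > 2 * \<epsilon>} \<in> sets N"
    and "measure N {\<omega> \<in> space N. \<exists>(s, t)\<in>I. \<bar>Z s \<omega> - Z t \<omega>\<bar> > 2 * \<epsilon>} \<le> \<eta>"
proof -
  define bad where "bad = {\<omega> \<in> space N. \<exists>(s, t)\<in>I. \<bar>Z s \<omega> - Z t \<omega>\<bar> > 2 * \<epsilon>}"
  have "{\<omega> \<in> space N. \<bar>Z s \<omega> - Z t \<omega>\<bar> > 2 * \<epsilon>} \<in> sets N" if "(s, t) \<in> I" for s t
  proof -
    have [measurable]: "Z s \<in> borel_measurable N" "Z t \<in> borel_measurable N"
      using that I by (auto intro: Z_meas)
    show ?thesis by measurable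
  qed
  then have "(\<Union>(s, t)\<in>I. {\<omega> \<in> space N. \<bar>Z s \<omega> - Z t \<omega>\<bar> > 2 * \<epsilon>}) \<in> sets N"
    using I(1) by (intro sets.finite_UN) auto
  also have "(\<Union>(s, t)\<in>I. {\<omega> \<in> space N. \<bar>Z s \<omega> - Z t \<omega>\<bar> > 2 * \<epsilon>}) = bad"
    unfolding bad_def by auto
  finally have bad [measurable]: "bad \<in> sets N" .
  then show "{\<omega> \<in> space N. \<exists>(s, t)\<in>I. \<bar>Z s \<omega> - Z t \<omega>\<bar> > 2 * \<epsilon>} \<in> sets N" unfolding bad_def .
  obtain t0 where t0: "t0 \<in> T" using p by blast
  obtain g :: "nat \<Rightarrow> 't \<times> 't" and k where g: "I = g ` {i. i < k}"
    using I(1) unfolding finite_conv_nat_seg_image by auto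
  \<comment> \<open>the \<open>i\<close>-th pair occupies the coordinates \<open>2 * i\<close> and \<open>2 * i + 1\<close>; the remaining ones are never looked at\<close>
  define q where "q j = (if j div 2 < k then if even j then fst (g (j div 2)) else snd (g (j div 2)) else t0)" for j
  have q: "q j \<in> T" for j using t0 I(2) unfolding q_def g by (auto simp: mem_Times_iff image_subset_iff)
  have q_g: "q (2 * i) = fst (g i)" "q (2 * i + 1) = snd (g i)" if "i < k" for i
    using that by (auto simp: q_def)
  define f :: "(nat \<Rightarrow> real) \<Rightarrow> real" where
    "f x = min 1 (\<Sum>i<k. max 0 (\<bar>x (2 * i) - x (2 * i + 1)\<bar> / \<epsilon> - 1))" for x
  have f01: "0 \<le> f x" "f x \<le> 1" for x unfolding f_def by (auto intro!: sum_nonneg)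
  have f_cont: "continuous_on UNIV f"
    unfolding f_def using \<open>\<epsilon> > 0\<close>
    by (intro continuous_intros continuous_on_product_coordinates) auto
  have f_dep: "f x = f (\<lambda>j. if j < 2 * k then x j else 0)" for x
    unfolding f_def by (intro arg_cong[of _ _ "min 1"] sum.cong refl) auto
  have lim: "(\<lambda>m. \<integral>\<omega>. f (\<lambda>j. Y m (q j) \<omega>) \<partial>M m) \<longlonglongrightarrow> (\<integral>\<omega>. f (\<lambda>j. Z (q j) \<omega>) \<partial>N)"
    using f01 by (intro fidi_continuous[OF q f_cont _ f_dep, of 1]) (auto simp: abs_le_iff intro: order_trans[of _ 0])
  have [measurable]: "f \<in> borel_measurable borel" by (rule borel_measurable_continuous_onI[OF f_cont])
  have int_Z: "integrable N (\<lambda>\<omega>. f (\<lambda>j. Z (q j) \<omega>))"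
    using f01 q by (intro N.integrable_const_bound[of _ 1]) (auto intro: measurable_compose[OF measurable_vector_Z])
  have "measure N bad = (\<integral>\<omega>. indicator bad \<omega> \<partial>N)" by simp
  also have "\<dots> \<le> (\<integral>\<omega>. f (\<lambda>j. Z (q j) \<omega>) \<partial>N)"
  proof (intro integral_mono int_Z)
    fix \<omega> assume "\<omega> \<in> space N"
    show "indicator bad \<omega> \<le> f (\<lambda>j. Z (q j) \<omega>)"
    proof (cases "\<omega> \<in> bad")
      case True
      then obtain i where i: "i < k" "\<bar>Z (fst (g i)) \<omega> - Z (snd (g i)) \<omega>\<bar> > 2 * \<epsilon>"
        unfolding bad_def g by auto
      then have "1 \<le> max 0 (\<bar>Z (q (2 * i)) \<omega> - Z (q (2 * i + 1)) \<omega>\<bar> / \<epsilon> - 1)"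
        unfolding q_g[OF i(1)] using \<open>\<epsilon> > 0\<close> by (auto simp: le_max_iff_disj field_simps)
      also have "\<dots> \<le> (\<Sum>i<k. max 0 (\<bar>Z (q (2 * i)) \<omega> - Z (q (2 * i + 1)) \<omega>\<bar> / \<epsilon> - 1))"
        using i(1) by (intro member_le_sum) auto
      finally show ?thesis using True by (simp add: f_def)
    qed (simp add: f01)
  qed (simp add: N.emeasure_eq_measure)
  also have "\<dots> \<le> \<eta>"
  proof (rule tendsto_upperbound[OF lim])
    show "eventually (\<lambda>m. (\<integral>\<omega>. f (\<lambda>j. Y m (q j) \<omega>) \<partial>M m) \<le> \<eta>) sequentially"
      using ev
    proof eventually_elim
      case (elim m)
      then obtain A where A [measurable]: "A \<in> sets (M m)" and A': "measure (M m) A \<le> \<eta>"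
        "\<And>\<omega> s t. \<omega> \<in> space (M m) - A \<Longrightarrow> (s, t) \<in> I \<Longrightarrow> \<bar>Y m s \<omega> - Y m t \<omega>\<bar> \<le> \<epsilon>"
        unfolding nearly_surely_def by blast
      interpret Mm: prob_space "M m" by (rule M)
      have "(\<integral>\<omega>. f (\<lambda>j. Y m (q j) \<omega>) \<partial>M m) \<le> (\<integral>\<omega>. indicator A \<omega> \<partial>M m)"
      proof (intro integral_mono)
        show "integrable (M m) (\<lambda>\<omega>. f (\<lambda>j. Y m (q j) \<omega>))"
          using f01 q by (intro Mm.integrable_const_bound[of _ 1]) (auto intro: measurable_compose[OF measurable_vector_Y])
        fix \<omega> assume \<omega>: "\<omega> \<in> space (M m)"
        show "f (\<lambda>j. Y m (q j) \<omega>) \<le> indicator A \<omega>"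
        proof (cases "\<omega> \<in> A")
          case False
          have "max 0 (\<bar>Y m (q (2 * i)) \<omega> - Y m (q (2 * i + 1)) \<omega>\<bar> / \<epsilon> - 1) = 0" if "i < k" for i
          proof -
            have "g i \<in> I" using that g by auto
            then have "\<bar>Y m (fst (g i)) \<omega> - Y m (snd (g i)) \<omega>\<bar> \<le> \<epsilon>"
              using A'(2)[of \<omega> "fst (g i)" "snd (g i)"] \<omega> False by simp
            then show ?thesis unfolding q_g[OF that] using \<open>\<epsilon> > 0\<close> by (simp add: max_def field_simps)
          qed
          then show ?thesis using False by (simp add: f_def)
        qed (simp add: f01)
      qed (simp add: Mm.emeasure_eq_measure)
      also have "\<dots> = measure (M m) A" by simp
      finally show ?case using A'(1) by linarith
    qed
  qed simp
  finally show "measure N {\<omega> \<in> space N. \<exists>(s, t)\<in>I. \<bar>Z s \<omega> - Z t \<omega>\<bar> > 2 * \<epsilon>} \<le> \<eta>"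
    unfolding bad_def .
qed

lemma Z_close_step:
  assumes t: "t \<in> T"
  shows "measure N {\<omega> \<in> space N. \<bar>Z t \<omega> - Zn n \<omega> t\<bar> > 2 * (1/2) ^ n} \<le> (1/2) ^ n"
proof -
  have "measure N {\<omega> \<in> space N. \<exists>(s, u)\<in>{(t, p n (\<iota> n t))}. \<bar>Z s \<omega> - Z u \<omega>\<bar> > 2 * (1/2) ^ n} \<le> (1/2) ^ n"
  proof (rule increment_bound)
    show "eventually (\<lambda>m. nearly_surely (M m) ((1/2) ^ n)
        (\<lambda>\<omega>. \<forall>(s, u)\<in>{(t, p n (\<iota> n t))}. \<bar>Y m s \<omega> - Y m u \<omega>\<bar> \<le> (1/2) ^ n)) sequentially"
      using equi[of n] by eventually_elim (erule nearly_surely_mono, use t in auto)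
  qed (use t p in auto)
  then show ?thesis using t by (simp add: Zn_def step_path_def)
qed

text \<open>
  Consecutive step processes are compared through the finitely many pairs of representatives that share
  a time. Any such time is close to both, so their difference is at most \<open>(1/2) ^ n + (1/2) ^ Suc n\<close>
  under \<open>Y m\<close>, and at most twice that under \<open>Z\<close>. The failure probabilities are summable in \<open>n\<close>.
\<close>

definition bad :: "nat \<Rightarrow> 'z set" where
  "bad n = {\<omega> \<in> space N. \<exists>t\<in>T. \<bar>Zn (Suc n) \<omega> t - Zn n \<omega> t\<bar> > 3 * (1/2) ^ n}"

lemma bad_bound: "bad n \<in> sets N" "measure N (bad n) \<le> (3/2) * (1/2) ^ n"
proof -
  define I where "I = (\<lambda>t. (p (Suc n) (\<iota> (Suc n) t), p n (\<iota> n t))) ` T"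
  have "I \<subseteq> (p (Suc n) ` {..<K (Suc n)}) \<times> (p n ` {..<K n})"
    unfolding I_def using \<iota> by auto
  then have I: "finite I" by (rule finite_subset) auto
  have IT: "I \<subseteq> T \<times> T" unfolding I_def using p by auto
  have ev: "eventually (\<lambda>m. nearly_surely (M m) ((3/2) * (1/2) ^ n)
      (\<lambda>\<omega>. \<forall>(s, t)\<in>I. \<bar>Y m s \<omega> - Y m t \<omega>\<bar> \<le> (3/2) * (1/2) ^ n)) sequentially"
    using equi[of n] equi[of "Suc n"]
  proof eventually_elim
    case (elim m)
    have "\<bar>y - z\<bar> \<le> (3/2) * (1/2) ^ n" if "\<bar>x - z\<bar> \<le> (1/2) ^ n" "\<bar>x - y\<bar> \<le> (1/2) ^ Suc n" for x y z :: real
    proof -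
      have "\<bar>x - y\<bar> \<le> (1/2) * (1/2) ^ n" using that(2) by simp
      with that(1) show ?thesis by linarith
    qed
    with nearly_surely_conj[OF elim] show ?case
      unfolding I_def by (elim nearly_surely_mono) auto
  qed
  have eq: "{\<omega> \<in> space N. \<exists>(s, t)\<in>I. \<bar>Z s \<omega> - Z t \<omega>\<bar> > 2 * ((3/2) * (1/2) ^ n)} = bad n"
    unfolding bad_def I_def by (auto simp: Zn_def step_path_def)
  show "bad n \<in> sets N" "measure N (bad n) \<le> (3/2) * (1/2) ^ n"
    using increment_bound[OF I IT _ ev] unfolding eq by simp_all
qed

text \<open>
  The event that the step processes converge uniformly at a geometric rate from level \<open>k\<close> on.
\<close>

definition good :: "nat \<Rightarrow> 'z set" where "good k = space N - (\<Union>n. bad (n + k))"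

lemma good_sets [measurable]: "good k \<in> sets N"
  unfolding good_def using bad_bound(1) by auto

lemma measure_good: "measure N (space N - good k) \<le> 3 * (1/2) ^ k"
proof -
  have sm: "(\<lambda>n. (3/2) * (1/2::real) ^ (n + k)) sums (3 * (1/2) ^ k)"
    using sums_mult2[OF sums_mult[OF power_half_series[unfolded sums_Suc_iff, simplified], of "3/2"], of "(1/2)^k"]
    sums_mult[OF geometric_sums[of "1/2::real"], of "(3/2) * (1/2)^k"]
    by (simp add: power_add mult.commute mult.left_commute)
  have sb: "summable (\<lambda>n. measure N (bad (n + k)))"
    by (rule summable_comparison_test[OF _ sums_summable[OF sm]]) (use bad_bound(2) in auto)
  have "space N - good k = (\<Union>n. bad (n + k))"
    unfolding good_def using sets.sets_into_space[OF bad_bound(1)] by auto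
  then have "measure N (space N - good k) \<le> (\<Sum>n. measure N (bad (n + k)))"
    using bad_bound(1) N.finite_measure_subadditive_countably[OF _ sb] by auto
  also have "\<dots> \<le> (\<Sum>n. (3/2) * (1/2) ^ (n + k))"
    by (intro suminf_le bad_bound sb sums_summable[OF sm])
  finally show ?thesis using sums_unique[OF sm] by simp
qed

lemma goodD:
  assumes "\<omega> \<in> good k" "n \<ge> k" "t \<in> T"
  shows "\<bar>Zn (Suc n) \<omega> t - Zn n \<omega> t\<bar> \<le> 3 * (1/2) ^ n"
proof -
  have "\<omega> \<in> space N" "\<omega> \<notin> bad ((n - k) + k)" using assms(1) unfolding good_def by blast+
  then show ?thesis using assms(2,3) by (auto simp: bad_def not_less)
qed

text \<open>
  The version of \<open>Z\<close> with bounded paths, as the uniform limit of its step processes. The zero path is an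
  arbitrary choice on the null set where there may be no limit.
\<close>

definition Zlim :: "'z \<Rightarrow> 't \<Rightarrow> real" where
  "Zlim \<omega> = (if \<omega> \<in> (\<Union>k. good k) then (\<lambda>t\<in>T. lim (\<lambda>n. Zn n \<omega> t)) else (\<lambda>t\<in>T. 0))"

lemma Zlim_close:
  assumes "\<omega> \<in> good k" "n \<ge> k" "t \<in> T"
  shows "\<bar>Zlim \<omega> t - Zn n \<omega> t\<bar> \<le> 6 * (1/2) ^ n"
proof -
  have "\<bar>lim (\<lambda>n. Zn n \<omega> t) - Zn n \<omega> t\<bar> \<le> 6 * (1/2) ^ n"
    using goodD[OF assms(1) _ assms(3)] assms(2) by (rule dyadic_increments_limit)
  then show ?thesis using assms unfolding Zlim_def by auto
qed

lemma Zlim_in: "Zlim \<omega> \<in> linf_space T"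
proof (cases "\<omega> \<in> (\<Union>k. good k)")
  case True
  then obtain k where k: "\<omega> \<in> good k" by auto
  obtain B where B: "\<And>t. t \<in> T \<Longrightarrow> \<bar>Zn k \<omega> t\<bar> \<le> B"
    using Zn_in[of k \<omega>] unfolding linf_space_def bounded_iff by auto
  show ?thesis
  proof (rule linf_spaceI)
    show "\<bar>Zlim \<omega> t\<bar> \<le> B + 6 * (1/2) ^ k" if "t \<in> T" for t
      using B[OF that] Zlim_close[OF k order_refl that] by linarith
  qed (simp add: Zlim_def)
next
  case False
  then show ?thesis by (intro linf_spaceI[of _ _ 0]) (auto simp: Zlim_def)
qed

lemma Zlim_dist:
  assumes "\<omega> \<in> good k" "n \<ge> k"
  shows "linf_dist T (Zlim \<omega>) (Zn n \<omega>) \<le> 6 * (1/2) ^ n"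
  by (rule linf_dist_le) (use Zlim_close[OF assms] in auto)

lemma half_powers_tendsto: "(\<lambda>n. c * (1/2::real) ^ n) \<longlonglongrightarrow> 0"
  using tendsto_mult[OF tendsto_const[of c] LIMSEQ_power_zero[of "1/2::real"]] by simp

lemma half_powers_eventually: "0 < e \<Longrightarrow> eventually (\<lambda>n. c * (1/2::real) ^ n < e) sequentially"
  by (rule order_tendstoD(2)[OF half_powers_tendsto])

lemma Zn_tendsto:
  assumes "\<omega> \<in> good k" and h: "linf_continuous T h"
  shows "(\<lambda>n. h (Zn n \<omega>)) \<longlonglongrightarrow> h (Zlim \<omega>)"
proof (rule tendstoI)
  fix e :: real assume "e > 0"
  then obtain d where d: "d > 0" "\<And>g. g \<in> linf_space T \<Longrightarrow> linf_dist T (Zlim \<omega>) g < d \<Longrightarrow> \<bar>h (Zlim \<omega>) - h g\<bar> < e"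
    using h Zlim_in[of \<omega>] unfolding continuous_map_linf_real by blast
  show "eventually (\<lambda>n. dist (h (Zn n \<omega>)) (h (Zlim \<omega>)) < e) sequentially"
    using half_powers_eventually[OF d(1), of 6] eventually_ge_at_top[of k]
  proof eventually_elim
    case (elim n)
    then have "linf_dist T (Zlim \<omega>) (Zn n \<omega>) < d"
      using Zlim_dist[OF assms(1), of n] by linarith
    from d(2)[OF Zn_in this] show ?case by (simp add: dist_real_def abs_minus_commute)
  qed
qed

lemma measurable_h_Zlim:
  assumes h: "linf_continuous T h"
  shows "(\<lambda>\<omega>. h (Zlim \<omega>)) \<in> borel_measurable N"
proof (rule borel_measurable_LIMSEQ_real)
  let ?G = "\<Union>k. good k"
  show "(\<lambda>n. if \<omega> \<in> ?G then h (Zn n \<omega>) else h (\<lambda>t\<in>T. 0)) \<longlonglongrightarrow> h (Zlim \<omega>)" for \<omega>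
  proof (cases "\<omega> \<in> ?G")
    case True
    then obtain k where "\<omega> \<in> good k" by auto
    with Zn_tendsto[OF this h] True show ?thesis by simp
  qed (simp add: Zlim_def)
  note [measurable] = measurable_h_Zn[OF h]
  show "(\<lambda>\<omega>. if \<omega> \<in> ?G then h (Zn n \<omega>) else h (\<lambda>t\<in>T. 0)) \<in> borel_measurable N" for n
    by measurable
qed

text \<open>
  Every open set is the complement of the zero set of a continuous function, the distance to its
  complement, so measurability of the continuous functionals of \<open>Zlim\<close> suffices.
\<close>

lemma measurable_Zlim: "Zlim \<in> measurable N (metric_borel (linf_metric T))"
  unfolding metric_borel_def
proof (rule measurable_measure_of)
  show "{U. openin (linf_topology T) U} \<subseteq> Pow (mspace (linf_metric T))"
    using openin_subset by force
  show "Zlim \<in> space N \<rightarrow> mspace (linf_metric T)" using Zlim_in by simp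
  fix U assume "U \<in> {U. openin (linf_topology T) U}"
  then have U: "openin (linf_topology T) U" by simp
  define C where "C = linf_space T - U"
  have Us: "U \<subseteq> linf_space T" using openin_subset[OF U] by simp
  show "Zlim -` U \<inter> space N \<in> sets N"
  proof (cases "C = {}")
    case True
    then have "Zlim -` U \<inter> space N = space N" using Zlim_in unfolding C_def by auto
    then show ?thesis by simp
  next
    case False
    have C: "C \<subseteq> linf_space T" unfolding C_def by auto
    have "closedin (linf_topology T) C"
      using closedin_diff[OF closedin_topspace U] unfolding C_def by simp
    from linf_setdist_eq_0_iff[OF C False this Zlim_in]
    have "Zlim -` U \<inter> space N = {\<omega> \<in> space N. linf_setdist T C (Zlim \<omega>) \<noteq> 0}"
      using Zlim_in unfolding C_def by auto
    also have "\<dots> \<in> sets N"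
      using measurable_h_Zlim[OF continuous_linf_setdist[OF C False]] by measurable
    finally show ?thesis .
  qed
qed

definition L :: "('t \<Rightarrow> real) measure" where "L = distr N (metric_borel (linf_metric T)) Zlim"

sublocale L: prob_space L
  unfolding L_def by (rule N.prob_space_distr[OF measurable_Zlim])

text \<open>
  By the first Borel-Cantelli lemma: \<open>Z t\<close> differs from the step process by more than \<open>2 * (1/2) ^ n\<close>
  for finitely many \<open>n\<close> only, and almost every point is in some \<open>good k\<close>.
\<close>

lemma Zlim_AE:
  assumes t: "t \<in> T"
  shows "AE \<omega> in N. Zlim \<omega> t = Z t \<omega>"
proof -
  note [measurable] = Z_meas[OF t] measurable_h_Zn[OF continuous_evaluation[OF t]]
  define far where "far n = (space N - good n) \<union> {\<omega> \<in> space N. \<bar>Z t \<omega> - Zn n \<omega> t\<bar> > 2 * (1/2) ^ n}" for n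
  have far [measurable]: "far n \<in> sets N" for n unfolding far_def by measurable
  have bound: "measure N (far n) \<le> 4 * (1/2) ^ n" for n
  proof -
    have "measure N (far n) \<le> measure N (space N - good n) + measure N {\<omega> \<in> space N. \<bar>Z t \<omega> - Zn n \<omega> t\<bar> > 2 * (1/2) ^ n}"
      unfolding far_def by (intro measure_Un_le) auto
    then show ?thesis using measure_good[of n] Z_close_step[OF t, of n] by simp
  qed
  have "summable (\<lambda>n. 4 * (1/2::real) ^ n)" by (intro summable_mult summable_geometric) simp
  then have "summable (\<lambda>n. measure N (far n))"
    by (rule summable_comparison_test[rotated]) (use bound in auto)
  then have "AE \<omega> in N. eventually (\<lambda>n. \<omega> \<in> space N - far n) sequentially"
    by (intro borel_cantelli_AE1 far) (simp_all add: N.emeasure_eq_measure)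
  then show ?thesis
  proof eventually_elim
    case (elim \<omega>)
    have "\<bar>Zlim \<omega> t - Z t \<omega>\<bar> \<le> 8 * (1/2) ^ n" if "\<omega> \<in> space N - far n" for n
    proof -
      have "\<omega> \<in> good n" "\<bar>Z t \<omega> - Zn n \<omega> t\<bar> \<le> 2 * (1/2) ^ n" using that unfolding far_def by auto
      then show ?thesis using Zlim_close[OF _ order_refl t, of \<omega> n] by linarith
    qed
    then have "eventually (\<lambda>n. \<bar>Zlim \<omega> t - Z t \<omega>\<bar> \<le> 8 * (1/2) ^ n) sequentially"
      using elim by (auto elim: eventually_mono)
    then have "\<bar>Zlim \<omega> t - Z t \<omega>\<bar> \<le> 0"
      by (intro tendsto_lowerbound[OF half_powers_tendsto[of 8]]) auto
    then show ?case by simp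
  qed
qed

lemma law_of_version_L: "law_of_version T N Z L"
  unfolding law_of_version_def
proof (intro allI impI)
  fix S assume "finite S \<and> S \<subseteq> T"
  then have S: "finite S" "S \<subseteq> T" by auto
  have eval: "(\<lambda>f. f t) \<in> borel_measurable (metric_borel (linf_metric T))" if "t \<in> S" for t
    using that S by (intro borel_measurable_metric_borel continuous_evaluation) auto
  have r: "(\<lambda>f. restrict f S) \<in> measurable (metric_borel (linf_metric T)) (Pi\<^sub>M S (\<lambda>_. borel))"
    by (rule measurable_restrict) (rule eval)
  have "distr L (Pi\<^sub>M S (\<lambda>_. borel)) (\<lambda>f. restrict f S) = distr N (Pi\<^sub>M S (\<lambda>_. borel)) (\<lambda>\<omega>. restrict (Zlim \<omega>) S)"
    unfolding L_def by (subst distr_distr[OF r measurable_Zlim]) (simp add: comp_def)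
  also have "\<dots> = distr N (Pi\<^sub>M S (\<lambda>_. borel)) (\<lambda>\<omega>. \<lambda>s\<in>S. Z s \<omega>)"
  proof (rule distr_cong_AE)
    show "(\<lambda>\<omega>. restrict (Zlim \<omega>) S) \<in> measurable N (Pi\<^sub>M S (\<lambda>_. borel))"
      using measurable_compose[OF measurable_Zlim r] .
    show "(\<lambda>\<omega>. \<lambda>s\<in>S. Z s \<omega>) \<in> measurable N (Pi\<^sub>M S (\<lambda>_. borel))"
      by (rule measurable_restrict) (use S Z_meas in auto)
    have "AE \<omega> in N. \<forall>s\<in>S. Zlim \<omega> s = Z s \<omega>"
      using S Zlim_AE by (intro AE_finite_allI) auto
    then show "AE \<omega> in N. restrict (Zlim \<omega>) S = (\<lambda>s\<in>S. Z s \<omega>)"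
      by eventually_elim (auto simp: restrict_def fun_eq_iff)
  qed (rule refl)+
  finally show "distr L (Pi\<^sub>M S (\<lambda>_. borel)) (\<lambda>f. restrict f S) = distr N (Pi\<^sub>M S (\<lambda>_. borel)) (\<lambda>\<omega>. \<lambda>s\<in>S. Z s \<omega>)" .
qed

lemma step_values_bounded:
  assumes "e > 0"
  shows "\<exists>R. measure N {\<omega> \<in> space N. \<exists>j<K n. \<bar>Z (p n j) \<omega>\<bar> > R} \<le> e"
proof -
  note [measurable] = Z_meas[OF p]
  let ?A = "\<lambda>r::nat. {\<omega> \<in> space N. \<exists>j<K n. \<bar>Z (p n j) \<omega>\<bar> > real r}"
  have "(\<lambda>r. measure N (?A r)) \<longlonglongrightarrow> measure N (\<Inter>r. ?A r)"
  proof (rule N.finite_Lim_measure_decseq)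
    show "decseq ?A" unfolding decseq_def by (auto intro: le_less_trans[rotated] order_less_le_trans)
  qed auto
  also have "(\<Inter>r. ?A r) = {}"
  proof -
    have "\<exists>r. \<forall>j<K n. \<bar>Z (p n j) \<omega>\<bar> \<le> real r" for \<omega>
    proof -
      obtain r where "(\<Sum>j<K n. \<bar>Z (p n j) \<omega>\<bar>) \<le> real r" using real_arch_simple by blast
      moreover have "\<bar>Z (p n j) \<omega>\<bar> \<le> (\<Sum>j<K n. \<bar>Z (p n j) \<omega>\<bar>)" if "j < K n" for j
        using that by (intro member_le_sum) auto
      ultimately show ?thesis by (meson order_trans)
    qed
    then show ?thesis by (fastforce simp: not_le[symmetric])
  qed
  finally have "(\<lambda>r. measure N (?A r)) \<longlonglongrightarrow> 0" by simp
  then have "eventually (\<lambda>r. measure N (?A r) < e) sequentially"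
    using assms by (rule order_tendstoD)
  then show ?thesis by (auto simp: eventually_sequentially intro: less_imp_le)
qed

text \<open>
  With probability close to \<open>1\<close>, the event \<open>good k\<close> holds for a fixed \<open>k\<close>, and for every \<open>n\<close> the values of
  the step process of level \<open>n\<close> are bounded by a constant \<open>R n\<close>. The paths of \<open>Zlim\<close> are then, for every large \<open>n\<close>, within
  \<open>6 * (1/2) ^ n\<close> of the compact set of step functions with values in \<open>{- R n..R n}\<close>; so they form a totally
  bounded set, the closure of which is compact.
\<close>

lemma tight_L: "tight_borel_law (linf_metric T) L"
  unfolding tight_borel_law_def
proof (intro conjI allI impI)
  show "prob_space L" by (rule L.prob_space_axioms)
  show "sets L = sets (metric_borel (linf_metric T))" by (simp add: L_def)
  fix \<epsilon> :: real assume "\<epsilon> > 0"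
  interpret S: Metric_space "linf_space T" "mdist (linf_metric T)" by (rule Metric_space_linf_mdist)
  note [measurable] = Z_meas[OF p]
  from half_powers_eventually[of "\<epsilon> / 2" 3] \<open>\<epsilon> > 0\<close> obtain k where k: "3 * (1/2) ^ k < \<epsilon> / 2"
    by (auto simp: eventually_sequentially)
  have "\<forall>n. \<exists>R. measure N {\<omega> \<in> space N. \<exists>j<K n. \<bar>Z (p n j) \<omega>\<bar> > R} \<le> (\<epsilon> / 4) * (1/2) ^ Suc n"
    using \<open>\<epsilon> > 0\<close> by (intro allI step_values_bounded) auto
  from choice[OF this] obtain R where R: "\<And>n. measure N {\<omega> \<in> space N. \<exists>j<K n. \<bar>Z (p n j) \<omega>\<bar> > R n} \<le> (\<epsilon> / 4) * (1/2) ^ Suc n"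
    by blast
  define big where "big n = {\<omega> \<in> space N. \<exists>j<K n. \<bar>Z (p n j) \<omega>\<bar> > R n}" for n
  have big [measurable]: "big n \<in> sets N" for n unfolding big_def by measurable
  define E where "E = good k - (\<Union>n. big n)"
  have E: "E \<in> sets N" unfolding E_def by auto
  have sm: "(\<lambda>n. (\<epsilon> / 4) * (1/2) ^ Suc n) sums (\<epsilon> / 4 * 1)"
    by (intro sums_mult power_half_series)
  have sb: "summable (\<lambda>n. measure N (big n))"
    by (rule summable_comparison_test[OF _ sums_summable[OF sm]]) (use R in \<open>auto simp: big_def\<close>)
  have "measure N (\<Union>n. big n) \<le> (\<Sum>n. measure N (big n))"
    by (rule N.finite_measure_subadditive_countably[OF _ sb]) auto
  also have "\<dots> \<le> (\<Sum>n. (\<epsilon> / 4) * (1/2) ^ Suc n)"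
    by (intro suminf_le sb sums_summable[OF sm]) (use R in \<open>auto simp: big_def\<close>)
  also have "\<dots> = \<epsilon> / 4" using sums_unique[OF sm] by simp
  finally have bigU: "measure N (\<Union>n. big n) \<le> \<epsilon> / 4" .
  have "measure N (space N - E) \<le> measure N ((space N - good k) \<union> (\<Union>n. big n))"
    unfolding E_def by (intro N.finite_measure_mono) auto
  also have "\<dots> \<le> measure N (space N - good k) + measure N (\<Union>n. big n)"
    by (intro measure_Un_le) auto
  finally have "measure N (space N - E) < \<epsilon>" using measure_good[of k] k bigU \<open>\<epsilon> > 0\<close> by linarith
  then have prob_E: "measure N E > 1 - \<epsilon>" using N.prob_compl[OF E] by linarith

  have "S.mtotally_bounded (Zlim ` E)"
  proof (rule S.mtotally_bounded_if_covered)
    show "Zlim ` E \<subseteq> linf_space T" using Zlim_in by auto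
    fix e :: real assume "e > 0"
    have "eventually (\<lambda>n. 6 * (1/2::real) ^ n < e / 2 \<and> n \<ge> k) sequentially"
      using \<open>e > 0\<close> by (intro eventually_conj half_powers_eventually eventually_ge_at_top) auto
    then obtain n where n: "6 * (1/2::real) ^ n < e / 2" "n \<ge> k"
      by (auto simp: eventually_sequentially)
    define box :: "(nat \<Rightarrow> real) set" where "box = PiE UNIV (\<lambda>j. if j < K n then {- R n..R n} else {0})"
    have "compactin (product_topology (\<lambda>i. euclidean) UNIV) box"
      unfolding box_def by (subst compactin_PiE) auto
    then have "compactin euclidean box" by (simp add: euclidean_product_topology)
    then have "compactin S.mtopology (step_path T (\<iota> n) ` box)"
      unfolding mtopology_of_linf[symmetric] by (rule image_compactin) (rule continuous_step_path[OF \<iota>])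
    then have "S.mtotally_bounded (step_path T (\<iota> n) ` box)" by (rule S.compactin_imp_mtotally_bounded)
    then obtain F where F: "finite F" "F \<subseteq> step_path T (\<iota> n) ` box"
      "step_path T (\<iota> n) ` box \<subseteq> (\<Union>x\<in>F. S.mball x (e / 2))"
      using \<open>e > 0\<close> unfolding S.mtotally_bounded_def by (meson half_gt_zero)
    have FT: "F \<subseteq> linf_space T" using F(2) step_path_in_linf[of T "\<iota> n" "K n", OF \<iota>] by auto
    have "Zlim \<omega> \<in> (\<Union>x\<in>F. S.mball x e)" if \<omega>: "\<omega> \<in> E" for \<omega>
    proof -
      have *: "\<omega> \<in> good k" "\<omega> \<in> space N" "\<omega> \<notin> big n"
        using \<omega> sets.sets_into_space[OF good_sets[of k]] unfolding E_def by auto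
      have "\<bar>Z (p n j) \<omega>\<bar> \<le> R n" if "j < K n" for j
        by (rule ccontr) (use *(2,3) that in \<open>auto simp: big_def not_le\<close>)
      then have "(\<lambda>j. if j < K n then Z (p n j) \<omega> else 0) \<in> box"
        unfolding box_def by (fastforce simp: abs_le_iff)
      moreover have "Zn n \<omega> = step_path T (\<iota> n) (\<lambda>j. if j < K n then Z (p n j) \<omega> else 0)"
        unfolding Zn_def by (auto simp: step_path_def \<iota> restrict_def fun_eq_iff)
      ultimately have "Zn n \<omega> \<in> step_path T (\<iota> n) ` box" by simp
      with F(3) obtain x where x': "x \<in> F" "Zn n \<omega> \<in> S.mball x (e / 2)" by blast
      then have x: "x \<in> F" "linf_dist T x (Zn n \<omega>) < e / 2"
        by (auto simp: mdist_linf_metric)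
      have xT: "x \<in> linf_space T" using x(1) FT by auto
      have "linf_dist T x (Zlim \<omega>) \<le> linf_dist T x (Zn n \<omega>) + linf_dist T (Zlim \<omega>) (Zn n \<omega>)"
        using linf_dist_triangle[OF xT Zn_in Zlim_in] by (simp add: linf_dist_commute)
      also have "\<dots> < e" using x(2) Zlim_dist[OF *(1) n(2)] n(1) by linarith
      finally show ?thesis using x(1) xT Zlim_in by (auto simp: mdist_linf_metric)
    qed
    then show "\<exists>F. finite F \<and> Zlim ` E \<subseteq> (\<Union>x\<in>F. S.mball x e)"
      using F(1) by blast
  qed
  then have comp: "compactin S.mtopology (S.mtopology closure_of (Zlim ` E))"
    using S.mtotally_bounded_eq_compact_closure_of[OF mcomplete_linf] by blast
  let ?C = "S.mtopology closure_of (Zlim ` E)"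
  have C_sets: "?C \<in> sets (metric_borel (linf_metric T))"
    by (rule closedin_sets_metric_borel) (simp add: mtopology_of_linf)
  have "measure N E \<le> measure L ?C"
    unfolding L_def measure_distr[OF measurable_Zlim C_sets]
  proof (rule N.finite_measure_mono)
    have "Zlim ` E \<subseteq> ?C" by (rule closure_of_subset) (use Zlim_in in auto)
    then show "E \<subseteq> Zlim -` ?C \<inter> space N" using sets.sets_into_space[OF E] by auto
    show "Zlim -` ?C \<inter> space N \<in> sets N" by (rule measurable_sets[OF measurable_Zlim C_sets])
  qed
  with prob_E comp show "\<exists>K. compactin (linf_topology T) K \<and> measure L K > 1 - \<epsilon>"
    by (intro exI[of _ ?C]) (simp add: mtopology_of_linf)
qed

text \<open>
  The paths of \<open>Y m\<close> are compared with those of \<open>Yn n m\<close>, these with \<open>Zn n\<close> through the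
  finite-dimensional convergence, and these with \<open>Zlim\<close>. The first and the last comparison need that \<open>h\<close>
  oscillates little between close paths, which is only true near a compact set \<open>C\<close>. The law of
  \<open>Zlim\<close> gives almost full mass to such a set. That the step processes are near \<open>C\<close> with high probability
  follows by transporting the expectation of the continuous function \<open>\<psi>\<close>, which vanishes on \<open>C\<close> and is
  \<open>1\<close> at distance \<open>r / 2\<close> from it, from \<open>Zlim\<close> to \<open>Zn n\<close>, and then to \<open>Yn n m\<close>.
\<close>

lemma weak_conv_L: "weak_conv_law (linf_metric T) M (\<lambda>m \<omega>. \<lambda>t\<in>T. Y m t \<omega>) L"
  unfolding weak_conv_law_def
proof (intro conjI allI impI)
  interpret S: Metric_space "linf_space T" "mdist (linf_metric T)" by (rule Metric_space_linf_mdist)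
  define path where "path m \<omega> = (\<lambda>t\<in>T. Y m t \<omega>)" for m \<omega>
  have path: "path m \<omega> \<in> linf_space T" if "\<omega> \<in> space (M m)" for m \<omega>
    using Y_bdd[OF that] by (auto simp: path_def linf_space_def bounded_iff)
  show "(\<lambda>\<omega>. \<lambda>t\<in>T. Y m t \<omega>) \<in> space (M m) \<rightarrow> mspace (linf_metric T)" for m
    using path unfolding path_def by simp
  fix h
  assume "linf_continuous T h \<and> bounded (h ` mspace (linf_metric T))"
  then have h: "linf_continuous T h"
    and "bounded (h ` linf_space T)" by auto
  then obtain B where B: "\<And>f. f \<in> linf_space T \<Longrightarrow> \<bar>h f\<bar> \<le> B" by (auto simp: bounded_iff)
  have "B \<ge> 0" using B[OF Zlim_in] by (meson abs_ge_zero order_trans)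
  have hL: "integral\<^sup>L L h = (\<integral>\<omega>. h (Zlim \<omega>) \<partial>N)"
    unfolding L_def by (rule integral_distr[OF measurable_Zlim borel_measurable_metric_borel[OF h]])
  have int_h: "integrable (M m) (\<lambda>\<omega>. h (Yn n m \<omega>))" "integrable N (\<lambda>\<omega>. h (Zn n \<omega>))" "integrable N (\<lambda>\<omega>. h (Zlim \<omega>))"
    if "linf_continuous T h"
      "\<And>f. f \<in> linf_space T \<Longrightarrow> \<bar>h f\<bar> \<le> B" for h B m n
  proof -
    interpret Mm: prob_space "M m" by (rule M)
    show "integrable (M m) (\<lambda>\<omega>. h (Yn n m \<omega>))"
      using that(2) Yn_in by (intro Mm.integrable_const_bound[of _ B] measurable_h_Yn[OF that(1)]) auto
    show "integrable N (\<lambda>\<omega>. h (Zn n \<omega>))" "integrable N (\<lambda>\<omega>. h (Zlim \<omega>))"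
      using that(2) Zn_in Zlim_in
      by (intro N.integrable_const_bound[of _ B] measurable_h_Zn[OF that(1)] measurable_h_Zlim[OF that(1)]; auto)+
  qed
  show "(\<lambda>m. outer_expectation (M m) (\<lambda>\<omega>. h (\<lambda>t\<in>T. Y m t \<omega>))) \<longlonglongrightarrow> integral\<^sup>L L h"
    unfolding hL path_def[symmetric]
  proof (rule LIMSEQ_I)
    fix \<epsilon> :: real assume "\<epsilon> > 0"
    \<comment> \<open>the three comparisons cost \<open>2 * e + 10 * B * e\<close>, \<open>e\<close> and \<open>2 * e + 8 * B * e\<close>; that \<open>e < 1\<close> makes \<open>C\<close> nonempty\<close>
    define e where "e = min (1/2) (\<epsilon> / (6 + 18 * B))"
    have e: "e > 0" "e \<le> 1/2" "5 * e + 18 * B * e < \<epsilon>"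
    proof -
      show "e > 0" using \<open>\<epsilon> > 0\<close> \<open>B \<ge> 0\<close> by (auto simp: e_def)
      show "e \<le> 1/2" by (simp only: e_def min.cobounded1)
      have "e * (6 + 18 * B) \<le> \<epsilon> / (6 + 18 * B) * (6 + 18 * B)"
        using \<open>B \<ge> 0\<close> by (intro mult_right_mono) (auto simp: e_def)
      also have "\<dots> = \<epsilon>" using \<open>B \<ge> 0\<close> by simp
      finally show "5 * e + 18 * B * e < \<epsilon>" using \<open>e > 0\<close> by (simp add: algebra_simps)
    qed
    obtain C where C: "compactin (linf_topology T) C" "measure L C > 1 - e"
      using tight_L e(1) unfolding tight_borel_law_def by blast
    have CT: "C \<subseteq> linf_space T" using compactin_subset_topspace[OF C(1)] by simp
    have "C \<noteq> {}" using C(2) e(2) by auto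
    have closed: "closedin (linf_topology T) C"
      using C(1) S.Hausdorff_space_mtopology unfolding mtopology_of_linf by (rule compactin_imp_closedin[rotated])
    then have C_sets: "C \<in> sets L" by (simp add: L_def closedin_sets_metric_borel)
    obtain r where r: "r > 0" "\<And>f g. f \<in> C \<Longrightarrow> g \<in> linf_space T \<Longrightarrow> linf_dist T f g < r \<Longrightarrow> \<bar>h f - h g\<bar> < e"
      using continuous_map_uniform_near_compact[OF C(1) h e(1)] by blast
    define \<psi> where "\<psi> f = min 1 (2 / r * linf_setdist T C f)" for f
    have \<psi>01: "0 \<le> \<psi> f" "\<psi> f \<le> 1" if "f \<in> linf_space T" for f
      using linf_setdist_nonneg[OF CT \<open>C \<noteq> {}\<close> that] r(1) unfolding \<psi>_def by auto
    have \<psi>_abs: "\<bar>\<psi> f\<bar> \<le> 1" if "f \<in> linf_space T" for f using \<psi>01[OF that] by simp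
    have \<psi>_cont: "linf_continuous T \<psi>"
      unfolding \<psi>_def
      by (intro continuous_map_real_min continuous_map_real_mult continuous_linf_setdist[OF CT \<open>C \<noteq> {}\<close>]) auto
    have \<psi>_lip: "\<psi> f \<le> \<psi> g + 2 / r * linf_dist T f g" if "f \<in> linf_space T" "g \<in> linf_space T" for f g
    proof -
      have "2 / r * linf_setdist T C f \<le> 2 / r * (linf_dist T f g + linf_setdist T C g)"
        using linf_setdist_triangle[OF CT \<open>C \<noteq> {}\<close> that] r(1) by (intro mult_left_mono) auto
      then have "2 / r * linf_setdist T C f \<le> 2 / r * linf_dist T f g + 2 / r * linf_setdist T C g"
        by (simp only: distrib_left)
      moreover have "0 \<le> 2 / r * linf_dist T f g" using linf_dist_nonneg[OF that] r(1) by simp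
      ultimately show ?thesis unfolding \<psi>_def by linarith
    qed
    have osc: "\<bar>h g - h f\<bar> \<le> 2 * e + 2 * B * \<psi> f"
      if fg: "f \<in> linf_space T" "g \<in> linf_space T" "linf_dist T f g < r / 2" for f g
    proof (cases "linf_setdist T C f < r / 2")
      case True
      then obtain c where c: "c \<in> C" "linf_dist T f c < r / 2"
        using linf_setdist_lessD[OF CT \<open>C \<noteq> {}\<close>] by blast
      have "linf_dist T c f < r" "linf_dist T c g < r"
        using c fg r(1) CT linf_dist_triangle[of c T f g] by (auto simp: linf_dist_commute)
      then have "\<bar>h c - h f\<bar> < e" "\<bar>h c - h g\<bar> < e" using r(2) c(1) fg by auto
      moreover have "0 \<le> 2 * B * \<psi> f" using \<psi>01[OF fg(1)] \<open>B \<ge> 0\<close> by simp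
      ultimately show ?thesis by linarith
    next
      case False
      then have "\<psi> f = 1" using r(1) by (simp add: \<psi>_def field_simps)
      then show ?thesis using B[OF fg(1)] B[OF fg(2)] e(1) by simp
    qed
    have "eventually (\<lambda>n. 6 * (1/2::real) ^ n < min (r/2) (e * (r / 2)) \<and> 3 * (1/2::real) ^ n < e) sequentially"
      using r(1) e(1) by (intro eventually_conj half_powers_eventually) auto
    then obtain n where n: "6 * (1/2::real) ^ n < r / 2" "6 * (1/2::real) ^ n < e * (r / 2)" "3 * (1/2::real) ^ n < e"
      by (auto simp: eventually_sequentially)
    have half_pos: "0 < (1/2::real) ^ n" by simp
    have bad_good: "measure N (space N - good n) \<le> e" using measure_good[of n] n(3) by linarith
    have E\<psi>_lim: "(\<integral>\<omega>. \<psi> (Zlim \<omega>) \<partial>N) \<le> e"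
    proof -
      have "(\<integral>\<omega>. \<psi> (Zlim \<omega>) \<partial>N) = integral\<^sup>L L \<psi>"
        unfolding L_def by (rule integral_distr[OF measurable_Zlim borel_measurable_metric_borel[OF \<psi>_cont], symmetric])
      also have "\<dots> \<le> (\<integral>f. 1 - indicator C f \<partial>L)"
      proof (intro integral_mono)
        have sp: "space L = linf_space T" by (simp add: L_def space_metric_borel)
        show "integrable L \<psi>"
        proof (rule L.integrable_const_bound[of _ 1])
          show "AE f in L. norm (\<psi> f) \<le> 1" using \<psi>_abs by (intro AE_I2) (simp add: sp)
          show "\<psi> \<in> borel_measurable L"
            using borel_measurable_metric_borel[OF \<psi>_cont] by (simp add: L_def)
        qed
        show "integrable L (\<lambda>f. 1 - indicator C f :: real)"
          using C_sets by (intro Bochner_Integration.integrable_diff) (auto simp: L.emeasure_eq_measure)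
        show "\<psi> f \<le> 1 - indicator C f" if "f \<in> space L" for f
          using \<psi>01[of f] that linf_setdist_eq_0_iff[OF CT \<open>C \<noteq> {}\<close> closed, of f]
          unfolding sp by (auto simp: indicator_def \<psi>_def)
      qed
      also have "\<dots> = 1 - measure L C"
        using C_sets by (subst Bochner_Integration.integral_diff) (auto simp: L.prob_space L.emeasure_eq_measure)
      finally show ?thesis using C(2) by linarith
    qed
    have int_g: "integrable N (\<lambda>\<omega>. indicator (space N - good n) \<omega> :: real)"
      by (simp add: N.emeasure_eq_measure)
    have E\<psi>_n: "(\<integral>\<omega>. \<psi> (Zn n \<omega>) \<partial>N) \<le> 3 * e"
    proof -
      have "(\<integral>\<omega>. \<psi> (Zn n \<omega>) \<partial>N) \<le> (\<integral>\<omega>. \<psi> (Zlim \<omega>) + e + indicator (space N - good n) \<omega> \<partial>N)"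
      proof (intro integral_mono)
        show "\<psi> (Zn n \<omega>) \<le> \<psi> (Zlim \<omega>) + e + indicator (space N - good n) \<omega>" if "\<omega> \<in> space N" for \<omega>
        proof (cases "\<omega> \<in> good n")
          case True
          have "\<psi> (Zn n \<omega>) \<le> \<psi> (Zlim \<omega>) + 2 / r * linf_dist T (Zn n \<omega>) (Zlim \<omega>)"
            by (rule \<psi>_lip[OF Zn_in Zlim_in])
          also have "2 / r * linf_dist T (Zn n \<omega>) (Zlim \<omega>) \<le> 2 / r * (e * (r / 2))"
            using Zlim_dist[OF True order_refl] n(2) r(1) by (intro mult_left_mono) (auto simp: linf_dist_commute)
          also have "2 / r * (e * (r / 2)) = e" using r(1) by simp
          finally show ?thesis using True by simp
        next
          case False
          then show ?thesis
            using that \<psi>01(2)[OF Zn_in, of n \<omega>] \<psi>01(1)[OF Zlim_in, of \<omega>] e(1) by simp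
        qed
      qed (use int_h(2,3)[OF \<psi>_cont \<psi>_abs] int_g in auto)
      also have "\<dots> = (\<integral>\<omega>. \<psi> (Zlim \<omega>) \<partial>N) + e + measure N (space N - good n)"
        using int_h(3)[OF \<psi>_cont \<psi>_abs] int_g by (simp add: N.prob_space)
      finally show ?thesis using E\<psi>_lim bad_good by linarith
    qed
    have Zn_Zlim: "\<bar>(\<integral>\<omega>. h (Zlim \<omega>) \<partial>N) - (\<integral>\<omega>. h (Zn n \<omega>) \<partial>N)\<bar> \<le> 2 * e + 8 * B * e"
    proof -
      have "\<bar>(\<integral>\<omega>. h (Zlim \<omega>) \<partial>N) - (\<integral>\<omega>. h (Zn n \<omega>) \<partial>N)\<bar> = \<bar>\<integral>\<omega>. h (Zlim \<omega>) - h (Zn n \<omega>) \<partial>N\<bar>"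
        using int_h(2,3)[OF h B] by simp
      also have "\<dots> \<le> (\<integral>\<omega>. \<bar>h (Zlim \<omega>) - h (Zn n \<omega>)\<bar> \<partial>N)" by (rule integral_abs_bound)
      also have "\<dots> \<le> (\<integral>\<omega>. 2 * e + 2 * B * \<psi> (Zn n \<omega>) + 2 * B * indicator (space N - good n) \<omega> \<partial>N)"
      proof (intro integral_mono)
        show "\<bar>h (Zlim \<omega>) - h (Zn n \<omega>)\<bar> \<le> 2 * e + 2 * B * \<psi> (Zn n \<omega>) + 2 * B * indicator (space N - good n) \<omega>"
          if "\<omega> \<in> space N" for \<omega>
        proof (cases "\<omega> \<in> good n")
          case True
          then have "linf_dist T (Zn n \<omega>) (Zlim \<omega>) < r / 2"
            using Zlim_dist[OF True order_refl] n(1) by (simp add: linf_dist_commute[of T "Zn n \<omega>"])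
          from osc[OF Zn_in Zlim_in this] show ?thesis using True by simp
        next
          case False
          have "0 \<le> 2 * B * \<psi> (Zn n \<omega>)" using \<psi>01[OF Zn_in] \<open>B \<ge> 0\<close> by simp
          then show ?thesis using False that B[OF Zlim_in, of \<omega>] B[OF Zn_in, of n \<omega>] e(1) by simp
        qed
      qed (use int_h(2,3)[OF h B] int_h(2)[OF \<psi>_cont \<psi>_abs] int_g in auto)
      also have "\<dots> = 2 * e + 2 * B * (\<integral>\<omega>. \<psi> (Zn n \<omega>) \<partial>N) + 2 * B * measure N (space N - good n)"
        using int_h(2)[OF \<psi>_cont \<psi>_abs] int_g by (simp add: N.prob_space)
      also have "\<dots> \<le> 2 * e + 2 * B * (3 * e) + 2 * B * e"
        using E\<psi>_n bad_good \<open>B \<ge> 0\<close> by (intro add_mono mult_left_mono) auto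
      finally show ?thesis by (simp add: algebra_simps)
    qed
    have ev1: "eventually (\<lambda>m. (\<integral>\<omega>. \<psi> (Yn n m \<omega>) \<partial>M m) < 4 * e) sequentially"
      by (rule order_tendstoD(2)[OF fidi_step[OF \<psi>_cont \<psi>_abs]]) (use E\<psi>_n e(1) in auto)
    have ev2: "eventually (\<lambda>m. \<bar>(\<integral>\<omega>. h (Yn n m \<omega>) \<partial>M m) - (\<integral>\<omega>. h (Zn n \<omega>) \<partial>N)\<bar> < e) sequentially"
      using tendstoD[OF fidi_step[OF h B] e(1), of n] by (simp add: dist_real_def)
    have "eventually (\<lambda>m. norm (outer_expectation (M m) (\<lambda>\<omega>. h (path m \<omega>)) - (\<integral>\<omega>. h (Zlim \<omega>) \<partial>N)) < \<epsilon>) sequentially"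
      using ev1 ev2 equi[of n]
    proof eventually_elim
      case (elim m)
      interpret Mm: prob_space "M m" by (rule M)
      obtain A where A [measurable]: "A \<in> sets (M m)" and A': "measure (M m) A \<le> (1/2) ^ n"
        "\<And>\<omega> t. \<omega> \<in> space (M m) - A \<Longrightarrow> t \<in> T \<Longrightarrow> \<bar>Y m t \<omega> - Y m (p n (\<iota> n t)) \<omega>\<bar> \<le> (1/2) ^ n"
        using elim(3) unfolding nearly_surely_def by blast
      have A_small: "measure (M m) A \<le> e" using A'(1) n(3) half_pos by linarith
      have int_A: "integrable (M m) (\<lambda>\<omega>. indicator A \<omega> :: real)" by (simp add: Mm.emeasure_eq_measure)
      have "\<bar>outer_expectation (M m) (\<lambda>\<omega>. h (path m \<omega>)) - (\<integral>\<omega>. h (Yn n m \<omega>) \<partial>M m)\<bar>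
          \<le> (\<integral>\<omega>. 2 * e + 2 * B * \<psi> (Yn n m \<omega>) + 2 * B * indicator A \<omega> \<partial>M m)"
      proof (rule outer_expectation_close)
        show "integrable (M m) (\<lambda>\<omega>. h (Yn n m \<omega>))" by (rule int_h(1)[OF h B])
        show "integrable (M m) (\<lambda>\<omega>. 2 * e + 2 * B * \<psi> (Yn n m \<omega>) + 2 * B * indicator A \<omega>)"
          using int_h(1)[OF \<psi>_cont \<psi>_abs] int_A by auto
        fix \<omega> assume \<omega>: "\<omega> \<in> space (M m)"
        show "\<bar>h (path m \<omega>) - h (Yn n m \<omega>)\<bar> \<le> 2 * e + 2 * B * \<psi> (Yn n m \<omega>) + 2 * B * indicator A \<omega>"
        proof (cases "\<omega> \<in> A")
          case True
          have "0 \<le> 2 * B * \<psi> (Yn n m \<omega>)" using \<psi>01[OF Yn_in] \<open>B \<ge> 0\<close> by simp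
          then show ?thesis using True B[OF path[OF \<omega>]] B[OF Yn_in, of n m \<omega>] e(1) by simp
        next
          case False
          have "linf_dist T (Yn n m \<omega>) (path m \<omega>) \<le> (1/2) ^ n"
            using A'(2)[of \<omega>] \<omega> False
            by (intro linf_dist_le) (auto simp: path_def Yn_def step_path_def abs_minus_commute)
          then have "linf_dist T (Yn n m \<omega>) (path m \<omega>) < r / 2" using n(1) half_pos by linarith
          from osc[OF Yn_in path[OF \<omega>] this] show ?thesis using False by simp
        qed
      qed
      also have "\<dots> = 2 * e + 2 * B * (\<integral>\<omega>. \<psi> (Yn n m \<omega>) \<partial>M m) + 2 * B * measure (M m) A"
        using int_h(1)[OF \<psi>_cont \<psi>_abs] int_A by (simp add: Mm.prob_space)
      also have "\<dots> \<le> 2 * e + 2 * B * (4 * e) + 2 * B * e"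
        using elim(1) A_small \<open>B \<ge> 0\<close> by (intro add_mono mult_left_mono) auto
      finally have "\<bar>outer_expectation (M m) (\<lambda>\<omega>. h (path m \<omega>)) - (\<integral>\<omega>. h (Yn n m \<omega>) \<partial>M m)\<bar>
          \<le> 2 * e + 10 * (B * e)" by (simp add: algebra_simps)
      then show ?case
        using elim(2) Zn_Zlim e(3) unfolding real_norm_def by (simp add: mult.assoc)
    qed
    then show "\<exists>no. \<forall>m\<ge>no. norm (outer_expectation (M m) (\<lambda>\<omega>. h (path m \<omega>)) - (\<integral>\<omega>. h (Zlim \<omega>) \<partial>N)) < \<epsilon>"
      by (simp add: eventually_sequentially)
  qed
qed

end

text \<open>
  Only the precisions \<open>e = (1/2) ^ n\<close> are needed; choosing a grid for each of them gives the locale.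
\<close>

theorem weak_conv_process_if_equicontinuous:
  fixes Y :: "nat \<Rightarrow> 't \<Rightarrow> 'w \<Rightarrow> real" and Z :: "'t \<Rightarrow> 'z \<Rightarrow> real"
  assumes M: "\<And>m. prob_space (M m)" and N: "prob_space N"
    and Y_meas: "\<And>m t. t \<in> T \<Longrightarrow> Y m t \<in> borel_measurable (M m)"
    and Z_meas: "\<And>t. t \<in> T \<Longrightarrow> Z t \<in> borel_measurable N"
    and Y_bdd: "\<And>m \<omega>. \<omega> \<in> space (M m) \<Longrightarrow> bounded ((\<lambda>t. Y m t \<omega>) ` T)"
    and fidi: "\<And>(k::nat) q c. (\<And>j. q j \<in> T) \<Longrightarrow>
        (\<lambda>m. char (distr (M m) borel (\<lambda>\<omega>. \<Sum>j<k. c j * Y m (q j) \<omega>)) 1)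
          \<longlonglongrightarrow> char (distr N borel (\<lambda>\<omega>. \<Sum>j<k. c j * Z (q j) \<omega>)) 1"
    and equi: "\<And>e. e > 0 \<Longrightarrow> \<exists>(k::nat) p \<iota>. (\<forall>j. p j \<in> T) \<and> (\<forall>t\<in>T. \<iota> t < k) \<and>
        eventually (\<lambda>m. nearly_surely (M m) e (\<lambda>\<omega>. \<forall>t\<in>T. \<bar>Y m t \<omega> - Y m (p (\<iota> t)) \<omega>\<bar> \<le> e)) sequentially"
  shows "weak_conv_process T M Y N Z"
proof -
  define good_grid where "good_grid e k p \<iota> \<longleftrightarrow> (\<forall>j. p j \<in> T) \<and> (\<forall>t\<in>T. \<iota> t < k) \<and>
      eventually (\<lambda>m. nearly_surely (M m) e (\<lambda>\<omega>. \<forall>t\<in>T. \<bar>Y m t \<omega> - Y m (p (\<iota> t)) \<omega>\<bar> \<le> e)) sequentially"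
    for e and k :: nat and p \<iota>
  have "\<forall>n. \<exists>k p \<iota>. good_grid ((1/2) ^ n) k p \<iota>"
    unfolding good_grid_def by (rule allI, rule equi) simp
  then obtain K p \<iota> where "\<And>n. good_grid ((1/2) ^ n) (K n) (p n) (\<iota> n)" by metis
  then interpret asymptotically_equicontinuous T M Y N Z K p \<iota>
    unfolding good_grid_def
    by (intro asymptotically_equicontinuous.intro[OF M N Y_meas Z_meas Y_bdd fidi]) blast+
  show ?thesis
    unfolding weak_conv_process_def using tight_L law_of_version_L weak_conv_L by blast
qed

section \<open>Empirical processes\<close>

lemma exp_le_one_plus_square:
  fixes x :: real
  assumes "\<bar>x\<bar> \<le> 1"
  shows "exp x \<le> 1 + x + x\<^sup>2"
proof (cases "x \<ge> 0")
  case True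
  then show ?thesis using exp_bound[of x] assms by simp
next
  case False
  define u where "u = - x"
  have u: "u > 0" "u \<le> 1" using False assms by (auto simp: u_def)
  have "1 + u \<le> exp u" using exp_ge_add_one_self .
  then have "exp x \<le> 1 / (1 + u)" using u by (simp add: u_def exp_minus field_simps)
  also have "\<dots> \<le> 1 - u + u\<^sup>2"
  proof -
    have "(1 - u + u\<^sup>2) * (1 + u) = 1 + u ^ 3" by (simp add: algebra_simps power2_eq_square power3_eq_cube)
    then have "1 \<le> (1 - u + u\<^sup>2) * (1 + u)" using u by simp
    then show ?thesis using u by (simp add: pos_divide_le_eq)
  qed
  finally show ?thesis by (simp add: u_def)
qed

text \<open>
  A Bernstein bound. Its point is that the variance proxy \<open>q\<close> may be much smaller than \<open>1\<close>, which a
  Hoeffding bound would not see: increments over short intervals must be small.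
\<close>

lemma (in prob_space) exp_moment_bernoulli_sum:
  fixes X :: "nat \<Rightarrow> 'a \<Rightarrow> real"
  assumes indep: "indep_vars (\<lambda>_. borel) X {1..m}"
    and X01: "\<And>i \<omega>. X i \<omega> \<in> {0, 1}"
    and mean: "\<And>i. i \<in> {1..m} \<Longrightarrow> expectation (X i) = p"
    and s: "\<bar>s\<bar> \<le> 1" "real m * q * s\<^sup>2 \<le> 1" "0 \<le> p" "p \<le> q"
  shows "integrable M (\<lambda>\<omega>. exp (s * ((\<Sum>i=1..m. X i \<omega>) - real m * p)))"
    and "expectation (\<lambda>\<omega>. exp (s * ((\<Sum>i=1..m. X i \<omega>) - real m * p))) \<le> exp 1"
proof -
  have X_meas [measurable]: "i \<in> {1..m} \<Longrightarrow> X i \<in> borel_measurable M" for i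
    using indep by (auto simp: indep_vars_def)
  have eq: "exp (s * ((\<Sum>i=1..m. X i \<omega>) - real m * p)) = (\<Prod>i=1..m. exp (s * (X i \<omega> - p)))" for \<omega>
    by (simp add: exp_sum[symmetric] sum_subtractf sum_distrib_left[symmetric] right_diff_distrib)
  have ind: "indep_vars (\<lambda>_. borel) (\<lambda>i \<omega>. exp (s * (X i \<omega> - p))) {1..m}"
    by (rule indep_vars_compose2[OF indep]) simp
  have X_int: "integrable M (X i)" if "i \<in> {1..m}" for i
  proof (rule integrable_const_bound[of _ 1])
    have "norm (X i \<omega>) \<le> 1" for \<omega> using X01[of i \<omega>] by auto
    then show "AE \<omega> in M. norm (X i \<omega>) \<le> 1" by (intro AE_I2)
  qed (rule X_meas[OF that])
  have factor: "exp (s * (X i \<omega> - p)) = exp (- s * p) * (1 + X i \<omega> * (exp s - 1))" for i \<omega>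
    using X01[of i \<omega>] by (auto simp: exp_diff exp_minus field_simps exp_add[symmetric])
  have int: "integrable M (\<lambda>\<omega>. exp (s * (X i \<omega> - p)))" if "i \<in> {1..m}" for i
    unfolding factor using X_int[OF that] by auto
  show "integrable M (\<lambda>\<omega>. exp (s * ((\<Sum>i=1..m. X i \<omega>) - real m * p)))"
    unfolding eq by (rule indep_vars_integrable[OF _ ind int]) auto
  have "expectation (\<lambda>\<omega>. exp (s * ((\<Sum>i=1..m. X i \<omega>) - real m * p))) =
      (\<Prod>i=1..m. expectation (\<lambda>\<omega>. exp (s * (X i \<omega> - p))))"
    unfolding eq by (rule indep_vars_lebesgue_integral[OF _ ind int]) auto
  also have "\<dots> \<le> (\<Prod>i=1..m. exp (q * s\<^sup>2))"
  proof (intro prod_mono conjI)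
    fix i assume i: "i \<in> {1..m}"
    show "0 \<le> expectation (\<lambda>\<omega>. exp (s * (X i \<omega> - p)))" by simp
    have "expectation (\<lambda>\<omega>. exp (s * (X i \<omega> - p))) = exp (- s * p) * (1 + p * (exp s - 1))"
      unfolding factor using X_int[OF i] mean[OF i] by (simp add: prob_space)
    also have "\<dots> \<le> exp (- s * p) * exp (p * (exp s - 1))"
      by (intro mult_left_mono exp_ge_add_one_self) auto
    also have "\<dots> = exp (p * (exp s - 1 - s))" by (simp add: exp_add[symmetric] algebra_simps)
    also have "\<dots> \<le> exp (q * s\<^sup>2)"
    proof -
      have "p * (exp s - 1 - s) \<le> p * s\<^sup>2"
        using exp_le_one_plus_square[OF s(1)] s(3) by (intro mult_left_mono) auto
      also have "\<dots> \<le> q * s\<^sup>2" using s(4) by (intro mult_right_mono) auto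
      finally show ?thesis by simp
    qed
    finally show "expectation (\<lambda>\<omega>. exp (s * (X i \<omega> - p))) \<le> exp (q * s\<^sup>2)" .
  qed
  also have "\<dots> = exp (real m * q * s\<^sup>2)" by (simp add: exp_of_nat_mult[symmetric] mult.assoc)
  also have "\<dots> \<le> exp 1" using s(2) by simp
  finally show "expectation (\<lambda>\<omega>. exp (s * ((\<Sum>i=1..m. X i \<omega>) - real m * p))) \<le> exp 1" .
qed

lemma (in prob_space) bernoulli_sum_tail:
  fixes X :: "nat \<Rightarrow> 'a \<Rightarrow> real"
  assumes indep: "indep_vars (\<lambda>_. borel) X {1..m}"
    and X01: "\<And>i \<omega>. X i \<omega> \<in> {0, 1}"
    and mean: "\<And>i. i \<in> {1..m} \<Longrightarrow> expectation (X i) = p"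
    and p: "0 \<le> p" "p \<le> q" "real m * q \<ge> 1"
  shows "prob {\<omega> \<in> space M. \<bar>(\<Sum>i=1..m. X i \<omega>) - real m * p\<bar> \<ge> x * sqrt (real m * q)} \<le> 2 * exp (1 - x)"
proof -
  have X_meas [measurable]: "i \<in> {1..m} \<Longrightarrow> X i \<in> borel_measurable M" for i
    using indep by (auto simp: indep_vars_def)
  \<comment> \<open>the exponent at which the exponential moment is of order one; at most \<open>1\<close> because \<open>m q \<ge> 1\<close>\<close>
  define s where "s = 1 / sqrt (real m * q)"
  define D where "D \<omega> = (\<Sum>i=1..m. X i \<omega>) - real m * p" for \<omega>
  have [measurable]: "D \<in> borel_measurable M" unfolding D_def by measurable
  have sq: "sqrt (real m * q) \<ge> 1" using p(3) by simp
  then have s: "0 < s" "s \<le> 1" "real m * q * s\<^sup>2 \<le> 1"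
    using p(3) unfolding s_def by (auto simp: power_divide)
  have 1: "integrable M (\<lambda>\<omega>. exp (s * D \<omega>))" "expectation (\<lambda>\<omega>. exp (s * D \<omega>)) \<le> exp 1"
    using exp_moment_bernoulli_sum[OF indep X01 mean _ _ p(1,2), of s] s unfolding D_def by auto
  have 2: "integrable M (\<lambda>\<omega>. exp (- s * D \<omega>))" "expectation (\<lambda>\<omega>. exp (- s * D \<omega>)) \<le> exp 1"
    using exp_moment_bernoulli_sum[OF indep X01 mean _ _ p(1,2), of "- s"] s unfolding D_def by auto
  let ?A = "{\<omega> \<in> space M. \<bar>D \<omega>\<bar> \<ge> x * sqrt (real m * q)}"
  have "prob ?A = expectation (indicator ?A)" by simp
  also have "\<dots> \<le> expectation (\<lambda>\<omega>. exp (- x) * (exp (s * D \<omega>) + exp (- s * D \<omega>)))"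
  proof (rule integral_mono)
    show "indicator ?A \<omega> \<le> exp (- x) * (exp (s * D \<omega>) + exp (- s * D \<omega>))" if "\<omega> \<in> space M" for \<omega>
    proof (cases "\<omega> \<in> ?A")
      case True
      then have "x * sqrt (real m * q) \<le> \<bar>D \<omega>\<bar>" by simp
      then have "x \<le> s * \<bar>D \<omega>\<bar>" using sq unfolding s_def by (simp add: field_simps)
      then have "exp x \<le> exp (s * \<bar>D \<omega>\<bar>)" by simp
      also have "\<dots> \<le> exp (s * D \<omega>) + exp (- s * D \<omega>)" by (cases "D \<omega> \<ge> 0") auto
      finally have "exp (- x) * exp x \<le> exp (- x) * (exp (s * D \<omega>) + exp (- s * D \<omega>))"
        by (intro mult_left_mono) auto
      then show ?thesis using True by (simp add: exp_minus)
    qed simp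
  qed (use 1 2 in \<open>auto simp: emeasure_eq_measure\<close>)
  also have "\<dots> = exp (- x) * (expectation (\<lambda>\<omega>. exp (s * D \<omega>)) + expectation (\<lambda>\<omega>. exp (- s * D \<omega>)))"
    using 1 2 by simp
  also have "\<dots> \<le> exp (- x) * (exp 1 + exp 1)" using 1 2 by (intro mult_left_mono) auto
  also have "\<dots> = 2 * exp (1 - x)" by (simp add: exp_diff exp_minus field_simps)
  finally show ?thesis unfolding D_def .
qed

definition empirical :: "nat \<Rightarrow> (nat \<Rightarrow> 'w \<Rightarrow> real) \<Rightarrow> (real \<Rightarrow> real) \<Rightarrow> real \<Rightarrow> 'w \<Rightarrow> real" where
  "empirical m X \<mu> t \<omega> = ((\<Sum>i=1..m. of_bool (X i \<omega> \<le> t)) - real m * \<mu> t) / sqrt (real m)"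

text \<open>
  The points of a dyadic partition of \<open>{\<delta>..1}\<close> into \<open>2 ^ k\<close> cells, and the index of the left end point
  of the cell that contains \<open>t\<close>.
\<close>

definition grid_point :: "real \<Rightarrow> nat \<Rightarrow> nat \<Rightarrow> real" where
  "grid_point \<delta> k j = \<delta> + (1 - \<delta>) * (real j / 2 ^ k)"

definition grid_index :: "real \<Rightarrow> nat \<Rightarrow> real \<Rightarrow> nat" where
  "grid_index \<delta> k t = nat \<lfloor>2 ^ k * ((t - \<delta>) / (1 - \<delta>))\<rfloor>"

abbreviation grid_floor :: "real \<Rightarrow> nat \<Rightarrow> real \<Rightarrow> real" where
  "grid_floor \<delta> k t \<equiv> grid_point \<delta> k (grid_index \<delta> k t)"

context
  fixes \<delta> :: real
  assumes \<delta>: "0 \<le> \<delta>" "\<delta> < 1"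
begin

lemma grid_point_mono: "i \<le> j \<Longrightarrow> grid_point \<delta> k i \<le> grid_point \<delta> k j"
  unfolding grid_point_def using \<delta> by (intro add_left_mono mult_left_mono divide_right_mono) auto

lemma grid_point_in:
  assumes "j \<le> 2 ^ k"
  shows "grid_point \<delta> k j \<in> {\<delta>..1}"
proof -
  have "grid_point \<delta> k 0 = \<delta>" "grid_point \<delta> k (2 ^ k) = 1" by (simp_all add: grid_point_def)
  then show ?thesis using grid_point_mono[of 0 j k] grid_point_mono[OF assms, of k] by auto
qed

lemma grid_step: "grid_point \<delta> k (Suc j) - grid_point \<delta> k j \<le> 1 / 2 ^ k"
proof -
  have "grid_point \<delta> k (Suc j) - grid_point \<delta> k j = (1 - \<delta>) * (1 / 2 ^ k)"
    by (simp add: grid_point_def add_divide_distrib algebra_simps)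
  also have "\<dots> \<le> 1 * (1 / 2 ^ k)" using \<delta> by (intro mult_right_mono) auto
  finally show ?thesis by simp
qed

lemma grid_index_bounds:
  assumes "t \<in> {\<delta>..1}"
  defines "u \<equiv> (t - \<delta>) / (1 - \<delta>)"
  shows "0 \<le> u" "u \<le> 1" "real (grid_index \<delta> k t) = of_int \<lfloor>2 ^ k * u\<rfloor>" "t = \<delta> + (1 - \<delta>) * u"
proof -
  show "0 \<le> u" "u \<le> 1" "t = \<delta> + (1 - \<delta>) * u" using assms(1) \<delta> by (auto simp: u_def field_simps)
  have "0 \<le> \<lfloor>2 ^ k * u\<rfloor>" using \<open>0 \<le> u\<close> by simp
  then show "real (grid_index \<delta> k t) = of_int \<lfloor>2 ^ k * u\<rfloor>" unfolding grid_index_def u_def[symmetric] by simp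
qed

lemma grid_index_le:
  assumes "t \<in> {\<delta>..1}"
  shows "grid_index \<delta> k t \<le> 2 ^ k"
proof -
  note u = grid_index_bounds[OF assms]
  have "real (grid_index \<delta> k t) \<le> 2 ^ k * ((t - \<delta>) / (1 - \<delta>))" unfolding u(3) by (rule of_int_floor_le)
  also have "\<dots> \<le> 2 ^ k * 1" using u(2) by (intro mult_left_mono) auto
  also have "\<dots> = real (2 ^ k)" by simp
  finally show ?thesis by (simp only: of_nat_le_iff)
qed

lemma grid_cell:
  assumes "t \<in> {\<delta>..1}"
  shows "grid_floor \<delta> k t \<le> t" "t \<le> grid_point \<delta> k (Suc (grid_index \<delta> k t))"
proof -
  note u = grid_index_bounds[OF assms]
  define u where "u = (t - \<delta>) / (1 - \<delta>)"
  define x where "x = real (grid_index \<delta> k t)"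
  have "x \<le> 2 ^ k * u" "2 ^ k * u \<le> x + 1"
    unfolding x_def u(3) u_def[symmetric] by linarith+
  then have "x / 2 ^ k \<le> u" "u \<le> (x + 1) / 2 ^ k"
    by (simp_all add: pos_divide_le_eq pos_le_divide_eq mult.commute)
  then have "real (grid_index \<delta> k t) / 2 ^ k \<le> u" "u \<le> real (Suc (grid_index \<delta> k t)) / 2 ^ k"
    by (simp_all add: x_def add.commute)
  then show "grid_floor \<delta> k t \<le> t" "t \<le> grid_point \<delta> k (Suc (grid_index \<delta> k t))"
    unfolding grid_point_def using u(4) \<delta> unfolding u_def[symmetric]
    by (metis add_left_mono diff_ge_0_iff_ge less_imp_le mult_left_mono)+
qed

lemma grid_floor_close: "t \<in> {\<delta>..1} \<Longrightarrow> \<bar>t - grid_floor \<delta> k t\<bar> \<le> 1 / 2 ^ k"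
  using grid_cell[of t k] grid_step[of k "grid_index \<delta> k t"] by linarith

text \<open>
  Passing from a grid to the next finer one moves the left end point by at most one fine cell, so the
  increments over single cells control the increment from the coarsest to the finest level.
\<close>

lemma grid_chain:
  fixes f :: "real \<Rightarrow> real"
  assumes t: "t \<in> {\<delta>..1}" and kn: "k \<le> n"
    and inc: "\<And>j i. k \<le> j \<Longrightarrow> j \<le> n \<Longrightarrow> i < 2 ^ j \<Longrightarrow> \<bar>f (grid_point \<delta> j (Suc i)) - f (grid_point \<delta> j i)\<bar> \<le> a j"
    and a: "\<And>j. 0 \<le> a j"
  shows "\<bar>f (grid_floor \<delta> n t) - f (grid_floor \<delta> k t)\<bar> \<le> (\<Sum>j=k..n. a j)"
proof -
  have "l \<le> n \<Longrightarrow> \<bar>f (grid_floor \<delta> l t) - f (grid_floor \<delta> k t)\<bar> \<le> (\<Sum>j=k..l. a j)" if "k \<le> l" for l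
    using that
  proof (induction l rule: dec_induct)
    case base
    then show ?case by (simp add: a)
  next
    case (step l)
    define i where "i = grid_index \<delta> l t"
    have half: "grid_point \<delta> l i = grid_point \<delta> (Suc l) (2 * i)" by (simp add: grid_point_def)
    define x where "x = 2 ^ l * ((t - \<delta>) / (1 - \<delta>))"
    have "\<lfloor>2 * x\<rfloor> = 2 * \<lfloor>x\<rfloor> \<or> \<lfloor>2 * x\<rfloor> = 2 * \<lfloor>x\<rfloor> + 1"
      using floor_correct[of x] floor_correct[of "2 * x"] by linarith
    moreover have "real i = of_int \<lfloor>x\<rfloor>" "real (grid_index \<delta> (Suc l) t) = of_int \<lfloor>2 * x\<rfloor>"
      using grid_index_bounds(3)[OF t, of l] grid_index_bounds(3)[OF t, of "Suc l"]
      by (simp_all add: i_def x_def mult.assoc)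
    ultimately have "real (grid_index \<delta> (Suc l) t) = real (2 * i) \<or> real (grid_index \<delta> (Suc l) t) = real (Suc (2 * i))"
      by auto
    then have cases: "grid_index \<delta> (Suc l) t = 2 * i \<or> grid_index \<delta> (Suc l) t = Suc (2 * i)"
      by (simp only: of_nat_eq_iff)
    have "\<bar>f (grid_floor \<delta> (Suc l) t) - f (grid_point \<delta> l i)\<bar> \<le> a (Suc l)"
    proof (cases "grid_index \<delta> (Suc l) t = 2 * i")
      case True
      then show ?thesis by (simp add: a half)
    next
      case False
      then have eq: "grid_index \<delta> (Suc l) t = Suc (2 * i)" using cases by simp
      then have "2 * i < 2 ^ Suc l" using grid_index_le[OF t, of "Suc l"] by linarith
      from inc[OF _ _ this] step.hyps step.prems show ?thesis unfolding eq half by simp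
    qed
    moreover have "\<bar>f (grid_floor \<delta> l t) - f (grid_floor \<delta> k t)\<bar> \<le> (\<Sum>j=k..l. a j)"
      using step by simp
    ultimately have "\<bar>f (grid_floor \<delta> (Suc l) t) - f (grid_floor \<delta> k t)\<bar> \<le> (\<Sum>j=k..l. a j) + a (Suc l)"
      unfolding i_def by linarith
    then show ?case using step.hyps by simp
  qed
  with kn show ?thesis by blast
qed

end

text \<open>
  The distribution function is prescribed on \<open>{\<delta>..1}\<close> only. Observations outside of this interval are
  not excluded, so a random subsample can be treated by moving all other observations out of sight.
\<close>

locale empirical_sample = prob_space M for M :: "'w measure" +
  fixes m :: nat and X :: "nat \<Rightarrow> 'w \<Rightarrow> real" and \<mu> :: "real \<Rightarrow> real" and \<delta> C :: real
  assumes \<delta>: "0 \<le> \<delta>" "\<delta> < 1" and m: "m \<ge> 1"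
    and indep: "indep_vars (\<lambda>_. borel) X {1..m}"
    and cdf: "\<And>i t. i \<in> {1..m} \<Longrightarrow> t \<in> {\<delta>..1} \<Longrightarrow> prob {\<omega> \<in> space M. X i \<omega> \<le> t} = \<mu> t"
    and C: "C \<ge> 1" and lip: "\<And>s t. s \<in> {\<delta>..1} \<Longrightarrow> t \<in> {\<delta>..1} \<Longrightarrow> s \<le> t \<Longrightarrow> \<mu> t - \<mu> s \<le> C * (t - s)"
begin

lemma X_meas [measurable]: "i \<in> {1..m} \<Longrightarrow> X i \<in> borel_measurable M"
  using indep by (auto simp: indep_vars_def)

lemma empirical_measurable [measurable]: "empirical m X \<mu> t \<in> borel_measurable M"
  unfolding empirical_def by measurable

lemma \<mu>_mono: "s \<in> {\<delta>..1} \<Longrightarrow> t \<in> {\<delta>..1} \<Longrightarrow> s \<le> t \<Longrightarrow> \<mu> s \<le> \<mu> t"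
  using m by (subst (1 2) cdf[of 1, symmetric]) (auto intro!: finite_measure_mono)

lemma \<mu>_bounds: "t \<in> {\<delta>..1} \<Longrightarrow> 0 \<le> \<mu> t \<and> \<mu> t \<le> 1"
  using m cdf[of 1 t, symmetric] by simp

lemma empirical_tail:
  assumes "t \<in> {\<delta>..1}"
  shows "prob {\<omega> \<in> space M. \<bar>empirical m X \<mu> t \<omega>\<bar> \<ge> x} \<le> 2 * exp (1 - x)"
proof -
  have "prob {\<omega> \<in> space M. \<bar>(\<Sum>i=1..m. of_bool (X i \<omega> \<le> t)) - real m * \<mu> t\<bar> \<ge> x * sqrt (real m * 1)} \<le> 2 * exp (1 - x)"
  proof (rule bernoulli_sum_tail)
    show "indep_vars (\<lambda>_. borel) (\<lambda>i \<omega>. of_bool (X i \<omega> \<le> t)) {1..m}"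
      by (rule indep_vars_compose2[OF indep]) measurable
    show "expectation (\<lambda>\<omega>. of_bool (X i \<omega> \<le> t)) = \<mu> t" if "i \<in> {1..m}" for i
    proof -
      have "expectation (\<lambda>\<omega>. of_bool (X i \<omega> \<le> t)) = expectation (indicator {\<omega> \<in> space M. X i \<omega> \<le> t})"
        by (intro Bochner_Integration.integral_cong) (auto simp: indicator_def)
      also have "\<dots> = prob {\<omega> \<in> space M. X i \<omega> \<le> t}"
        by (simp, rule arg_cong[of _ _ prob], auto)
      finally show ?thesis by (simp only: cdf[OF that assms])
    qed
  qed (use \<mu>_bounds[OF assms] m in auto)
  moreover have "\<bar>empirical m X \<mu> t \<omega>\<bar> \<ge> x \<longleftrightarrow> \<bar>(\<Sum>i=1..m. of_bool (X i \<omega> \<le> t)) - real m * \<mu> t\<bar> \<ge> x * sqrt (real m * 1)" for \<omega>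
    using m by (simp add: empirical_def abs_divide field_simps)
  ultimately show ?thesis by simp
qed

lemma empirical_increment_tail:
  assumes st: "s \<in> {\<delta>..1}" "t \<in> {\<delta>..1}" "s \<le> t" and q: "\<mu> t - \<mu> s \<le> q" "real m * q \<ge> 1"
  shows "prob {\<omega> \<in> space M. \<bar>empirical m X \<mu> t \<omega> - empirical m X \<mu> s \<omega>\<bar> \<ge> x * sqrt q} \<le> 2 * exp (1 - x)"
proof -
  have "prob {\<omega> \<in> space M. \<bar>(\<Sum>i=1..m. of_bool (s < X i \<omega> \<and> X i \<omega> \<le> t)) - real m * (\<mu> t - \<mu> s)\<bar> \<ge> x * sqrt (real m * q)}
      \<le> 2 * exp (1 - x)"
  proof (rule bernoulli_sum_tail)
    show "indep_vars (\<lambda>_. borel) (\<lambda>i \<omega>. of_bool (s < X i \<omega> \<and> X i \<omega> \<le> t)) {1..m}"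
      by (rule indep_vars_compose2[OF indep]) measurable
    show "expectation (\<lambda>\<omega>. of_bool (s < X i \<omega> \<and> X i \<omega> \<le> t)) = \<mu> t - \<mu> s" if i: "i \<in> {1..m}" for i
    proof -
      note [measurable] = X_meas[OF i]
      have "expectation (\<lambda>\<omega>. of_bool (s < X i \<omega> \<and> X i \<omega> \<le> t)) =
          expectation (indicator ({\<omega> \<in> space M. X i \<omega> \<le> t} - {\<omega> \<in> space M. X i \<omega> \<le> s}))"
        by (intro Bochner_Integration.integral_cong) (auto simp: indicator_def)
      also have "\<dots> = prob ({\<omega> \<in> space M. X i \<omega> \<le> t} - {\<omega> \<in> space M. X i \<omega> \<le> s})" by simp
      also have "\<dots> = \<mu> t - \<mu> s"
        using st by (subst finite_measure_Diff) (auto simp: cdf[OF i])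
      finally show ?thesis .
    qed
  qed (use \<mu>_mono[OF st] q in auto)
  moreover have "\<bar>empirical m X \<mu> t \<omega> - empirical m X \<mu> s \<omega>\<bar> \<ge> x * sqrt q \<longleftrightarrow>
      \<bar>(\<Sum>i=1..m. of_bool (s < X i \<omega> \<and> X i \<omega> \<le> t)) - real m * (\<mu> t - \<mu> s)\<bar> \<ge> x * sqrt (real m * q)" for \<omega>
  proof -
    have "(\<Sum>i=1..m. of_bool (s < X i \<omega> \<and> X i \<omega> \<le> t)) = (\<Sum>i=1..m. of_bool (X i \<omega> \<le> t) - of_bool (X i \<omega> \<le> s) :: real)"
      using st(3) by (intro sum.cong) auto
    then have "empirical m X \<mu> t \<omega> - empirical m X \<mu> s \<omega> =
        ((\<Sum>i=1..m. of_bool (s < X i \<omega> \<and> X i \<omega> \<le> t)) - real m * (\<mu> t - \<mu> s)) / sqrt (real m)"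
      by (simp add: empirical_def sum_subtractf diff_divide_distrib[symmetric] algebra_simps)
    moreover have "x * sqrt (real m * q) = (x * sqrt q) * sqrt (real m)" by (simp add: real_sqrt_mult)
    moreover have "sqrt (real m) > 0" using m by simp
    ultimately show ?thesis by (simp only: abs_divide pos_le_divide_eq abs_of_pos)
  qed
  ultimately show ?thesis by simp
qed

text \<open>
  Inside of a cell, both the empirical and the theoretical distribution function are monotone, so
  the process cannot exceed its increment over the cell by more than the drift.
\<close>

lemma empirical_between:
  assumes "s \<in> {\<delta>..1}" "t \<in> {\<delta>..1}" "s' \<in> {\<delta>..1}" "s \<le> t" "t \<le> s'" and "\<mu> s' - \<mu> s \<le> q"
  shows "\<bar>empirical m X \<mu> t \<omega> - empirical m X \<mu> s \<omega>\<bar> \<le> \<bar>empirical m X \<mu> s' \<omega> - empirical m X \<mu> s \<omega>\<bar> + sqrt (real m) * q"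
proof -
  define c where "c u = (\<Sum>i=1..m. of_bool (X i \<omega> \<le> u) :: real)" for u
  have c: "c s \<le> c t" "c t \<le> c s'" unfolding c_def by (intro sum_mono; use assms in force)+
  have \<mu>: "\<mu> s \<le> \<mu> t" "\<mu> t \<le> \<mu> s'" using \<mu>_mono assms by auto
  have mq: "real m * (\<mu> s' - \<mu> s) \<le> real m * q" using assms(6) by (intro mult_left_mono) auto
  have m\<mu>: "real m * \<mu> s \<le> real m * \<mu> t" "real m * \<mu> t \<le> real m * \<mu> s'" using \<mu> by (auto intro!: mult_left_mono)
  let ?d = "\<lambda>u. c u - real m * \<mu> u"
  have "\<bar>?d t - ?d s\<bar> \<le> \<bar>?d s' - ?d s\<bar> + real m * q"
    using c m\<mu> mq unfolding right_diff_distrib by linarith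
  then have "\<bar>?d t - ?d s\<bar> / sqrt (real m) \<le> (\<bar>?d s' - ?d s\<bar> + real m * q) / sqrt (real m)"
    by (intro divide_right_mono) auto
  moreover have "\<bar>empirical m X \<mu> u \<omega> - empirical m X \<mu> s \<omega>\<bar> = \<bar>?d u - ?d s\<bar> / sqrt (real m)" for u
    unfolding empirical_def c_def by (simp add: diff_divide_distrib[symmetric] abs_divide)
  moreover have "real m * q / sqrt (real m) = sqrt (real m) * q"
    by (simp only: times_divide_eq_left[symmetric] real_div_sqrt of_nat_0_le_iff)
  ultimately show ?thesis by (simp add: add_divide_distrib)
qed

text \<open>
  Chaining. An increment over a cell of level \<open>j\<close> has standard deviation at most \<open>sqrt (C / 2 ^ j)\<close>; as
  long as \<open>2 ^ j \<le> m\<close> its tail is exponential, and the thresholds \<open>2 j\<close> standard deviations make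
  both the failure probabilities \<open>2 ^ j exp (- 2 j)\<close> and the thresholds themselves summable. At
  the last such level a cell contains boundedly many observations on average, and monotonicity takes over.
\<close>

lemma empirical_chaining:
  assumes k: "2 ^ k \<le> m"
  shows "\<exists>n\<ge>k. nearly_surely M (\<Sum>j=k..n. 2 * exp 1 * (2 * exp (-2)) ^ j)
     (\<lambda>\<omega>. \<forall>t\<in>{\<delta>..1}. \<bar>empirical m X \<mu> t \<omega> - empirical m X \<mu> (grid_floor \<delta> k t) \<omega>\<bar>
        \<le> 2 * (\<Sum>j=k..n. 2 * real j * sqrt (C / 2 ^ j)) + 2 * C / sqrt (real m))"
proof -
  obtain n where n: "2 ^ n \<le> m" "m < 2 ^ (n + 1)" using ex_power_ivl1[of 2 m] m by auto
  have "(2::nat) ^ k < 2 ^ (n + 1)" using k n(2) by linarith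
  then have kn: "k \<le> n" using power_less_imp_less_exp[of "2::nat" k "n + 1"] by simp
  define a where "a j = 2 * real j * sqrt (C / 2 ^ j)" for j
  have a0: "0 \<le> a j" for j unfolding a_def using C by simp
  let ?E = "\<lambda>t \<omega>. empirical m X \<mu> t \<omega>" and ?g = "grid_point \<delta>"
  have cell: "?g j i \<in> {\<delta>..1}" "?g j (Suc i) \<in> {\<delta>..1}" "?g j i \<le> ?g j (Suc i)"
    "\<mu> (?g j (Suc i)) - \<mu> (?g j i) \<le> C / 2 ^ j" if "i < 2 ^ j" for i j
  proof -
    show "?g j i \<in> {\<delta>..1}" "?g j (Suc i) \<in> {\<delta>..1}" "?g j i \<le> ?g j (Suc i)"
      using that by (auto intro!: grid_point_in[OF \<delta>] grid_point_mono[OF \<delta>] simp del: atLeastAtMost_iff)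
    from lip[OF this] show "\<mu> (?g j (Suc i)) - \<mu> (?g j i) \<le> C / 2 ^ j"
      using mult_left_mono[OF grid_step[OF \<delta>, of j i], of C] C by simp
  qed
  define B where "B j i = {\<omega> \<in> space M. \<bar>?E (?g j (Suc i)) \<omega> - ?E (?g j i) \<omega>\<bar> \<ge> a j}" for j i
  have B [measurable]: "B j i \<in> events" for j i unfolding B_def by measurable
  have B_prob: "prob (B j i) \<le> 2 * exp (1 - 2 * real j)" if "j \<le> n" "i < 2 ^ j" for i j
    unfolding B_def a_def
  proof (rule empirical_increment_tail[OF cell, OF that(2) that(2) that(2) that(2)])
    have "real (2 ^ j) \<le> real (2 ^ n)" using that(1) by simp
    also have "\<dots> \<le> real m" using n(1) by (simp only: of_nat_le_iff)
    finally have "2 ^ j \<le> real m * 1" by simp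
    also have "\<dots> \<le> real m * C" using C by (intro mult_left_mono) auto
    finally show "1 \<le> real m * (C / 2 ^ j)" by (simp add: field_simps)
  qed
  define A where "A = (\<Union>j\<in>{k..n}. \<Union>i\<in>{..<2^j}. B j i)"
  have A: "A \<in> events" unfolding A_def by auto
  have "prob A \<le> (\<Sum>j=k..n. prob (\<Union>i\<in>{..<2^j}. B j i))"
    unfolding A_def by (intro finite_measure_subadditive_finite) auto
  also have "\<dots> \<le> (\<Sum>j=k..n. \<Sum>i<2^j. prob (B j i))"
    by (intro sum_mono finite_measure_subadditive_finite) auto
  also have "\<dots> \<le> (\<Sum>j=k..n. \<Sum>i<(2::nat)^j. 2 * exp (1 - 2 * real j))"
    by (intro sum_mono B_prob) auto
  also have "\<dots> = (\<Sum>j=k..n. 2 * exp 1 * (2 * exp (-2)) ^ j)"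
    by (intro sum.cong refl) (simp add: power_mult_distrib exp_diff exp_minus exp_of_nat_mult[symmetric] field_simps power_inverse)
  finally have A_prob: "prob A \<le> (\<Sum>j=k..n. 2 * exp 1 * (2 * exp (-2)) ^ j)" .
  \<comment> \<open>\<open>n\<close> is the last level with \<open>2 ^ n \<le> m\<close>, so the expected number of observations in a cell is at most \<open>2 C\<close>\<close>
  have sqm: "sqrt (real m) * (C / 2 ^ n) \<le> 2 * C / sqrt (real m)"
  proof -
    have "real m < real (2 ^ (n + 1))" using n(2) by (simp only: of_nat_less_iff)
    then have "real m \<le> 2 * 2 ^ n" by simp
    then have "real m * C \<le> (2 * 2 ^ n) * C" using C by (intro mult_right_mono) auto
    moreover have "sqrt (real m) * sqrt (real m) = real m" by simp
    ultimately have "sqrt (real m) * C * sqrt (real m) \<le> 2 * C * 2 ^ n" by (simp add: algebra_simps)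
    then show ?thesis using m by (simp add: field_simps)
  qed
  have bound: "\<bar>?E t \<omega> - ?E (grid_floor \<delta> k t) \<omega>\<bar> \<le> 2 * (\<Sum>j=k..n. a j) + 2 * C / sqrt (real m)"
    if \<omega>: "\<omega> \<in> space M - A" and t: "t \<in> {\<delta>..1}" for \<omega> t
  proof -
    have inc: "\<bar>?E (?g j (Suc i)) \<omega> - ?E (?g j i) \<omega>\<bar> \<le> a j" if "k \<le> j" "j \<le> n" "i < 2 ^ j" for i j
      using \<omega> that unfolding A_def B_def by (force simp: not_le)
    have 1: "\<bar>?E (grid_floor \<delta> n t) \<omega> - ?E (grid_floor \<delta> k t) \<omega>\<bar> \<le> (\<Sum>j=k..n. a j)"
      by (rule grid_chain[OF \<delta> t kn inc a0])
    have 2: "\<bar>?E t \<omega> - ?E (grid_floor \<delta> n t) \<omega>\<bar> \<le> (\<Sum>j=k..n. a j) + 2 * C / sqrt (real m)"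
    proof (cases "grid_index \<delta> n t < 2 ^ n")
      case True
      note c = cell[OF True]
      from empirical_between[OF c(1) t c(2) grid_cell[OF \<delta> t] c(4), of \<omega>]
      have "\<bar>?E t \<omega> - ?E (grid_floor \<delta> n t) \<omega>\<bar> \<le> a n + sqrt (real m) * (C / 2 ^ n)"
        using inc[OF kn order_refl True] by linarith
      also have "a n \<le> (\<Sum>j=k..n. a j)" using kn a0 by (intro member_le_sum) auto
      finally show ?thesis using sqm by linarith
    next
      \<comment> \<open>only the right end point of the interval has index \<open>2 ^ n\<close>\<close>
      case False
      then have "grid_index \<delta> n t = 2 ^ n" using grid_index_le[OF \<delta> t, of n] by simp
      then have "grid_floor \<delta> n t = 1" by (simp add: grid_point_def)
      moreover have "t = 1" using calculation grid_cell(1)[OF \<delta> t, of n] t by simp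
      ultimately show ?thesis using a0 C by (auto intro!: add_nonneg_nonneg sum_nonneg)
    qed
    show ?thesis using 1 2 by linarith
  qed
  show ?thesis using kn A A_prob bound unfolding a_def nearly_surely_def by blast
qed

end

lemma summable_tail_small:
  fixes u :: "nat \<Rightarrow> real"
  assumes "summable u" "\<And>j. 0 \<le> u j" "e > 0"
  shows "\<exists>k0. \<forall>k\<ge>k0. \<forall>n. (\<Sum>j=k..n. u j) < e"
proof -
  obtain k0 where k0: "\<And>k n. k \<ge> k0 \<Longrightarrow> norm (\<Sum>j=k..<n. u j) < e"
    using assms(1,3) unfolding summable_Cauchy by blast
  have "(\<Sum>j=k..<Suc n. u j) < e" if "k \<ge> k0" for k n
    using k0[OF that, of "Suc n"] unfolding real_norm_def by (rule le_less_trans[OF abs_ge_self])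
  then show ?thesis by (auto simp: atLeastLessThanSuc_atLeastAtMost)
qed

lemma chaining_constants:
  assumes "e > 0"
  shows "\<exists>k0. \<forall>k\<ge>k0. \<forall>n. (\<Sum>j=k..n. 2 * exp 1 * (2 * exp (-2)) ^ j) < (e::real)"
    "\<exists>k0. \<forall>k\<ge>k0. \<forall>n. (\<Sum>j=k..n. 2 * real j * sqrt (C / 2 ^ j)) < e"
proof -
  have "2 * exp (-2::real) < 1"
  proof -
    have "(2::real) < 1 + 2" by simp
    also have "\<dots> \<le> exp 2" by (rule exp_ge_add_one_self)
    finally show ?thesis by (simp add: exp_minus field_simps)
  qed
  then have "summable (\<lambda>j. 2 * exp 1 * (2 * exp (-2::real)) ^ j)"
    by (intro summable_mult summable_geometric) simp
  from summable_tail_small[OF this _ assms]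
  show "\<exists>k0. \<forall>k\<ge>k0. \<forall>n. (\<Sum>j=k..n. 2 * exp 1 * (2 * exp (-2)) ^ j) < e" by simp
  show "\<exists>k0. \<forall>k\<ge>k0. \<forall>n. (\<Sum>j=k..n. 2 * real j * sqrt (C / 2 ^ j)) < e"
  proof (cases "C \<ge> 0")
    case True
    have "summable (\<lambda>j. real (Suc j) * (1 / sqrt 2) ^ j)"
      using geometric_deriv_sums[of "1 / sqrt (2::real)"] by (auto dest: sums_summable)
    then have "summable (\<lambda>j. 2 * sqrt C * (real (Suc j) * (1 / sqrt 2) ^ j))" by (rule summable_mult)
    then have "summable (\<lambda>j. 2 * real j * sqrt (C / 2 ^ j))"
    proof (rule summable_comparison_test[rotated], intro exI[of _ 0] allI impI)
      fix j
      have "sqrt (C / 2 ^ j) = sqrt C * (1 / sqrt 2) ^ j"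
        by (simp add: real_sqrt_divide real_sqrt_power power_divide)
      then have "norm (2 * real j * sqrt (C / 2 ^ j)) = (2 * sqrt C * (1 / sqrt 2) ^ j) * real j"
        using True by (simp add: abs_mult)
      also have "\<dots> \<le> (2 * sqrt C * (1 / sqrt 2) ^ j) * real (Suc j)"
        using True by (intro mult_left_mono) auto
      finally show "norm (2 * real j * sqrt (C / 2 ^ j)) \<le> 2 * sqrt C * (real (Suc j) * (1 / sqrt 2) ^ j)"
        by (simp add: algebra_simps)
    qed
    from summable_tail_small[OF this _ assms] True show ?thesis by simp
  next
    case False
    then have "(\<Sum>j=k..n. 2 * real j * sqrt (C / 2 ^ j)) \<le> 0" for k n
      by (intro sum_nonpos mult_nonneg_nonpos) (auto simp: divide_nonpos_pos)
    then show ?thesis using assms by (meson le_less_trans)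
  qed
qed

section \<open>Characteristic functions of normalized sums and of Gaussian processes\<close>

lemma cmod_iexp_diff_le: "cmod (iexp x - iexp y) \<le> \<bar>x - y\<bar>" for x y :: real
proof -
  have "iexp x - iexp y = iexp y * (iexp (x - y) - 1)"
    by (simp add: right_diff_distrib exp_add[symmetric] algebra_simps)
  then have "cmod (iexp x - iexp y) = cmod (iexp (x - y) - 1)" by (simp add: norm_mult)
  also have "\<dots> \<le> \<bar>x - y\<bar>" using iexp_approx1[of "x - y" 0] by simp
  finally show ?thesis .
qed

lemma (in prob_space) char_close:
  assumes [measurable]: "X \<in> borel_measurable M" "Y \<in> borel_measurable M"
    and A [measurable]: "A \<in> events" and d: "0 \<le> d" "\<And>\<omega>. \<omega> \<in> space M - A \<Longrightarrow> \<bar>X \<omega> - Y \<omega>\<bar> \<le> d"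
  shows "cmod (char (distr M borel X) 1 - char (distr M borel Y) 1) \<le> d + 2 * prob A"
proof -
  have int: "integrable M (\<lambda>\<omega>. iexp (Z \<omega>))" if [measurable]: "Z \<in> borel_measurable M" for Z :: "'a \<Rightarrow> real"
    by (rule integrable_const_bound[of _ 1]) auto
  have char: "char (distr M borel Z) 1 = (\<integral>\<omega>. iexp (Z \<omega>) \<partial>M)" if [measurable]: "Z \<in> borel_measurable M" for Z
    unfolding char_def by (subst integral_distr) auto
  have "cmod (char (distr M borel X) 1 - char (distr M borel Y) 1) = cmod (\<integral>\<omega>. iexp (X \<omega>) - iexp (Y \<omega>) \<partial>M)"
    by (simp add: char int)
  also have "\<dots> \<le> (\<integral>\<omega>. cmod (iexp (X \<omega>) - iexp (Y \<omega>)) \<partial>M)" by (rule integral_norm_bound)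
  also have "\<dots> \<le> (\<integral>\<omega>. d + 2 * indicator A \<omega> \<partial>M)"
  proof (rule integral_mono)
    show "integrable M (\<lambda>\<omega>. cmod (iexp (X \<omega>) - iexp (Y \<omega>)))" by (intro integrable_norm Bochner_Integration.integrable_diff int) auto
    show "integrable M (\<lambda>\<omega>. d + 2 * indicator A \<omega>)" by (simp add: emeasure_eq_measure)
    fix \<omega> assume \<omega>: "\<omega> \<in> space M"
    show "cmod (iexp (X \<omega>) - iexp (Y \<omega>)) \<le> d + 2 * indicator A \<omega>"
    proof (cases "\<omega> \<in> A")
      case True
      have "cmod (iexp (X \<omega>) - iexp (Y \<omega>)) \<le> cmod (iexp (X \<omega>)) + cmod (iexp (Y \<omega>))" by (rule norm_triangle_ineq4)
      then show ?thesis using True d(1) by simp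
    next
      case False
      then show ?thesis using cmod_iexp_diff_le[of "X \<omega>" "Y \<omega>"] d(2)[of \<omega>] \<omega> by simp
    qed
  qed
  also have "\<dots> = d + 2 * prob A" by (simp add: prob_space emeasure_eq_measure)
  finally show ?thesis .
qed

lemma inverse_sqrt_tendsto_0: "(\<lambda>m. c / sqrt (real m)) \<longlonglongrightarrow> 0"
  by (intro tendsto_divide_0[OF tendsto_const] filterlim_at_top_imp_at_infinity
      filterlim_compose[OF sqrt_at_top filterlim_real_sequentially])

lemma inverse_sqrt_small:
  assumes "e > 0"
  shows "eventually (\<lambda>m. c / sqrt (real m) < e) sequentially"
  by (rule order_tendstoD(2)[OF inverse_sqrt_tendsto_0 assms])

text \<open>
  A central limit theorem for triangular arrays, the rows of which live on different probability
  spaces. The characteristic function of a bounded centred summand is \<open>1 - v / (2 * m)\<close> up to an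
  error of order \<open>m powr (- 3 / 2)\<close>, and the errors of the \<open>m\<close> factors of the product add up.
\<close>

lemma char_normalized_sum_tendsto:
  fixes M :: "nat \<Rightarrow> 'w measure" and \<zeta> :: "nat \<Rightarrow> nat \<Rightarrow> 'w \<Rightarrow> real"
  assumes M: "\<And>m. prob_space (M m)"
    and indep: "\<And>m. prob_space.indep_vars (M m) (\<lambda>_. borel) (\<zeta> m) {1..m}"
    and bdd: "\<And>m i \<omega>. \<bar>\<zeta> m i \<omega>\<bar> \<le> c"
    and mean: "\<And>m i. i \<in> {1..m} \<Longrightarrow> integral\<^sup>L (M m) (\<zeta> m i) = 0"
    and var: "\<And>m i. i \<in> {1..m} \<Longrightarrow> integral\<^sup>L (M m) (\<lambda>\<omega>. (\<zeta> m i \<omega>)\<^sup>2) = v"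
  shows "(\<lambda>m. char (distr (M m) borel (\<lambda>\<omega>. (\<Sum>i=1..m. \<zeta> m i \<omega>) / sqrt (real m))) 1)
           \<longlonglongrightarrow> complex_of_real (exp (- v / 2))"
proof -
  have c: "c \<ge> 0" using bdd[of 0 0 undefined] by linarith
  have approx: "cmod (char (distr (M m) borel (\<lambda>\<omega>. (\<Sum>i=1..m. \<zeta> m i \<omega>) / sqrt (real m))) 1 -
      complex_of_real ((1 + (- v / 2) / real m) ^ m)) \<le> c ^ 3 / 6 * (1 / sqrt (real m))"
    if m: "m \<ge> 1" "real m \<ge> \<bar>v\<bar>" for m
  proof -
    interpret prob_space "M m" by (rule M)
    have meas [measurable]: "i \<in> {1..m} \<Longrightarrow> \<zeta> m i \<in> borel_measurable (M m)" for i
      using indep[of m] by (auto simp: indep_vars_def)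
    define \<tau> where "\<tau> = 1 / sqrt (real m)"
    have \<tau>: "0 < \<tau>" "\<tau>\<^sup>2 = 1 / real m" using m by (auto simp: \<tau>_def power_divide)
    have single: "cmod (char (distr (M m) borel (\<lambda>\<omega>. \<zeta> m i \<omega> / sqrt (real m))) 1 - (1 - v / (2 * real m)))
        \<le> \<tau>\<^sup>2 / 6 * (\<tau> * c ^ 3)" if i: "i \<in> {1..m}" for i
    proof -
      let ?D = "distr (M m) borel (\<zeta> m i)"
      note [measurable] = meas[OF i]
      interpret D: real_distribution ?D by (rule real_distribution_distr) simp
      have "AE x in ?D. \<bar>x\<bar> \<le> c" by (subst AE_distr_iff) (auto simp: bdd)
      then have int: "integrable ?D (\<lambda>x. x ^ n)" for n
        by (intro D.integrable_const_bound[of _ "c ^ n"]) (auto elim!: eventually_mono simp: power_abs intro: power_mono)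
      have E1: "D.expectation (\<lambda>x. x) = 0" using mean[OF i] by (subst integral_distr) auto
      have E2: "D.expectation (\<lambda>x. x\<^sup>2) = v" using var[OF i] by (subst integral_distr) auto
      have "cmod (char ?D \<tau> - (1 - \<tau>\<^sup>2 * v / 2)) \<le> (\<tau>\<^sup>2 / 6) * D.expectation (\<lambda>x. min (6 * x\<^sup>2) (\<bar>\<tau>\<bar> * \<bar>x\<bar> ^ 3))"
      proof (rule D.char_approx3)
        show "integrable ?D (\<lambda>x. x)" using int[of 1] by simp
        show "D.variance (\<lambda>x. x) = v" using E1 E2 by simp
      qed (use E1 int in auto)
      also have "D.expectation (\<lambda>x. min (6 * x\<^sup>2) (\<bar>\<tau>\<bar> * \<bar>x\<bar> ^ 3)) \<le> D.expectation (\<lambda>x. \<tau> * c ^ 3)"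
      proof (rule integral_mono_AE')
        show "AE x in ?D. min (6 * x\<^sup>2) (\<bar>\<tau>\<bar> * \<bar>x\<bar> ^ 3) \<le> \<tau> * c ^ 3"
          using \<open>AE x in ?D. \<bar>x\<bar> \<le> c\<close>
        proof eventually_elim
          case (elim x)
          then have "\<bar>\<tau>\<bar> * \<bar>x\<bar> ^ 3 \<le> \<tau> * c ^ 3" using \<tau>(1) by (intro mult_mono power_mono) auto
          then show ?case by (simp add: min.coboundedI2)
        qed
        show "AE x in ?D. 0 \<le> \<tau> * c ^ 3" using \<tau>(1) c by simp
      qed simp
      also have "D.expectation (\<lambda>x. \<tau> * c ^ 3) = \<tau> * c ^ 3" using D.prob_space by simp
      finally have "cmod (char ?D \<tau> - (1 - \<tau>\<^sup>2 * v / 2)) \<le> \<tau>\<^sup>2 / 6 * (\<tau> * c ^ 3)"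
        by (simp add: mult_left_mono)
      moreover have "char (distr (M m) borel (\<lambda>\<omega>. \<zeta> m i \<omega> / sqrt (real m))) 1 = char ?D \<tau>"
        unfolding char_def \<tau>_def by (subst (1 2) integral_distr) (auto simp: field_simps)
      moreover have "\<tau>\<^sup>2 * v / 2 = v / (2 * real m)" using \<tau>(2) by simp
      ultimately show ?thesis by simp
    qed
    have "indep_vars (\<lambda>_. borel) (\<lambda>i \<omega>. \<zeta> m i \<omega> / sqrt (real m)) {1..m}"
      by (rule indep_vars_compose2[OF indep]) simp
    from char_distr_sum[OF this, of 1]
    have prod: "char (distr (M m) borel (\<lambda>\<omega>. (\<Sum>i=1..m. \<zeta> m i \<omega>) / sqrt (real m))) 1 =
        (\<Prod>i=1..m. char (distr (M m) borel (\<lambda>\<omega>. \<zeta> m i \<omega> / sqrt (real m))) 1)"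
      by (simp add: sum_divide_distrib)
    have "\<bar>v / (2 * real m)\<bar> \<le> 1" using m by (simp add: abs_divide field_simps)
    moreover have "v / (2 * real m) \<ge> 0"
    proof -
      have "v \<ge> 0" by (subst var[of 1 m, symmetric]) (use m in auto)
      then show ?thesis by simp
    qed
    ultimately have w: "cmod (1 - complex_of_real v / (2 * of_nat m)) \<le> 1"
    proof -
      have "1 - complex_of_real v / (2 * of_nat m) = complex_of_real (1 - v / (2 * real m))" by simp
      moreover assume "\<bar>v / (2 * real m)\<bar> \<le> 1" "v / (2 * real m) \<ge> 0"
      ultimately show ?thesis by (simp only: norm_of_real)
    qed
    have "cmod (char (distr (M m) borel (\<lambda>\<omega>. (\<Sum>i=1..m. \<zeta> m i \<omega>) / sqrt (real m))) 1 -
      (\<Prod>i=1..m. 1 - complex_of_real v / (2 * of_nat m))) \<le>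
      (\<Sum>i=1..m. cmod (char (distr (M m) borel (\<lambda>\<omega>. \<zeta> m i \<omega> / sqrt (real m))) 1 - (1 - v / (2 * real m))))"
      unfolding prod
    proof (rule order_trans[OF norm_prod_diff])
      show "cmod (char (distr (M m) borel (\<lambda>\<omega>. \<zeta> m i \<omega> / sqrt (real m))) 1) \<le> 1" if "i \<in> {1..m}" for i
        by (intro real_distribution.cmod_char_le_1 real_distribution_distr) (use meas[OF that] in measurable)
    qed (use w in auto)
    also have "\<dots> \<le> (\<Sum>i=1..m. \<tau>\<^sup>2 / 6 * (\<tau> * c ^ 3))" by (rule sum_mono) (rule single)
    also have "\<dots> = c ^ 3 / 6 * (1 / sqrt (real m))"
      using \<tau>(2) m by (simp add: \<tau>_def[symmetric])
    also have "(\<Prod>i=1..m. 1 - complex_of_real v / (2 * of_nat m)) = complex_of_real ((1 + (- v / 2) / real m) ^ m)"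
    proof -
      have "1 + (- v / 2) / real m = 1 - v / (2 * real m)" by simp
      then show ?thesis by (simp only:) simp
    qed
    finally show ?thesis .
  qed
  have null: "(\<lambda>m. char (distr (M m) borel (\<lambda>\<omega>. (\<Sum>i=1..m. \<zeta> m i \<omega>) / sqrt (real m))) 1 -
      complex_of_real ((1 + (- v / 2) / real m) ^ m)) \<longlonglongrightarrow> 0"
  proof (rule Lim_null_comparison)
    show "eventually (\<lambda>m. cmod (char (distr (M m) borel (\<lambda>\<omega>. (\<Sum>i=1..m. \<zeta> m i \<omega>) / sqrt (real m))) 1 -
      complex_of_real ((1 + (- v / 2) / real m) ^ m)) \<le> c ^ 3 / 6 * (1 / sqrt (real m))) sequentially"
      using eventually_ge_at_top[of "1 + nat \<lceil>\<bar>v\<bar>\<rceil>"]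
      by eventually_elim (rule approx, linarith+)
    from tendsto_mult[OF tendsto_const[of "c ^ 3 / 6"] inverse_sqrt_tendsto_0[of 1]]
    show "(\<lambda>m. c ^ 3 / 6 * (1 / sqrt (real m))) \<longlonglongrightarrow> 0" by simp
  qed
  have "(\<lambda>m. complex_of_real ((1 + (- v / 2) / real m) ^ m)) \<longlonglongrightarrow> complex_of_real (exp (- v / 2))"
    by (intro tendsto_of_real tendsto_exp_limit_sequentially)
  from tendsto_add[OF null this] show ?thesis by simp
qed

lemma normal_law_moments:
  assumes N: "prob_space N" and [measurable]: "S \<in> borel_measurable N"
    and law: "distr N borel S = normal_law \<nu> \<sigma>" and \<sigma>: "\<sigma> \<ge> 0"
  shows "integrable N S" "integrable N (\<lambda>\<omega>. (S \<omega>)\<^sup>2)" "integral\<^sup>L N S = \<nu>"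
    "(\<integral>\<omega>. (S \<omega> - \<nu>)\<^sup>2 \<partial>N) = \<sigma>\<^sup>2"
    "char (distr N borel S) 1 = iexp \<nu> * exp (- \<sigma>\<^sup>2 / 2)"
proof -
  interpret prob_space N by fact
  have "integrable N S \<and> integrable N (\<lambda>\<omega>. (S \<omega>)\<^sup>2) \<and> integral\<^sup>L N S = \<nu> \<and>
    (\<integral>\<omega>. (S \<omega> - \<nu>)\<^sup>2 \<partial>N) = \<sigma>\<^sup>2 \<and> char (distr N borel S) 1 = iexp \<nu> * exp (- \<sigma>\<^sup>2 / 2)"
  proof (cases "\<sigma> = 0")
    case True
    then have law: "distr N borel S = return borel \<nu>" using law by (simp add: normal_law_def)
    have "AE x in distr N borel S. x = \<nu>" unfolding law by (subst AE_return) auto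
    then have AE: "AE \<omega> in N. S \<omega> = \<nu>" by (subst (asm) AE_distr_iff) auto
    have "integrable N S" using AE by (subst integrable_cong_AE[of _ _ "\<lambda>_. \<nu>"]) auto
    moreover have "integrable N (\<lambda>\<omega>. (S \<omega>)\<^sup>2)"
      using AE by (subst integrable_cong_AE[of _ _ "\<lambda>_. \<nu>\<^sup>2"]) (auto elim!: eventually_mono)
    moreover have "integral\<^sup>L N S = \<nu>"
      using AE by (subst integral_cong_AE[of _ _ "\<lambda>_. \<nu>"]) (auto simp: prob_space)
    moreover have "(\<integral>\<omega>. (S \<omega> - \<nu>)\<^sup>2 \<partial>N) = 0"
      using AE by (subst integral_cong_AE[of _ _ "\<lambda>_. 0"]) (auto elim!: eventually_mono)
    moreover have "char (distr N borel S) 1 = iexp \<nu>"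
      unfolding char_def law by (subst integral_return) auto
    ultimately show ?thesis using True by simp
  next
    case False
    with \<sigma> have pos: "0 < \<sigma>" by simp
    have "distr N lborel S = distr N borel S" by (rule distr_cong) auto
    then have D: "distributed N lborel S (normal_density \<nu> \<sigma>)"
      using law False by (simp add: distributed_def normal_law_def)
    have int: "integrable N (\<lambda>\<omega>. (S \<omega> - \<nu>) ^ k)" for k
      using integrable_normal_moment[OF pos, of \<nu> k]
      by (subst distributed_integrable[OF D, symmetric]) auto
    have i1: "integrable N S" using Bochner_Integration.integrable_add[OF int[of 1], of "\<lambda>_. \<nu>"] by simp
    have "(S \<omega>)\<^sup>2 = (S \<omega> - \<nu>)\<^sup>2 + 2 * \<nu> * S \<omega> - \<nu>\<^sup>2" for \<omega> by (simp add: power2_eq_square algebra_simps)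
    then have i2: "integrable N (\<lambda>\<omega>. (S \<omega>)\<^sup>2)" using int[of 2] i1 by simp
    have e1: "integral\<^sup>L N S = \<nu>"
      using distributed_integral[OF D, of "\<lambda>x. x"] integral_normal_moment_nz_1[OF pos, of \<nu>] by simp
    have e2: "(\<integral>\<omega>. (S \<omega> - \<nu>)\<^sup>2 \<partial>N) = \<sigma>\<^sup>2"
      using distributed_integral[OF D, of "\<lambda>x. (x - \<nu>)\<^sup>2"] integral_normal_moment_even[OF pos, of \<nu> 1] by simp
    let ?W = "\<lambda>\<omega>. (S \<omega> - \<nu>) / \<sigma>"
    have "distributed N lborel ?W std_normal_density"
      using D unfolding normal_standard_normal_convert[OF pos] .
    then have "distr N lborel ?W = std_normal_distribution" by (simp add: distributed_def)
    moreover have "distr N lborel ?W = distr N borel ?W" by (rule distr_cong) auto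
    ultimately have "char (distr N borel ?W) \<sigma> = exp (- \<sigma>\<^sup>2 / 2)"
      by (simp add: char_std_normal_distribution)
    moreover have "char (distr N borel S) 1 = iexp \<nu> * char (distr N borel ?W) \<sigma>"
    proof -
      have "iexp (S \<omega>) = iexp \<nu> * iexp (\<sigma> * ?W \<omega>)" for \<omega>
      proof -
        have "iexp (\<nu> + \<sigma> * ?W \<omega>) = iexp \<nu> * iexp (\<sigma> * ?W \<omega>)"
          by (simp only: of_real_add distrib_left exp_add)
        moreover have "\<nu> + \<sigma> * ?W \<omega> = S \<omega>" using pos by simp
        ultimately show ?thesis by (simp only:)
      qed
      then have "(\<integral>\<omega>. iexp (S \<omega>) \<partial>N) = iexp \<nu> * (\<integral>\<omega>. iexp (\<sigma> * ?W \<omega>) \<partial>N)"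
        by (simp only: integral_mult_right_zero)
      moreover have "char (distr N borel S) 1 = (\<integral>\<omega>. iexp (S \<omega>) \<partial>N)"
        unfolding char_def by (subst integral_distr) auto
      moreover have "char (distr N borel ?W) \<sigma> = (\<integral>\<omega>. iexp (\<sigma> * ?W \<omega>) \<partial>N)"
        unfolding char_def by (subst integral_distr) auto
      ultimately show ?thesis by simp
    qed
    ultimately show ?thesis using i1 i2 e1 e2 by simp
  qed
  then show "integrable N S" "integrable N (\<lambda>\<omega>. (S \<omega>)\<^sup>2)" "integral\<^sup>L N S = \<nu>"
    "(\<integral>\<omega>. (S \<omega> - \<nu>)\<^sup>2 \<partial>N) = \<sigma>\<^sup>2" "char (distr N borel S) 1 = iexp \<nu> * exp (- \<sigma>\<^sup>2 / 2)" by auto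
qed

text \<open>
  A linear combination of values of a Gaussian process is normal, so its mean and its variance
  determine its characteristic function. The times \<open>q j\<close> may coincide, hence the coefficients that belong
  to the same time are collected first.
\<close>

lemma gaussian_process_char:
  fixes q :: "nat \<Rightarrow> 't"
  assumes G: "gaussian_process N T Z (\<lambda>_. 0) K" and q: "\<And>j. j < k \<Longrightarrow> q j \<in> T"
  shows "char (distr N borel (\<lambda>\<omega>. \<Sum>j<k. c j * Z (q j) \<omega>)) 1 =
    complex_of_real (exp (- (\<Sum>i<k. \<Sum>j<k. c i * c j * K (q i) (q j)) / 2))"
proof -
  have N: "prob_space N" and Z [measurable]: "\<And>t. t \<in> T \<Longrightarrow> Z t \<in> borel_measurable N"
    and lin: "\<And>S c. finite S \<Longrightarrow> S \<subseteq> T \<Longrightarrow> \<exists>\<nu> \<sigma>. \<sigma> \<ge> 0 \<and> distr N borel (\<lambda>\<omega>. \<Sum>s\<in>S. c s * Z s \<omega>) = normal_law \<nu> \<sigma>"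
    and mean: "\<And>t. t \<in> T \<Longrightarrow> integral\<^sup>L N (Z t) = 0"
    and cov: "\<And>s t. s \<in> T \<Longrightarrow> t \<in> T \<Longrightarrow> (\<integral>\<omega>. Z s \<omega> * Z t \<omega> \<partial>N) = K s t"
    using G unfolding gaussian_process_def by auto
  interpret prob_space N by fact
  have Z_int: "integrable N (Z t)" and Z_sq: "integrable N (\<lambda>\<omega>. (Z t \<omega>)\<^sup>2)" if t: "t \<in> T" for t
  proof -
    obtain \<nu> \<sigma> where "\<sigma> \<ge> 0" "distr N borel (Z t) = normal_law \<nu> \<sigma>"
      using lin[of "{t}" "\<lambda>_. 1"] t by auto
    from normal_law_moments[OF N Z[OF t] this(2,1)]
    show "integrable N (Z t)" "integrable N (\<lambda>\<omega>. (Z t \<omega>)\<^sup>2)" by auto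
  qed
  have Z_prod: "integrable N (\<lambda>\<omega>. Z s \<omega> * Z t \<omega>)" if st: "s \<in> T" "t \<in> T" for s t
  proof (rule Bochner_Integration.integrable_bound)
    show "integrable N (\<lambda>\<omega>. (Z s \<omega>)\<^sup>2 + (Z t \<omega>)\<^sup>2)" using Z_sq st by simp
    show "(\<lambda>\<omega>. Z s \<omega> * Z t \<omega>) \<in> borel_measurable N" using st by measurable
    have "\<bar>x * y\<bar> \<le> x\<^sup>2 + y\<^sup>2" for x y :: real
    proof -
      have "0 \<le> (\<bar>x\<bar> - \<bar>y\<bar>)\<^sup>2" by simp
      then have "2 * (\<bar>x\<bar> * \<bar>y\<bar>) \<le> x\<^sup>2 + y\<^sup>2" by (simp add: power2_diff)
      moreover have "0 \<le> \<bar>x\<bar> * \<bar>y\<bar>" by simp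
      ultimately show ?thesis unfolding abs_mult by linarith
    qed
    then show "AE \<omega> in N. norm (Z s \<omega> * Z t \<omega>) \<le> norm ((Z s \<omega>)\<^sup>2 + (Z t \<omega>)\<^sup>2)"
      by (intro AE_I2) simp
  qed
  define S where "S \<omega> = (\<Sum>j<k. c j * Z (q j) \<omega>)" for \<omega>
  define d where "d s = (\<Sum>j | j < k \<and> q j = s. c j)" for s
  have S_eq: "S \<omega> = (\<Sum>s\<in>q ` {..<k}. d s * Z s \<omega>)" for \<omega>
  proof -
    have "S \<omega> = (\<Sum>s\<in>q ` {..<k}. \<Sum>j | j \<in> {..<k} \<and> q j = s. c j * Z (q j) \<omega>)"
      unfolding S_def by (rule sum.image_gen) simp
    also have "\<dots> = (\<Sum>s\<in>q ` {..<k}. d s * Z s \<omega>)"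
      by (intro sum.cong refl) (simp add: d_def sum_distrib_right)
    finally show ?thesis .
  qed
  obtain \<nu> \<sigma> where \<sigma>: "\<sigma> \<ge> 0" and "distr N borel (\<lambda>\<omega>. \<Sum>s\<in>q ` {..<k}. d s * Z s \<omega>) = normal_law \<nu> \<sigma>"
    using lin[of "q ` {..<k}" d] q by auto
  moreover have "S = (\<lambda>\<omega>. \<Sum>s\<in>q ` {..<k}. d s * Z s \<omega>)" by (rule ext) (rule S_eq)
  ultimately have law: "distr N borel S = normal_law \<nu> \<sigma>" by (simp only:)
  have S_meas [measurable]: "S \<in> borel_measurable N"
    unfolding S_def using q by (intro borel_measurable_sum borel_measurable_times) auto
  note mom = normal_law_moments[OF N S_meas law \<sigma>]
  have "integral\<^sup>L N S = 0"
    unfolding S_def using q Z_int mean by (subst Bochner_Integration.integral_sum) auto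
  then have \<nu>: "\<nu> = 0" using mom(3) by simp
  have "\<sigma>\<^sup>2 = (\<integral>\<omega>. S \<omega> * S \<omega> \<partial>N)" using mom(4) unfolding \<nu> by (simp add: power2_eq_square)
  also have "\<dots> = (\<integral>\<omega>. (\<Sum>i<k. \<Sum>j<k. c i * c j * (Z (q i) \<omega> * Z (q j) \<omega>)) \<partial>N)"
    unfolding S_def sum_product by (intro Bochner_Integration.integral_cong sum.cong refl) (simp add: algebra_simps)
  also have "\<dots> = (\<Sum>i<k. \<Sum>j<k. c i * c j * K (q i) (q j))"
  proof -
    have "(\<integral>\<omega>. (\<Sum>i<k. \<Sum>j<k. c i * c j * (Z (q i) \<omega> * Z (q j) \<omega>)) \<partial>N) =
        (\<Sum>i<k. \<integral>\<omega>. (\<Sum>j<k. c i * c j * (Z (q i) \<omega> * Z (q j) \<omega>)) \<partial>N)"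
      using Z_prod q by (intro Bochner_Integration.integral_sum Bochner_Integration.integrable_sum integrable_mult_right) auto
    also have "\<dots> = (\<Sum>i<k. \<Sum>j<k. \<integral>\<omega>. c i * c j * (Z (q i) \<omega> * Z (q j) \<omega>) \<partial>N)"
      using Z_prod q by (intro sum.cong refl Bochner_Integration.integral_sum integrable_mult_right) auto
    also have "\<dots> = (\<Sum>i<k. \<Sum>j<k. c i * c j * K (q i) (q j))"
      using cov q by (intro sum.cong refl) simp
    finally show ?thesis .
  qed
  finally show ?thesis
    using mom(5) unfolding \<nu> S_def[abs_def] by simp
qed

section \<open>Equicontinuity and boundedness of empirical processes\<close>

text \<open>
  The thresholds \<open>k0\<close> and \<open>m0\<close> are the same for all samples whose distribution function has the
  Lipschitz constant \<open>C\<close>, so the statement applies when the probability space changes with \<open>m\<close>.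
\<close>

theorem empirical_equicontinuous:
  fixes C e :: real
  assumes e: "e > 0"
  shows "\<exists>k0. \<forall>k\<ge>k0. \<exists>m0. \<forall>m\<ge>m0. \<forall>(M :: 'w measure) X \<mu>. empirical_sample M m X \<mu> \<delta> C \<longrightarrow>
     nearly_surely M e (\<lambda>\<omega>. \<forall>t\<in>{\<delta>..1}. \<bar>empirical m X \<mu> t \<omega> - empirical m X \<mu> (grid_floor \<delta> k t) \<omega>\<bar> \<le> e)"
proof -
  have e4: "e / 4 > 0" using e by simp
  obtain k1 where k1: "\<And>k n. k \<ge> k1 \<Longrightarrow> (\<Sum>j=k..n. 2 * exp 1 * (2 * exp (-2)) ^ j) < e"
    using chaining_constants(1)[OF e] by blast
  obtain k2 where k2: "\<And>k n. k \<ge> k2 \<Longrightarrow> (\<Sum>j=k..n. 2 * real j * sqrt (C / 2 ^ j)) < e / 4"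
    using chaining_constants(2)[OF e4, of C] by blast
  obtain m1 where m1: "\<And>m. m \<ge> m1 \<Longrightarrow> 2 * C / sqrt (real m) < e / 4"
    using inverse_sqrt_small[OF e4, of "2 * C"] unfolding eventually_sequentially by blast
  show ?thesis
  proof (rule exI[of _ "max k1 k2"], intro allI impI)
    fix k assume k: "max k1 k2 \<le> k"
    show "\<exists>m0. \<forall>m\<ge>m0. \<forall>(M :: 'w measure) X \<mu>. empirical_sample M m X \<mu> \<delta> C \<longrightarrow>
     nearly_surely M e (\<lambda>\<omega>. \<forall>t\<in>{\<delta>..1}. \<bar>empirical m X \<mu> t \<omega> - empirical m X \<mu> (grid_floor \<delta> k t) \<omega>\<bar> \<le> e)"
    proof (intro exI[of _ "max m1 (2 ^ k)"] allI impI)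
      fix m and M :: "'w measure" and X \<mu>
      assume m_ge: "max m1 (2 ^ k) \<le> m" and "empirical_sample M m X \<mu> \<delta> C"
      then interpret empirical_sample M m X \<mu> \<delta> C by simp
      have "2 ^ k \<le> m" using m_ge by simp
      from empirical_chaining[OF this] obtain n where
        chain: "nearly_surely M (\<Sum>j=k..n. 2 * exp 1 * (2 * exp (-2)) ^ j)
          (\<lambda>\<omega>. \<forall>t\<in>{\<delta>..1}. \<bar>empirical m X \<mu> t \<omega> - empirical m X \<mu> (grid_floor \<delta> k t) \<omega>\<bar>
            \<le> 2 * (\<Sum>j=k..n. 2 * real j * sqrt (C / 2 ^ j)) + 2 * C / sqrt (real m))"
        by blast
      have s1: "(\<Sum>j=k..n. 2 * exp 1 * (2 * exp (-2)) ^ j) \<le> e" using k by (intro less_imp_le[OF k1]) simp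
      have s2: "(\<Sum>j=k..n. 2 * real j * sqrt (C / 2 ^ j)) < e / 4" using k by (intro k2) simp
      have s3: "2 * C / sqrt (real m) < e / 4" using m_ge by (intro m1) simp
      have "2 * (\<Sum>j=k..n. 2 * real j * sqrt (C / 2 ^ j)) + 2 * C / sqrt (real m) \<le> e" using s2 s3 e by linarith
      then show "nearly_surely M e (\<lambda>\<omega>. \<forall>t\<in>{\<delta>..1}.
          \<bar>empirical m X \<mu> t \<omega> - empirical m X \<mu> (grid_floor \<delta> k t) \<omega>\<bar> \<le> e)"
        by (intro nearly_surely_mono[OF chain s1]) (blast intro: order_trans)
    qed
  qed
qed

text \<open>
  The process is close to its values on a finite grid, where the tail bounds for a single time apply.
\<close>

theorem empirical_bounded:
  fixes C e :: real
  assumes e: "e > 0"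
  shows "\<exists>R>0. \<exists>m0. \<forall>m\<ge>m0. \<forall>(M :: 'w measure) X \<mu>. empirical_sample M m X \<mu> \<delta> C \<longrightarrow>
     nearly_surely M e (\<lambda>\<omega>. \<forall>t\<in>{\<delta>..1}. \<bar>empirical m X \<mu> t \<omega>\<bar> \<le> R)"
proof -
  have e2: "e / 2 > 0" using e by simp
  obtain k m0 where eq: "\<forall>m\<ge>m0. \<forall>(M :: 'w measure) X \<mu>. empirical_sample M m X \<mu> \<delta> C \<longrightarrow>
     nearly_surely M (e / 2) (\<lambda>\<omega>. \<forall>t\<in>{\<delta>..1}. \<bar>empirical m X \<mu> t \<omega> - empirical m X \<mu> (grid_floor \<delta> k t) \<omega>\<bar> \<le> e / 2)"
    using empirical_equicontinuous[OF e2] by blast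
  define n where "n = real (Suc (2 ^ k))"
  have n: "n > 0" unfolding n_def by (simp only: of_nat_0_less_iff zero_less_Suc)
  \<comment> \<open>so large that the tail bounds at the \<open>n\<close> grid points add up to at most \<open>e / 2\<close>\<close>
  define x where "x = max 1 (1 - ln (e / (4 * n)))"
  have x: "x > 0" "n * (2 * exp (1 - x)) \<le> e / 2"
  proof -
    show "x > 0" unfolding x_def by simp
    have "1 - x \<le> ln (e / (4 * n))" unfolding x_def by linarith
    then have "exp (1 - x) \<le> exp (ln (e / (4 * n)))" by simp
    also have "\<dots> = e / (4 * n)" using e n by simp
    finally show "n * (2 * exp (1 - x)) \<le> e / 2" using n by (simp add: field_simps)
  qed
  show ?thesis
  proof (intro exI[of _ "x + e / 2"] conjI exI[of _ m0] allI impI)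
    show "0 < x + e / 2" using x(1) e by simp
    fix m and M :: "'w measure" and X \<mu>
    assume m_ge: "m0 \<le> m" and sample: "empirical_sample M m X \<mu> \<delta> C"
    then interpret empirical_sample M m X \<mu> \<delta> C by simp
    note close = eq[THEN spec, THEN mp, OF m_ge, THEN spec, THEN spec, THEN spec, THEN mp, OF sample]
    define B where "B i = {\<omega> \<in> space M. \<bar>empirical m X \<mu> (grid_point \<delta> k i) \<omega>\<bar> \<ge> x}" for i
    have B [measurable]: "B i \<in> events" for i unfolding B_def by measurable
    have "prob (\<Union>i\<in>{..2 ^ k}. B i) \<le> (\<Sum>i\<le>2 ^ k. prob (B i))"
      by (intro finite_measure_subadditive_finite) auto
    also have "\<dots> \<le> (\<Sum>i\<le>(2::nat) ^ k. 2 * exp (1 - x))"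
      unfolding B_def by (intro sum_mono empirical_tail grid_point_in[OF \<delta>]) simp
    also have "\<dots> = n * (2 * exp (1 - x))" by (simp add: n_def)
    finally have "prob (\<Union>i\<in>{..2 ^ k}. B i) \<le> e / 2" using x(2) by linarith
    then have "nearly_surely M (e / 2) (\<lambda>\<omega>. \<forall>i\<le>2 ^ k. \<bar>empirical m X \<mu> (grid_point \<delta> k i) \<omega>\<bar> \<le> x)"
      unfolding nearly_surely_def by (intro bexI[of _ "\<Union>i\<in>{..2 ^ k}. B i"]) (auto simp: B_def not_le)
    from nearly_surely_conj[OF close this]
    show "nearly_surely M e (\<lambda>\<omega>. \<forall>t\<in>{\<delta>..1}. \<bar>empirical m X \<mu> t \<omega>\<bar> \<le> x + e / 2)"
    proof (rule nearly_surely_mono)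
      fix \<omega> assume *: "(\<forall>t\<in>{\<delta>..1}. \<bar>empirical m X \<mu> t \<omega> - empirical m X \<mu> (grid_floor \<delta> k t) \<omega>\<bar> \<le> e / 2) \<and>
          (\<forall>i\<le>2 ^ k. \<bar>empirical m X \<mu> (grid_point \<delta> k i) \<omega>\<bar> \<le> x)"
      show "\<forall>t\<in>{\<delta>..1}. \<bar>empirical m X \<mu> t \<omega>\<bar> \<le> x + e / 2"
      proof
        fix t assume t: "t \<in> {\<delta>..1}"
        have "\<bar>empirical m X \<mu> t \<omega> - empirical m X \<mu> (grid_floor \<delta> k t) \<omega>\<bar> \<le> e / 2"
          "\<bar>empirical m X \<mu> (grid_floor \<delta> k t) \<omega>\<bar> \<le> x"
          using * t grid_index_le[OF \<delta> t, of k] by blast+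
        then show "\<bar>empirical m X \<mu> t \<omega>\<bar> \<le> x + e / 2" by linarith
      qed
    qed simp
  qed
qed

section \<open>The mixture model\<close>

lemma measure_uniform_measure_eq:
  assumes A: "A \<in> sets M" "emeasure M A \<noteq> 0" "emeasure M A \<noteq> \<infinity>" and B: "B \<in> sets M"
  shows "measure (uniform_measure M A) B = measure M (A \<inter> B) / measure M A"
proof -
  have "emeasure M (A \<inter> B) \<le> emeasure M A" using A(1) B by (intro emeasure_mono) auto
  then have fin: "emeasure M (A \<inter> B) \<noteq> \<infinity>" using A(3) by (auto simp: top_unique)
  have "measure M A > 0" using A(2,3) by (simp add: measure_def enn2real_positive_iff less_top zero_less_iff_neq_zero)
  then have "emeasure M (A \<inter> B) / emeasure M A = ennreal (measure M (A \<inter> B) / measure M A)"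
    using A(3) fin by (simp add: emeasure_eq_ennreal_measure divide_ennreal)
  then show ?thesis
    using emeasure_uniform_measure[OF A(1) B] by (simp add: measure_def[of "uniform_measure M A"])
qed

lemma strictly_concave_onD:
  assumes "strictly_concave_on S f" "x \<in> S" "y \<in> S" "x \<noteq> y" "0 < u" "u < 1"
  shows "u * f x + (1 - u) * f y < f (u * x + (1 - u) * y)"
  using assms unfolding strictly_concave_on_def by blast

context fdr_mixture_sample
begin

lemma pair_measurable: "i \<in> {1..m} \<Longrightarrow> (\<lambda>\<omega>. (P i \<omega>, H i \<omega>)) \<in> M \<rightarrow>\<^sub>M borel \<Otimes>\<^sub>M count_space UNIV"
  using indep_pairs by (auto simp: indep_vars_def)

lemma P_measurable: "i \<in> {1..m} \<Longrightarrow> P i \<in> borel_measurable M"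
  using measurable_compose[OF pair_measurable measurable_fst] by simp

lemma H_measurable: "i \<in> {1..m} \<Longrightarrow> H i \<in> M \<rightarrow>\<^sub>M count_space UNIV"
  using measurable_compose[OF pair_measurable measurable_snd] by simp

lemma prob_H:
  assumes i: "i \<in> {1..m}" and a: "0 \<le> a" "a \<le> 1"
  shows "prob {\<omega> \<in> space M. H i \<omega>} = a" "prob {\<omega> \<in> space M. \<not> H i \<omega>} = 1 - a"
proof -
  have *: "prob (H i -` {b} \<inter> space M) = pmf (bernoulli_pmf a) b" for b
    using measure_distr[OF H_measurable[OF i], of "{b}"] unfolding law_H[OF i]
    by (simp add: measure_pmf_single)
  have "H i -` {True} \<inter> space M = {\<omega> \<in> space M. H i \<omega>}" "H i -` {False} \<inter> space M = {\<omega> \<in> space M. \<not> H i \<omega>}"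
    by auto
  then show "prob {\<omega> \<in> space M. H i \<omega>} = a" "prob {\<omega> \<in> space M. \<not> H i \<omega>} = 1 - a"
    using *[of True] *[of False] a by simp_all
qed

text \<open>
  The model prescribes conditional laws; what is counted are joint events.
\<close>

lemma prob_conditional:
  assumes i: "i \<in> {1..m}" and A: "A \<in> events" "prob A > 0"
  shows "prob {\<omega> \<in> A. P i \<omega> \<le> t} = prob A * measure (distr (uniform_measure M A) borel (P i)) {..t}"
proof -
  have [measurable]: "P i \<in> borel_measurable M" by (rule P_measurable[OF i])
  have "P i -` {..t} \<inter> space M \<in> events" by measurable
  have "measure (distr (uniform_measure M A) borel (P i)) {..t} = measure (uniform_measure M A) (P i -` {..t} \<inter> space M)"
    by (subst measure_distr) auto
  also have "\<dots> = prob (A \<inter> (P i -` {..t} \<inter> space M)) / prob A"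
    using A by (intro measure_uniform_measure_eq) (auto simp: emeasure_eq_measure)
  also have "A \<inter> (P i -` {..t} \<inter> space M) = {\<omega> \<in> A. P i \<omega> \<le> t}"
    using sets.sets_into_space[OF A(1)] by auto
  finally show ?thesis using A(2) by simp
qed

lemma prob_P_null:
  assumes i: "i \<in> {1..m}" and a: "0 \<le> a" "a \<le> 1" and t: "t \<in> {0..1}"
  shows "prob {\<omega> \<in> space M. P i \<omega> \<le> t \<and> \<not> H i \<omega>} = (1 - a) * t"
proof (cases "a < 1")
  case True
  have [measurable]: "H i \<in> M \<rightarrow>\<^sub>M count_space UNIV" by (rule H_measurable[OF i])
  let ?A = "{\<omega> \<in> space M. \<not> H i \<omega>}"
  have "{\<omega> \<in> space M. P i \<omega> \<le> t \<and> \<not> H i \<omega>} = {\<omega> \<in> ?A. P i \<omega> \<le> t}" by auto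
  then have "prob {\<omega> \<in> space M. P i \<omega> \<le> t \<and> \<not> H i \<omega>} = (1 - a) * measure (uniform_measure lborel {0<..<1::real}) {..t}"
    using prob_conditional[OF i, of ?A t] prob_H(2)[OF i a] True law_P_null[OF i True] by simp
  also have "measure (uniform_measure lborel {0<..<1::real}) {..t} = measure lborel ({0<..<1} \<inter> {..t})"
    by (subst measure_uniform_measure_eq) auto
  also have "{0<..<1} \<inter> {..t} = (if t < 1 then {0<..t} else {0<..<1::real})" by auto
  also have "measure lborel \<dots> = t" using t by auto
  finally show ?thesis .
next
  \<comment> \<open>for \<open>a = 1\<close> no conditional law is prescribed, but there are almost surely no true null hypotheses\<close>
  case False
  have [measurable]: "H i \<in> M \<rightarrow>\<^sub>M count_space UNIV" by (rule H_measurable[OF i])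
  have "prob {\<omega> \<in> space M. P i \<omega> \<le> t \<and> \<not> H i \<omega>} \<le> prob {\<omega> \<in> space M. \<not> H i \<omega>}"
    by (intro finite_measure_mono) auto
  then have "prob {\<omega> \<in> space M. P i \<omega> \<le> t \<and> \<not> H i \<omega>} \<le> 0" using prob_H(2)[OF i a] False by simp
  then show ?thesis using False a measure_nonneg[of M "{\<omega> \<in> space M. P i \<omega> \<le> t \<and> \<not> H i \<omega>}"] by simp
qed

lemma prob_P_alternative:
  assumes i: "i \<in> {1..m}" and a: "0 < a" "a \<le> 1"
  shows "prob {\<omega> \<in> space M. P i \<omega> \<le> t \<and> H i \<omega>} = a * F t"
proof -
  have [measurable]: "H i \<in> M \<rightarrow>\<^sub>M count_space UNIV" by (rule H_measurable[OF i])
  let ?A = "{\<omega> \<in> space M. H i \<omega>}"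
  have "{\<omega> \<in> space M. P i \<omega> \<le> t \<and> H i \<omega>} = {\<omega> \<in> ?A. P i \<omega> \<le> t}" by auto
  then show ?thesis
    using prob_conditional[OF i, of ?A t] prob_H(1)[OF i] a law_P_alternative[OF i a(1)]
    by (simp add: cdf_def fun_eq_iff)
qed

lemma prob_P:
  assumes i: "i \<in> {1..m}" and a: "0 < a" "a \<le> 1" and t: "t \<in> {0..1}"
  shows "prob {\<omega> \<in> space M. P i \<omega> \<le> t} = mixture_cdf a F t"
proof -
  have [measurable]: "H i \<in> M \<rightarrow>\<^sub>M count_space UNIV" "P i \<in> borel_measurable M"
    by (rule H_measurable[OF i], rule P_measurable[OF i])
  have "prob {\<omega> \<in> space M. P i \<omega> \<le> t} = prob ({\<omega> \<in> space M. P i \<omega> \<le> t \<and> \<not> H i \<omega>} \<union> {\<omega> \<in> space M. P i \<omega> \<le> t \<and> H i \<omega>})"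
    by (rule arg_cong[of _ _ prob]) auto
  also have "\<dots> = prob {\<omega> \<in> space M. P i \<omega> \<le> t \<and> \<not> H i \<omega>} + prob {\<omega> \<in> space M. P i \<omega> \<le> t \<and> H i \<omega>}"
    by (intro finite_measure_Union) auto
  finally show ?thesis
    using prob_P_null[OF i _ a(2) t] prob_P_alternative[OF i a] a by (simp add: mixture_cdf_def)
qed

text \<open>
  The contribution of one hypothesis to the linearized false discovery proportion: at the threshold
  \<open>t\<close>, a false rejection counts \<open>1 - Q t\<close> and a correct one \<open>- Q t\<close>, so that \<open>Q t\<close> makes it centred.
\<close>

definition score :: "nat \<Rightarrow> real \<Rightarrow> 'w \<Rightarrow> real" where
  "score i t \<omega> = of_bool (P i \<omega> \<le> t) * (of_bool (\<not> H i \<omega>) - fdp_limit a F t)"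

lemma score_measurable: "i \<in> {1..m} \<Longrightarrow> score i t \<in> borel_measurable M"
proof -
  assume i: "i \<in> {1..m}"
  have [measurable]: "H i \<in> M \<rightarrow>\<^sub>M count_space UNIV" "P i \<in> borel_measurable M"
    by (rule H_measurable[OF i], rule P_measurable[OF i])
  show ?thesis unfolding score_def by measurable
qed

text \<open>
  The product of two scores is \<open>(1 - Q s) * (1 - Q t)\<close> on a false and \<open>Q s * Q t\<close> on a correct rejection at
  the smaller threshold, and \<open>0\<close> otherwise. As \<open>1 - Q t = a * F t / G t\<close>, these two cases are the two
  summands of the covariance kernel.
\<close>

lemma score_moments:
  assumes i: "i \<in> {1..m}" and a: "0 < a" "a \<le> 1" and st: "s \<in> {0..1}" "t \<in> {0..1}"
    and G: "mixture_cdf a F s > 0" "mixture_cdf a F t > 0"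
  shows "expectation (score i t) = 0"
    and "expectation (\<lambda>\<omega>. score i s \<omega> * score i t \<omega>) =
      mixture_cdf a F s * mixture_cdf a F t * fdp_kernel a F s t"
proof -
  have [measurable]: "H i \<in> M \<rightarrow>\<^sub>M count_space UNIV" "P i \<in> borel_measurable M"
    by (rule H_measurable[OF i], rule P_measurable[OF i])
  let ?G = "mixture_cdf a F" and ?Q = "fdp_limit a F"
  let ?A = "\<lambda>t. {\<omega> \<in> space M. P i \<omega> \<le> t \<and> \<not> H i \<omega>}" and ?B = "\<lambda>t. {\<omega> \<in> space M. P i \<omega> \<le> t \<and> H i \<omega>}"
  have [measurable]: "?A t \<in> events" "?B t \<in> events" for t by measurable
  have lin: "expectation (\<lambda>\<omega>. x * indicator (?A t) \<omega> + y * indicator (?B t) \<omega>) = x * ((1 - a) * t) + y * (a * F t)"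
    if "t \<in> {0..1}" for x y t
    using prob_P_null[OF i _ a(2) that] prob_P_alternative[OF i a, of t] a
    by (subst Bochner_Integration.integral_add) (auto simp: emeasure_eq_measure)
  have Q: "1 - ?Q t = a * F t / ?G t" if "?G t > 0" for t
    using that by (simp add: fdp_limit_def mixture_cdf_def field_simps)
  have "expectation (score i t) = expectation (\<lambda>\<omega>. (1 - ?Q t) * indicator (?A t) \<omega> + (- ?Q t) * indicator (?B t) \<omega>)"
    by (intro Bochner_Integration.integral_cong) (auto simp: score_def)
  also have "\<dots> = (1 - ?Q t) * ((1 - a) * t) + (- ?Q t) * (a * F t)" by (rule lin[OF st(2)])
  also have "\<dots> = 0" unfolding Q[OF G(2)] using G(2) by (simp add: fdp_limit_def field_simps)
  finally show "expectation (score i t) = 0" .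
  let ?r = "min s t"
  have r: "?r \<in> {0..1}" using st by auto
  have "expectation (\<lambda>\<omega>. score i s \<omega> * score i t \<omega>) =
      expectation (\<lambda>\<omega>. ((1 - ?Q s) * (1 - ?Q t)) * indicator (?A ?r) \<omega> + (?Q s * ?Q t) * indicator (?B ?r) \<omega>)"
    by (intro Bochner_Integration.integral_cong) (auto simp: score_def)
  also have "\<dots> = ((1 - ?Q s) * (1 - ?Q t)) * ((1 - a) * ?r) + (?Q s * ?Q t) * (a * F ?r)" by (rule lin[OF r])
  also have "\<dots> = ?G s * ?G t * fdp_kernel a F s t"
  proof -
    have "(a * f / g) * (a * f' / g') * (b * r) + (b * s / g) * (b * t / g') * (a * f'') =
        g * g' * (a * b * ((b * s * t * f'' + a * f * f' * r) / (g\<^sup>2 * g'\<^sup>2)))"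
      if "g > 0" "g' > 0" for b f g f' g' f'' r
      using that by (simp add: power2_eq_square field_simps)
    from this[OF G] show ?thesis
      unfolding Q[OF G(1)] Q[OF G(2)] unfolding fdp_limit_def fdp_kernel_def .
  qed
  finally show "expectation (\<lambda>\<omega>. score i s \<omega> * score i t \<omega>) = ?G s * ?G t * fdp_kernel a F s t" .
qed

end

section \<open>The marginal distribution function\<close>

lemma mixture_cdf_bounds:
  assumes a: "0 < a" "a \<le> 1" and F: "distribution_function_01 F" "\<And>t. t \<in> {0..1} \<Longrightarrow> F t \<ge> t" and t: "t \<in> {0..1}"
  shows "t \<le> mixture_cdf a F t" "mixture_cdf a F t \<le> 1" "0 \<le> fdp_limit a F t" "fdp_limit a F t \<le> 1"
proof -
  obtain D where D: "real_distribution D" "F = cdf D" using F(1) unfolding distribution_function_01_def by auto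
  interpret D: real_distribution D by fact
  have F1: "F t \<le> 1" unfolding D(2) cdf_def by simp
  have Ft: "t \<le> F t" by (rule F(2)[OF t])
  have "(1 - a) * t + a * t \<le> mixture_cdf a F t"
    unfolding mixture_cdf_def using a Ft by (intro add_left_mono mult_left_mono) auto
  then show "t \<le> mixture_cdf a F t" by (simp add: algebra_simps)
  have "mixture_cdf a F t \<le> (1 - a) * 1 + a * 1"
    unfolding mixture_cdf_def using a F1 t by (intro add_mono mult_left_mono) auto
  then show "mixture_cdf a F t \<le> 1" by simp
  have G0: "0 \<le> mixture_cdf a F t" using \<open>t \<le> mixture_cdf a F t\<close> t by simp
  show "0 \<le> fdp_limit a F t" unfolding fdp_limit_def using a t G0 by simp
  have "(1 - a) * t \<le> mixture_cdf a F t" unfolding mixture_cdf_def using a Ft t by simp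
  then show "fdp_limit a F t \<le> 1" unfolding fdp_limit_def using G0
    by (cases "mixture_cdf a F t = 0") (auto simp: divide_le_eq)
qed

text \<open>
  The point \<open>s\<close> divides the segment from \<open>0\<close> to \<open>t\<close>, so concavity gives \<open>G s \<ge> (s / t) * G t\<close>, that is,
  \<open>G t - G s \<le> (1 - s / t) * G t\<close>. Near \<open>0\<close> the slope of \<open>G\<close> may be unbounded.
\<close>

lemma strictly_concave_increment:
  assumes conc: "strictly_concave_on {0..1} G" and G0: "0 \<le> G 0" and G1: "\<And>t. t \<in> {0..1} \<Longrightarrow> G t \<le> 1"
    and \<delta>: "0 < \<delta>" and st: "\<delta> \<le> s" "s \<le> t" "t \<le> 1"
  shows "G t - G s \<le> (1 / \<delta>) * (t - s)"
proof (cases "s = t")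
  case False
  define u where "u = s / t"
  have u: "0 < u" "u < 1" "u * t + (1 - u) * 0 = s" using False st \<delta> by (auto simp: u_def)
  have "u * G t + (1 - u) * G 0 < G (u * t + (1 - u) * 0)"
    by (rule strictly_concave_onD[OF conc]) (use u(1,2) st \<delta> in auto)
  moreover have "0 \<le> (1 - u) * G 0" using u G0 by simp
  ultimately have "u * G t < G s" unfolding u(3) by linarith
  then have "G t - G s \<le> (1 - u) * G t" by (simp add: algebra_simps)
  also have "\<dots> \<le> (1 - u) * 1" using u st \<delta> by (intro mult_left_mono G1) auto
  also have "\<dots> = (t - s) / t" using st \<delta> by (simp add: u_def diff_divide_distrib)
  also have "\<dots> \<le> (t - s) / \<delta>" using st \<delta> by (intro divide_left_mono) auto
  finally show ?thesis by simp
qed simp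

text \<open>
  If all null hypotheses are true, \<open>G\<close> is linear.
\<close>

lemma not_strictly_concave_identity: "strictly_concave_on {0..1} (mixture_cdf a F) \<Longrightarrow> a \<noteq> 0"
proof
  assume "strictly_concave_on {0..1} (mixture_cdf a F)" "a = 0"
  with strictly_concave_onD[of "{0..1}" "mixture_cdf a F" 0 1 "1/2"]
  have "1/2 * mixture_cdf 0 F 0 + (1 - 1/2) * mixture_cdf 0 F 1 < mixture_cdf 0 F (1/2 * 0 + (1 - 1/2) * 1)"
    by simp
  then show False by (simp add: mixture_cdf_def)
qed

section \<open>Linearization of the false discovery proportion\<close>

text \<open>
  The \<open>p\<close>-values of the true null hypotheses; all others are moved to \<open>2\<close>, beyond every threshold. The
  empirical distribution function of the masked sample counts the false rejections.
\<close>

definition masked :: "(nat \<Rightarrow> 'w \<Rightarrow> real) \<Rightarrow> (nat \<Rightarrow> 'w \<Rightarrow> bool) \<Rightarrow> nat \<Rightarrow> 'w \<Rightarrow> real" where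
  "masked P H i \<omega> = (if H i \<omega> then 2 else P i \<omega>)"

lemma fdp_bounds: "0 \<le> fdp m P H t \<omega>" "fdp m P H t \<omega> \<le> 1"
proof -
  let ?A = "\<Sum>i=1..m. of_bool (P i \<omega> \<le> t) * (1 - of_bool (H i \<omega>)) :: real"
  let ?B = "(\<Sum>i=1..m. of_bool (P i \<omega> \<le> t)) + of_bool (\<forall>i\<in>{1..m}. P i \<omega> > t) :: real"
  have A: "0 \<le> ?A" by (intro sum_nonneg) auto
  have "?A \<le> (\<Sum>i=1..m. of_bool (P i \<omega> \<le> t))" by (intro sum_mono) auto
  then have AB: "?A \<le> ?B" by (intro add_increasing2) auto
  show "0 \<le> fdp m P H t \<omega>" unfolding fdp_def using A AB by (intro divide_nonneg_nonneg) auto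
  show "fdp m P H t \<omega> \<le> 1" unfolding fdp_def using A AB by (cases "?B = 0") (auto simp: divide_le_eq)
qed

text \<open>
  The numbers of false and of all rejections are \<open>m * Q * G + sqrt m * U\<close> and \<open>m * G + sqrt m * V\<close>. Hence
  \<open>sqrt m * (fdp - Q) = (U - Q * V) / (G + V / sqrt m)\<close>, and replacing the denominator by \<open>G\<close> costs a term of
  order \<open>1 / sqrt m\<close> when \<open>U\<close> and \<open>V\<close> are bounded. The last hypothesis keeps the denominator above
  \<open>d / 2\<close>, and so guarantees that there is a rejection at all.
\<close>

lemma fdp_linearization:
  fixes P :: "nat \<Rightarrow> 'w \<Rightarrow> real" and H :: "nat \<Rightarrow> 'w \<Rightarrow> bool" and m :: nat and a :: real and F :: "real \<Rightarrow> real"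
  defines "U \<equiv> empirical m (masked P H) (\<lambda>t. (1 - a) * t)" and "V \<equiv> empirical m P (mixture_cdf a F)"
  assumes m: "m \<ge> 1" and t: "t \<le> 1" and d: "0 < d" "d \<le> mixture_cdf a F t"
    and Q: "0 \<le> fdp_limit a F t" "fdp_limit a F t \<le> 1"
    and R: "\<bar>U t \<omega>\<bar> \<le> R" "\<bar>V t \<omega>\<bar> \<le> R" "R / sqrt (real m) \<le> d / 2"
  shows "\<bar>sqrt (real m) * (fdp m P H t \<omega> - fdp_limit a F t) - (U t \<omega> - fdp_limit a F t * V t \<omega>) / mixture_cdf a F t\<bar>
    \<le> 4 * R\<^sup>2 / d\<^sup>2 / sqrt (real m)"
proof -
  define G where "G = mixture_cdf a F t"
  define q where "q = fdp_limit a F t"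
  define r where "r = sqrt (real m)"
  have r: "r > 0" "r * r = real m" using m by (auto simp: r_def)
  have G: "G \<ge> d" "G > 0" using d by (auto simp: G_def)
  have qG: "q * G = (1 - a) * t" using G(2) unfolding q_def G_def fdp_limit_def by simp
  define A where "A = (\<Sum>i=1..m. of_bool (P i \<omega> \<le> t) * (1 - of_bool (H i \<omega>)) :: real)"
  define B where "B = (\<Sum>i=1..m. of_bool (P i \<omega> \<le> t) :: real)"
  have "(\<Sum>i=1..m. of_bool (masked P H i \<omega> \<le> t)) = A"
    unfolding A_def masked_def using t by (intro sum.cong refl) auto
  then have A: "A = r * U t \<omega> + r * r * (q * G)"
    unfolding U_def empirical_def r_def[symmetric] qG using r by (simp add: r(2)[symmetric] field_simps)
  have B: "B = r * V t \<omega> + r * r * G"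
    unfolding V_def empirical_def r_def[symmetric] B_def[symmetric] G_def[symmetric] using r by (simp add: r(2)[symmetric] field_simps)
  define w where "w = G + V t \<omega> / r"
  have "\<bar>V t \<omega> / r\<bar> \<le> R / r" using R(2) r(1) by (simp add: abs_divide divide_right_mono)
  then have Vr: "\<bar>V t \<omega> / r\<bar> \<le> d / 2" using R(3) unfolding r_def by linarith
  then have w: "w \<ge> d / 2" "w > 0" using G d unfolding w_def by linarith+
  have Bw: "B = r * r * w" unfolding B w_def using r by (simp add: field_simps)
  then have "B > 0" using mult_pos_pos[OF mult_pos_pos[OF r(1) r(1)] w(2)] by (simp only:)
  have "\<not> (\<forall>i\<in>{1..m}. P i \<omega> > t)"
  proof
    assume "\<forall>i\<in>{1..m}. P i \<omega> > t"
    then have "B = 0" unfolding B_def by (intro sum.neutral) auto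
    with \<open>B > 0\<close> show False by simp
  qed
  then have fdp: "fdp m P H t \<omega> = A / B" unfolding fdp_def A_def[symmetric] B_def[symmetric] by simp
  have Y: "r * (A / B - q) = (U t \<omega> - q * V t \<omega>) / w"
  proof -
    have "A - q * B = r * (U t \<omega> - q * V t \<omega>)" unfolding A B by (simp add: algebra_simps)
    moreover have "r * (A / B - q) = r * (A - q * B) / B" using \<open>B > 0\<close> by (simp add: field_simps)
    ultimately show ?thesis unfolding Bw using r(1) w by simp
  qed
  have diff: "(U t \<omega> - q * V t \<omega>) / w - (U t \<omega> - q * V t \<omega>) / G = (U t \<omega> - q * V t \<omega>) * (- (V t \<omega> / r)) / (w * G)"
  proof -
    have "1 / w - 1 / G = (- (V t \<omega> / r)) / (w * G)"
      using w G unfolding w_def by (simp add: diff_frac_eq)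
    then show ?thesis by (simp only: right_diff_distrib[symmetric] divide_inverse mult_1 mult.assoc)
  qed
  have R0: "R \<ge> 0" using R(1) by linarith
  have "\<bar>q * V t \<omega>\<bar> \<le> 1 * R" unfolding abs_mult using Q R by (intro mult_mono) (auto simp: q_def)
  then have num: "\<bar>U t \<omega> - q * V t \<omega>\<bar> \<le> 2 * R" using R(1) by linarith
  have "\<bar>r * (A / B - q) - (U t \<omega> - q * V t \<omega>) / G\<bar> = \<bar>U t \<omega> - q * V t \<omega>\<bar> * \<bar>V t \<omega> / r\<bar> / (w * G)"
    unfolding Y diff using w(2) G(2) by (simp add: abs_mult)
  also have "\<dots> \<le> (2 * R) * (R / r) / ((d / 2) * d)"
    using num \<open>\<bar>V t \<omega> / r\<bar> \<le> R / r\<close> w G d R0 r(1)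
    by (intro frac_le mult_mono) auto
  also have "\<dots> = 4 * R\<^sup>2 / d\<^sup>2 / r" using d r(1) by (simp add: power2_eq_square field_simps)
  finally show ?thesis unfolding fdp r_def q_def G_def .
qed

section \<open>The limit of the false discovery proportion process\<close>

locale fdr_asymptotics =
  fixes a \<delta> :: real and F :: "real \<Rightarrow> real"
    and M :: "nat \<Rightarrow> 'w measure" and P :: "nat \<Rightarrow> nat \<Rightarrow> 'w \<Rightarrow> real" and H :: "nat \<Rightarrow> nat \<Rightarrow> 'w \<Rightarrow> bool"
  assumes a: "0 < a" "a \<le> 1"
    and F: "distribution_function_01 F" "\<And>t. t \<in> {0..1} \<Longrightarrow> F t \<ge> t"
    and sample: "\<And>m. fdr_mixture_sample (M m) m a F (P m) (H m)"
    and conc: "strictly_concave_on {0..1} (mixture_cdf a F)"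
    and \<delta>: "0 < \<delta>" "\<delta> < 1"
begin

sublocale S: fdr_mixture_sample "M m" m a F "P m" "H m" for m by (rule sample)

abbreviation "G \<equiv> mixture_cdf a F"
abbreviation "Q \<equiv> fdp_limit a F"

text \<open>
  \<open>Y\<close> is the process of interest and \<open>X\<close> its linearization in terms of the empirical processes \<open>U\<close> and \<open>V\<close>
  of the false and of all rejections.
\<close>

definition U :: "nat \<Rightarrow> real \<Rightarrow> 'w \<Rightarrow> real" where "U m = empirical m (masked (P m) (H m)) (\<lambda>t. (1 - a) * t)"
definition V :: "nat \<Rightarrow> real \<Rightarrow> 'w \<Rightarrow> real" where "V m = empirical m (P m) G"
definition X :: "nat \<Rightarrow> real \<Rightarrow> 'w \<Rightarrow> real" where "X m t \<omega> = (U m t \<omega> - Q t * V m t \<omega>) / G t"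
definition Y :: "nat \<Rightarrow> real \<Rightarrow> 'w \<Rightarrow> real" where
  "Y m t \<omega> = sqrt (real m) * (fdp m (P m) (H m) t \<omega> - Q t)"

lemma unit: "t \<in> {\<delta>..1} \<Longrightarrow> t \<in> {0..1}" using \<delta> by auto

lemma G_ge: "t \<in> {\<delta>..1} \<Longrightarrow> \<delta> \<le> G t" "t \<in> {\<delta>..1} \<Longrightarrow> 0 < G t"
  using mixture_cdf_bounds(1)[OF a F, of t] \<delta> by auto

lemma Q_bounds: "t \<in> {\<delta>..1} \<Longrightarrow> 0 \<le> Q t" "t \<in> {\<delta>..1} \<Longrightarrow> Q t \<le> 1"
  using mixture_cdf_bounds(3,4)[OF a F, of t] \<delta> by auto

lemma G_mono: "s \<in> {0..1} \<Longrightarrow> t \<in> {0..1} \<Longrightarrow> s \<le> t \<Longrightarrow> G s \<le> G t"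
proof -
  assume st: "s \<in> {0..1}" "t \<in> {0..1}" "s \<le> t"
  obtain D where D: "real_distribution D" "F = cdf D" using F(1) unfolding distribution_function_01_def by auto
  interpret D: real_distribution D by fact
  have "F s \<le> F t" unfolding D(2) using st(3) by (rule D.cdf_nondecreasing)
  then show "G s \<le> G t" unfolding mixture_cdf_def using a st by (intro add_mono mult_left_mono) auto
qed

lemma G_increment: "s \<in> {\<delta>..1} \<Longrightarrow> t \<in> {\<delta>..1} \<Longrightarrow> s \<le> t \<Longrightarrow> G t - G s \<le> (1 / \<delta>) * (t - s)"
  using mixture_cdf_bounds(1)[OF a F, of 0] mixture_cdf_bounds(2)[OF a F] \<delta>
  by (intro strictly_concave_increment[OF conc]) auto

lemma G_continuous: "continuous_on {\<delta>..1} G"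
proof (rule lipschitz_on_continuous_on)
  show "(1 / \<delta>)-lipschitz_on {\<delta>..1} G"
  proof (rule lipschitz_onI)
    fix s t assume st: "s \<in> {\<delta>..1}" "t \<in> {\<delta>..1}"
    show "dist (G s) (G t) \<le> 1 / \<delta> * dist s t"
    proof (cases "s \<le> t")
      case True
      then show ?thesis using G_increment[OF st] G_mono[OF unit unit, OF st] by (simp add: dist_real_def)
    next
      case False
      then show ?thesis using G_increment[OF st(2,1)] G_mono[OF unit unit, OF st(2,1)] by (simp add: dist_real_def)
    qed
  qed (use \<delta> in simp)
qed

lemma Q_continuous: "continuous_on {\<delta>..1} Q"
  unfolding fdp_limit_def using G_ge(2) by (intro continuous_intros G_continuous) force

lemma inverse_\<delta>: "1 \<le> 1 / \<delta>" using \<delta> by simp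

lemma indep_V: "prob_space.indep_vars (M m) (\<lambda>_. borel) (P m) {1..m}"
proof -
  have "prob_space.indep_vars (M m) (\<lambda>_. borel) (\<lambda>i \<omega>. fst (P m i \<omega>, H m i \<omega>)) {1..m}"
    by (rule S.indep_vars_compose2[OF S.indep_pairs]) simp
  then show ?thesis by simp
qed

lemma indep_U: "prob_space.indep_vars (M m) (\<lambda>_. borel) (masked (P m) (H m)) {1..m}"
proof -
  have "prob_space.indep_vars (M m) (\<lambda>_. borel) (\<lambda>i \<omega>. (\<lambda>(x, h). if h then 2 else x) (P m i \<omega>, H m i \<omega>)) {1..m}"
    by (rule S.indep_vars_compose2[OF S.indep_pairs]) measurable
  then show ?thesis unfolding masked_def by simp
qed

lemma cdf_V: "i \<in> {1..m} \<Longrightarrow> t \<in> {\<delta>..1} \<Longrightarrow> measure (M m) {\<omega> \<in> space (M m). P m i \<omega> \<le> t} = G t"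
  by (rule S.prob_P) (use a unit in auto)

lemma cdf_U: "i \<in> {1..m} \<Longrightarrow> t \<in> {\<delta>..1} \<Longrightarrow> measure (M m) {\<omega> \<in> space (M m). masked (P m) (H m) i \<omega> \<le> t} = (1 - a) * t"
proof -
  assume i: "i \<in> {1..m}" and t: "t \<in> {\<delta>..1}"
  have "{\<omega> \<in> space (M m). masked (P m) (H m) i \<omega> \<le> t} = {\<omega> \<in> space (M m). P m i \<omega> \<le> t \<and> \<not> H m i \<omega>}"
    using t by (auto simp: masked_def)
  then show ?thesis using S.prob_P_null[OF i] a unit[OF t] by simp
qed

lemma empirical_samples:
  assumes m: "m \<ge> 1"
  shows "empirical_sample (M m) m (masked (P m) (H m)) (\<lambda>t. (1 - a) * t) \<delta> (1 / \<delta>)"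
    "empirical_sample (M m) m (P m) G \<delta> (1 / \<delta>)"
proof -
  have "(1 - a) * t - (1 - a) * s \<le> 1 / \<delta> * (t - s)" if "s \<le> t" for s t
  proof -
    have "(1 - a) * (t - s) \<le> 1 / \<delta> * (t - s)" using a inverse_\<delta> that by (intro mult_right_mono) auto
    then show ?thesis by (simp add: algebra_simps)
  qed
  with m \<delta> show "empirical_sample (M m) m (masked (P m) (H m)) (\<lambda>t. (1 - a) * t) \<delta> (1 / \<delta>)"
    by (intro empirical_sample.intro empirical_sample_axioms.intro S.prob_space_axioms indep_U cdf_U inverse_\<delta>) simp_all
  from m \<delta> show "empirical_sample (M m) m (P m) G \<delta> (1 / \<delta>)"
    by (intro empirical_sample.intro empirical_sample_axioms.intro S.prob_space_axioms indep_V cdf_V inverse_\<delta> G_increment) simp_all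
qed

lemma UV_bounded:
  assumes e: "e > 0"
  shows "\<exists>R>0. eventually (\<lambda>m. nearly_surely (M m) e (\<lambda>\<omega>. \<forall>t\<in>{\<delta>..1}. \<bar>U m t \<omega>\<bar> \<le> R \<and> \<bar>V m t \<omega>\<bar> \<le> R)) sequentially"
proof -
  have e2: "e / 2 > 0" using e by simp
  obtain R m0 where R: "R > 0" and bdd: "\<forall>m\<ge>m0. \<forall>(M :: 'w measure) X \<mu>. empirical_sample M m X \<mu> \<delta> (1 / \<delta>) \<longrightarrow>
      nearly_surely M (e / 2) (\<lambda>\<omega>. \<forall>t\<in>{\<delta>..1}. \<bar>empirical m X \<mu> t \<omega>\<bar> \<le> R)"
    using empirical_bounded[OF e2, where 'w = 'w] by blast
  have "nearly_surely (M m) e (\<lambda>\<omega>. \<forall>t\<in>{\<delta>..1}. \<bar>U m t \<omega>\<bar> \<le> R \<and> \<bar>V m t \<omega>\<bar> \<le> R)" if "m \<ge> max 1 m0" for m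
  proof -
    have m: "m0 \<le> m" "1 \<le> m" using that by auto
    note bdd' = bdd[THEN spec, THEN mp, OF m(1), THEN spec, THEN spec, THEN spec, THEN mp]
    show ?thesis
      using nearly_surely_conj[OF bdd'[OF empirical_samples(1)[OF m(2)]] bdd'[OF empirical_samples(2)[OF m(2)]]]
      unfolding U_def V_def by (rule nearly_surely_mono) auto
  qed
  then show ?thesis using R unfolding eventually_sequentially by blast
qed

lemma UV_equicontinuous:
  assumes e: "e > 0"
  shows "\<exists>k0. \<forall>k\<ge>k0. eventually (\<lambda>m. nearly_surely (M m) e (\<lambda>\<omega>. \<forall>t\<in>{\<delta>..1}.
     \<bar>U m t \<omega> - U m (grid_floor \<delta> k t) \<omega>\<bar> \<le> e \<and> \<bar>V m t \<omega> - V m (grid_floor \<delta> k t) \<omega>\<bar> \<le> e)) sequentially"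
proof -
  have e2: "e / 2 > 0" "e / 2 \<le> e" using e by simp_all
  obtain k0 where equi: "\<forall>k\<ge>k0. \<exists>m0. \<forall>m\<ge>m0. \<forall>(M :: 'w measure) X \<mu>. empirical_sample M m X \<mu> \<delta> (1 / \<delta>) \<longrightarrow>
      nearly_surely M (e / 2) (\<lambda>\<omega>. \<forall>t\<in>{\<delta>..1}. \<bar>empirical m X \<mu> t \<omega> - empirical m X \<mu> (grid_floor \<delta> k t) \<omega>\<bar> \<le> e / 2)"
    using empirical_equicontinuous[OF e2(1), where 'w = 'w] by blast
  show ?thesis
  proof (intro exI[of _ k0] allI impI)
    fix k assume "k0 \<le> k"
    from equi[THEN spec, THEN mp, OF this] obtain m0 where
      equi: "\<forall>m\<ge>m0. \<forall>(M :: 'w measure) X \<mu>. empirical_sample M m X \<mu> \<delta> (1 / \<delta>) \<longrightarrow>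
      nearly_surely M (e / 2) (\<lambda>\<omega>. \<forall>t\<in>{\<delta>..1}. \<bar>empirical m X \<mu> t \<omega> - empirical m X \<mu> (grid_floor \<delta> k t) \<omega>\<bar> \<le> e / 2)"
      by blast
    have "nearly_surely (M m) e (\<lambda>\<omega>. \<forall>t\<in>{\<delta>..1}.
      \<bar>U m t \<omega> - U m (grid_floor \<delta> k t) \<omega>\<bar> \<le> e \<and> \<bar>V m t \<omega> - V m (grid_floor \<delta> k t) \<omega>\<bar> \<le> e)" if "m \<ge> max 1 m0" for m
    proof -
      have m: "m0 \<le> m" "1 \<le> m" using that by auto
      note equi' = equi[THEN spec, THEN mp, OF m(1), THEN spec, THEN spec, THEN spec, THEN mp]
      show ?thesis
        using nearly_surely_conj[OF equi'[OF empirical_samples(1)[OF m(2)]] equi'[OF empirical_samples(2)[OF m(2)]]]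
        unfolding U_def V_def by (rule nearly_surely_mono) (use e2(2) in \<open>auto intro: order_trans\<close>)
    qed
    then show "eventually (\<lambda>m. nearly_surely (M m) e (\<lambda>\<omega>. \<forall>t\<in>{\<delta>..1}.
      \<bar>U m t \<omega> - U m (grid_floor \<delta> k t) \<omega>\<bar> \<le> e \<and> \<bar>V m t \<omega> - V m (grid_floor \<delta> k t) \<omega>\<bar> \<le> e)) sequentially"
      unfolding eventually_sequentially by blast
  qed
qed

lemma Y_close_X:
  assumes e: "e > 0"
  shows "eventually (\<lambda>m. nearly_surely (M m) e (\<lambda>\<omega>. \<forall>t\<in>{\<delta>..1}. \<bar>Y m t \<omega> - X m t \<omega>\<bar> \<le> e)) sequentially"
proof -
  obtain R where R: "R > 0"
    "eventually (\<lambda>m. nearly_surely (M m) e (\<lambda>\<omega>. \<forall>t\<in>{\<delta>..1}. \<bar>U m t \<omega>\<bar> \<le> R \<and> \<bar>V m t \<omega>\<bar> \<le> R)) sequentially"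
    using UV_bounded[OF e] by blast
  have d2: "\<delta> / 2 > 0" using \<delta> by simp
  from R(2) inverse_sqrt_small[OF d2, of R] inverse_sqrt_small[OF e, of "4 * R\<^sup>2 / \<delta>\<^sup>2"] eventually_ge_at_top[of 1]
  show ?thesis
  proof eventually_elim
    case (elim m)
    from elim(1) order_refl show ?case
    proof (rule nearly_surely_mono, intro ballI)
      fix \<omega> t assume UV: "\<forall>t\<in>{\<delta>..1}. \<bar>U m t \<omega>\<bar> \<le> R \<and> \<bar>V m t \<omega>\<bar> \<le> R" and t: "t \<in> {\<delta>..1}"
      have "\<bar>Y m t \<omega> - X m t \<omega>\<bar> \<le> 4 * R\<^sup>2 / \<delta>\<^sup>2 / sqrt (real m)"
        unfolding Y_def X_def U_def V_def
        by (rule fdp_linearization) (use elim t UV \<delta> G_ge(1)[OF t] Q_bounds[OF t] in \<open>auto simp: U_def V_def\<close>)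
      then show "\<bar>Y m t \<omega> - X m t \<omega>\<bar> \<le> e" using elim(3) by linarith
    qed
  qed
qed

text \<open>
  \<open>X = \<alpha> * U - \<beta> * V\<close> with the bounded continuous functions \<open>\<alpha> = 1 / G\<close> and \<open>\<beta> = Q / G\<close>. The increments of a
  product are small since the factors are bounded and have small increments.
\<close>

lemma X_equicontinuous:
  assumes e: "e > 0"
  shows "\<exists>k. eventually (\<lambda>m. nearly_surely (M m) e (\<lambda>\<omega>. \<forall>t\<in>{\<delta>..1}. \<bar>X m t \<omega> - X m (grid_floor \<delta> k t) \<omega>\<bar> \<le> e)) sequentially"
proof -
  define \<alpha> where "\<alpha> t = 1 / G t" for t
  define \<beta> where "\<beta> t = Q t / G t" for t
  have X_eq: "X m t \<omega> = \<alpha> t * U m t \<omega> - \<beta> t * V m t \<omega>" for m t \<omega>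
    by (simp add: X_def \<alpha>_def \<beta>_def diff_divide_distrib)
  have \<alpha>\<beta>: "\<bar>\<alpha> t\<bar> \<le> 1 / \<delta>" "\<bar>\<beta> t\<bar> \<le> 1 / \<delta>" if t: "t \<in> {\<delta>..1}" for t
    unfolding \<alpha>_def \<beta>_def abs_divide
    by (rule frac_le; use G_ge[OF t] Q_bounds[OF t] \<delta> in simp)+
  have cont: "continuous_on {\<delta>..1} \<alpha>" "continuous_on {\<delta>..1} \<beta>"
    unfolding \<alpha>_def[abs_def] \<beta>_def[abs_def] using G_ge(2)
    by (intro continuous_intros G_continuous Q_continuous; force)+
  have e2: "e / 2 > 0" using e by simp
  obtain R where R: "R > 0" "eventually (\<lambda>m. nearly_surely (M m) (e / 2) (\<lambda>\<omega>. \<forall>t\<in>{\<delta>..1}. \<bar>U m t \<omega>\<bar> \<le> R \<and> \<bar>V m t \<omega>\<bar> \<le> R)) sequentially"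
    using UV_bounded[OF e2] by blast
  have eR: "e / (4 * R) > 0" using e R by simp
  obtain d1 where d1: "d1 > 0" "\<And>s t. s \<in> {\<delta>..1} \<Longrightarrow> t \<in> {\<delta>..1} \<Longrightarrow> dist t s < d1 \<Longrightarrow> dist (\<alpha> t) (\<alpha> s) < e / (4 * R)"
    using compact_uniformly_continuous[OF cont(1) compact_Icc] eR unfolding uniformly_continuous_on_def by metis
  obtain d2 where d2: "d2 > 0" "\<And>s t. s \<in> {\<delta>..1} \<Longrightarrow> t \<in> {\<delta>..1} \<Longrightarrow> dist t s < d2 \<Longrightarrow> dist (\<beta> t) (\<beta> s) < e / (4 * R)"
    using compact_uniformly_continuous[OF cont(2) compact_Icc] eR unfolding uniformly_continuous_on_def by metis
  define e1 where "e1 = min (e / 2) (\<delta> * e / 4)"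
  have e1: "e1 > 0" "e1 \<le> e / 2" "e1 \<le> \<delta> * e / 4"
    using e \<delta> unfolding e1_def by simp_all
  obtain k0 where k0: "\<And>k. k \<ge> k0 \<Longrightarrow> eventually (\<lambda>m. nearly_surely (M m) e1 (\<lambda>\<omega>. \<forall>t\<in>{\<delta>..1}.
     \<bar>U m t \<omega> - U m (grid_floor \<delta> k t) \<omega>\<bar> \<le> e1 \<and> \<bar>V m t \<omega> - V m (grid_floor \<delta> k t) \<omega>\<bar> \<le> e1)) sequentially"
    using UV_equicontinuous[OF e1(1)] by blast
  have "(\<lambda>k. (1/2::real) ^ k) \<longlonglongrightarrow> 0" by (intro LIMSEQ_power_zero) simp
  then have "eventually (\<lambda>k. (1/2::real) ^ k < min d1 d2) sequentially"
    using d1(1) d2(1) by (intro order_tendstoD(2)) auto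
  then have "eventually (\<lambda>k. (1/2::real) ^ k < min d1 d2 \<and> k \<ge> k0) sequentially"
    by (intro eventually_conj eventually_ge_at_top)
  then obtain k where k: "(1/2::real) ^ k < min d1 d2" "k \<ge> k0" by (auto simp: eventually_sequentially)
  have bound: "\<bar>X m t \<omega> - X m (grid_floor \<delta> k t) \<omega>\<bar> \<le> e"
    if inc: "\<And>t. t \<in> {\<delta>..1} \<Longrightarrow> \<bar>U m t \<omega> - U m (grid_floor \<delta> k t) \<omega>\<bar> \<le> e1 \<and> \<bar>V m t \<omega> - V m (grid_floor \<delta> k t) \<omega>\<bar> \<le> e1"
      and UV: "\<And>t. t \<in> {\<delta>..1} \<Longrightarrow> \<bar>U m t \<omega>\<bar> \<le> R \<and> \<bar>V m t \<omega>\<bar> \<le> R" and t: "t \<in> {\<delta>..1}" for m \<omega> t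
  proof -
    let ?s = "grid_floor \<delta> k t"
    have s: "?s \<in> {\<delta>..1}" using \<delta> t by (intro grid_point_in grid_index_le) auto
    have "dist t ?s < min d1 d2"
      using grid_floor_close[OF less_imp_le[OF \<delta>(1)] \<delta>(2) t, of k] k(1) by (simp add: dist_real_def power_one_over)
    then have osc: "\<bar>\<alpha> t - \<alpha> ?s\<bar> \<le> e / (4 * R)" "\<bar>\<beta> t - \<beta> ?s\<bar> \<le> e / (4 * R)"
      using d1(2)[OF s t] d2(2)[OF s t] by (auto simp: dist_real_def)
    have product_bound: "\<bar>x * u - y * v\<bar> \<le> e / 2"
      if "\<bar>x\<bar> \<le> 1 / \<delta>" "\<bar>u - v\<bar> \<le> e1" "\<bar>x - y\<bar> \<le> e / (4 * R)" "\<bar>v\<bar> \<le> R" for x u y v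
    proof -
      have "x * u - y * v = x * (u - v) + (x - y) * v" by (simp add: algebra_simps)
      then have "\<bar>x * u - y * v\<bar> \<le> \<bar>x\<bar> * \<bar>u - v\<bar> + \<bar>x - y\<bar> * \<bar>v\<bar>"
        by (metis abs_mult abs_triangle_ineq)
      also have "\<dots> \<le> (1 / \<delta>) * (\<delta> * e / 4) + (e / (4 * R)) * R"
        using that e1 \<delta> e R(1) by (intro add_mono mult_mono) auto
      also have "\<dots> = e / 2" using \<delta> R(1) by simp
      finally show ?thesis .
    qed
    have "\<bar>\<alpha> t * U m t \<omega> - \<alpha> ?s * U m ?s \<omega>\<bar> \<le> e / 2" "\<bar>\<beta> t * V m t \<omega> - \<beta> ?s * V m ?s \<omega>\<bar> \<le> e / 2"
      using product_bound[OF \<alpha>\<beta>(1)[OF t] _ osc(1)] product_bound[OF \<alpha>\<beta>(2)[OF t] _ osc(2)] inc[OF t] UV[OF s] by blast+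
    then show ?thesis unfolding X_eq by linarith
  qed
  from k0[OF k(2)] R(2)
  have "eventually (\<lambda>m. nearly_surely (M m) e (\<lambda>\<omega>. \<forall>t\<in>{\<delta>..1}. \<bar>X m t \<omega> - X m (grid_floor \<delta> k t) \<omega>\<bar> \<le> e)) sequentially"
  proof eventually_elim
    case (elim m)
    from nearly_surely_conj[OF this] show ?case
      by (rule nearly_surely_mono) (use e1(2) bound in \<open>auto simp del: atLeastAtMost_iff\<close>)
  qed
  then show ?thesis by blast
qed

lemma Y_equicontinuous:
  assumes e: "e > 0"
  shows "\<exists>k. eventually (\<lambda>m. nearly_surely (M m) e (\<lambda>\<omega>. \<forall>t\<in>{\<delta>..1}. \<bar>Y m t \<omega> - Y m (grid_floor \<delta> k t) \<omega>\<bar> \<le> e)) sequentially"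
proof -
  have e3: "e / 3 > 0" using e by simp
  obtain k where
    k: "eventually (\<lambda>m. nearly_surely (M m) (e / 3) (\<lambda>\<omega>. \<forall>t\<in>{\<delta>..1}. \<bar>X m t \<omega> - X m (grid_floor \<delta> k t) \<omega>\<bar> \<le> e / 3)) sequentially"
    using X_equicontinuous[OF e3] by blast
  from k Y_close_X[OF e3]
  have "eventually (\<lambda>m. nearly_surely (M m) e (\<lambda>\<omega>. \<forall>t\<in>{\<delta>..1}. \<bar>Y m t \<omega> - Y m (grid_floor \<delta> k t) \<omega>\<bar> \<le> e)) sequentially"
  proof eventually_elim
    case (elim m)
    have "e / 3 + e / 3 \<le> e" using e by simp
    with nearly_surely_conj[OF elim] show ?case
    proof (rule nearly_surely_mono, intro ballI)
      fix \<omega> t assume *: "(\<forall>t\<in>{\<delta>..1}. \<bar>X m t \<omega> - X m (grid_floor \<delta> k t) \<omega>\<bar> \<le> e / 3) \<and>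
          (\<forall>t\<in>{\<delta>..1}. \<bar>Y m t \<omega> - X m t \<omega>\<bar> \<le> e / 3)" and t: "t \<in> {\<delta>..1}"
      have "grid_floor \<delta> k t \<in> {\<delta>..1}" using \<delta> t by (intro grid_point_in grid_index_le) auto
      then have "\<bar>Y m (grid_floor \<delta> k t) \<omega> - X m (grid_floor \<delta> k t) \<omega>\<bar> \<le> e / 3"
        "\<bar>X m t \<omega> - X m (grid_floor \<delta> k t) \<omega>\<bar> \<le> e / 3" "\<bar>Y m t \<omega> - X m t \<omega>\<bar> \<le> e / 3"
        using * t by blast+
      then show "\<bar>Y m t \<omega> - Y m (grid_floor \<delta> k t) \<omega>\<bar> \<le> e" by linarith
    qed
  qed
  then show ?thesis by blast
qed

lemma Y_measurable: "Y m t \<in> borel_measurable (M m)"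
proof -
  have [measurable]: "i \<in> {1..m} \<Longrightarrow> P m i \<in> borel_measurable (M m)" for i by (rule S.P_measurable)
  have [measurable]: "i \<in> {1..m} \<Longrightarrow> H m i \<in> M m \<rightarrow>\<^sub>M count_space UNIV" for i by (rule S.H_measurable)
  show ?thesis unfolding Y_def[abs_def] fdp_def by measurable
qed

lemma Y_bounded: "bounded ((\<lambda>t. Y m t \<omega>) ` {\<delta>..1})"
  unfolding bounded_iff
proof (intro exI[of _ "sqrt (real m)"] ballI, elim imageE, simp only:)
  fix t assume t: "t \<in> {\<delta>..1}"
  have "\<bar>fdp m (P m) (H m) t \<omega> - Q t\<bar> \<le> 1"
    using fdp_bounds[of m "P m" "H m" t \<omega>] Q_bounds[OF t] by simp
  then have "sqrt (real m) * \<bar>fdp m (P m) (H m) t \<omega> - Q t\<bar> \<le> sqrt (real m) * 1"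
    by (intro mult_left_mono) auto
  then show "norm (Y m t \<omega>) \<le> sqrt (real m)" by (simp add: Y_def abs_mult)
qed

lemma X_eq_score:
  assumes t: "t \<in> {\<delta>..1}"
  shows "X m t \<omega> = (\<Sum>i=1..m. S.score m i t \<omega> / G t) / sqrt (real m)"
proof -
  have qG: "Q t * G t = (1 - a) * t" using G_ge(2)[OF t] by (simp add: fdp_limit_def)
  let ?x = "(\<Sum>i=1..m. of_bool (masked (P m) (H m) i \<omega> \<le> t)) - real m * ((1 - a) * t)"
  let ?y = "(\<Sum>i=1..m. of_bool (P m i \<omega> \<le> t)) - real m * G t"
  have "(\<Sum>i=1..m. S.score m i t \<omega>) =
      (\<Sum>i=1..m. of_bool (masked (P m) (H m) i \<omega> \<le> t) - Q t * of_bool (P m i \<omega> \<le> t))"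
    using t by (intro sum.cong refl) (auto simp: S.score_def masked_def)
  also have "\<dots> = (\<Sum>i=1..m. of_bool (masked (P m) (H m) i \<omega> \<le> t)) - Q t * (\<Sum>i=1..m. of_bool (P m i \<omega> \<le> t))"
    unfolding sum_subtractf sum_distrib_left ..
  also have "\<dots> = ?x - Q t * ?y"
    unfolding qG[symmetric] by (simp only: right_diff_distrib) (simp add: algebra_simps)
  finally have score: "(\<Sum>i=1..m. S.score m i t \<omega>) = ?x - Q t * ?y" .
  have "X m t \<omega> = (?x - Q t * ?y) / sqrt (real m) / G t"
    unfolding X_def U_def V_def empirical_def by (simp only: times_divide_eq_right diff_divide_distrib[symmetric])
  also have "\<dots> = (\<Sum>i=1..m. S.score m i t \<omega>) / sqrt (real m) / G t" unfolding score ..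
  also have "\<dots> = (\<Sum>i=1..m. S.score m i t \<omega> / G t) / sqrt (real m)"
    by (simp only: sum_divide_distrib[symmetric] divide_divide_eq_left mult.commute)
  finally show ?thesis .
qed

text \<open>
  A linear combination of values of \<open>X m\<close> is a normalized sum of independent bounded variables, each of
  which is a linear combination of scores and has the variance that the kernel prescribes.
\<close>

lemma X_fidi:
  fixes k :: nat and q c :: "nat \<Rightarrow> real"
  assumes q: "\<And>j. j < k \<Longrightarrow> q j \<in> {\<delta>..1}"
  shows "(\<lambda>m. char (distr (M m) borel (\<lambda>\<omega>. \<Sum>j<k. c j * X m (q j) \<omega>)) 1) \<longlonglongrightarrow>
    complex_of_real (exp (- (\<Sum>i<k. \<Sum>j<k. c i * c j * fdp_kernel a F (q i) (q j)) / 2))"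
proof -
  define d where "d j = c j / G (q j)" for j
  define \<zeta> where "\<zeta> m i \<omega> = (\<Sum>j<k. d j * S.score m i (q j) \<omega>)" for m i \<omega>
  have score_le: "\<bar>S.score m i (q j) \<omega>\<bar> \<le> 1" if "j < k" for m i j \<omega>
    using Q_bounds[OF q[OF that]] by (auto simp: S.score_def)
  have score_int: "integrable (M m) (S.score m i (q j))" "integrable (M m) (\<lambda>\<omega>. S.score m i (q j) \<omega> * S.score m i (q l) \<omega>)"
    if "i \<in> {1..m}" "j < k" "l < k" for m :: nat and i j l
  proof -
    note [measurable] = S.score_measurable[OF that(1)]
    show "integrable (M m) (S.score m i (q j))"
      using score_le[OF that(2)] by (intro S.integrable_const_bound[of _ 1]) auto
    have "\<bar>S.score m i (q j) \<omega> * S.score m i (q l) \<omega>\<bar> \<le> 1 * 1" for \<omega>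
      unfolding abs_mult using score_le that by (intro mult_mono) auto
    then show "integrable (M m) (\<lambda>\<omega>. S.score m i (q j) \<omega> * S.score m i (q l) \<omega>)"
      by (intro S.integrable_const_bound[of _ 1]) auto
  qed
  have eq: "(\<Sum>j<k. c j * X m (q j) \<omega>) = (\<Sum>i=1..m. \<zeta> m i \<omega>) / sqrt (real m)" for m \<omega>
  proof -
    have "(\<Sum>j<k. c j * X m (q j) \<omega>) = (\<Sum>j<k. \<Sum>i=1..m. d j * S.score m i (q j) \<omega>) / sqrt (real m)"
      unfolding sum_divide_distrib using q
      by (intro sum.cong refl) (simp add: X_eq_score d_def sum_divide_distrib sum_distrib_left)
    then show ?thesis unfolding \<zeta>_def by (subst sum.swap)
  qed
  show ?thesis
    unfolding eq
  proof (rule char_normalized_sum_tendsto)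
    show "prob_space (M m)" for m by (rule S.prob_space_axioms)
    show "prob_space.indep_vars (M m) (\<lambda>_. borel) (\<zeta> m) {1..m}" for m
    proof -
      have "prob_space.indep_vars (M m) (\<lambda>_. borel)
          (\<lambda>i \<omega>. (\<lambda>(x, h). \<Sum>j<k. d j * (of_bool (x \<le> q j) * (of_bool (\<not> h) - Q (q j)))) (P m i \<omega>, H m i \<omega>)) {1..m}"
        by (rule S.indep_vars_compose2[OF S.indep_pairs]) measurable
      then show ?thesis by (simp add: \<zeta>_def[abs_def] S.score_def)
    qed
    show "\<bar>\<zeta> m i \<omega>\<bar> \<le> (\<Sum>j<k. \<bar>d j\<bar>)" for m i \<omega>
      unfolding \<zeta>_def using score_le
      by (intro order_trans[OF sum_abs] sum_mono) (auto simp: abs_mult intro: mult_left_le)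
    fix m i :: nat assume i: "i \<in> {1..m}"
    have mom: "S.expectation m (S.score m i (q j)) = 0"
        "S.expectation m (\<lambda>\<omega>. S.score m i (q j) \<omega> * S.score m i (q l) \<omega>) = G (q j) * G (q l) * fdp_kernel a F (q j) (q l)"
      if "j < k" "l < k" for j l
      using S.score_moments[OF i a unit unit, OF q[OF that(1)] q[OF that(2)]] S.score_moments[OF i a unit unit, OF q[OF that(2)] q[OF that(1)]]
        G_ge(2)[OF q[OF that(1)]] G_ge(2)[OF q[OF that(2)]] by auto
    show "S.expectation m (\<zeta> m i) = 0"
      unfolding \<zeta>_def[abs_def] using score_int(1)[OF i] mom(1)
      by (subst Bochner_Integration.integral_sum) auto
    have "S.expectation m (\<lambda>\<omega>. (\<zeta> m i \<omega>)\<^sup>2) =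
        S.expectation m (\<lambda>\<omega>. \<Sum>j<k. \<Sum>l<k. d j * d l * (S.score m i (q j) \<omega> * S.score m i (q l) \<omega>))"
      unfolding \<zeta>_def power2_eq_square sum_product
      by (intro Bochner_Integration.integral_cong sum.cong refl) (simp add: algebra_simps)
    also have "\<dots> = (\<Sum>j<k. S.expectation m (\<lambda>\<omega>. \<Sum>l<k. d j * d l * (S.score m i (q j) \<omega> * S.score m i (q l) \<omega>)))"
      using score_int(2)[OF i] by (intro Bochner_Integration.integral_sum Bochner_Integration.integrable_sum integrable_mult_right) auto
    also have "\<dots> = (\<Sum>j<k. \<Sum>l<k. S.expectation m (\<lambda>\<omega>. d j * d l * (S.score m i (q j) \<omega> * S.score m i (q l) \<omega>)))"
      using score_int(2)[OF i] by (intro sum.cong refl Bochner_Integration.integral_sum integrable_mult_right) auto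
    also have "\<dots> = (\<Sum>j<k. \<Sum>l<k. c j * c l * fdp_kernel a F (q j) (q l))"
    proof (intro sum.cong refl)
      fix j l assume "j \<in> {..<k}" "l \<in> {..<k}"
      then show "S.expectation m (\<lambda>\<omega>. d j * d l * (S.score m i (q j) \<omega> * S.score m i (q l) \<omega>)) = c j * c l * fdp_kernel a F (q j) (q l)"
        using mom(2)[of j l] G_ge(2)[OF q, of j] G_ge(2)[OF q, of l] by (simp add: d_def)
    qed
    finally show "S.expectation m (\<lambda>\<omega>. (\<zeta> m i \<omega>)\<^sup>2) = (\<Sum>i<k. \<Sum>j<k. c i * c j * fdp_kernel a F (q i) (q j))" .
  qed
qed

lemma X_measurable: "t \<in> {\<delta>..1} \<Longrightarrow> X m t \<in> borel_measurable (M m)"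
proof -
  assume t: "t \<in> {\<delta>..1}"
  have [measurable]: "i \<in> {1..m} \<Longrightarrow> S.score m i t \<in> borel_measurable (M m)" for i by (rule S.score_measurable)
  have "X m t = (\<lambda>\<omega>. (\<Sum>i=1..m. S.score m i t \<omega> / G t) / sqrt (real m))" using X_eq_score[OF t] by (intro ext)
  then show ?thesis by simp
qed

lemma Y_fidi:
  fixes k :: nat and q c :: "nat \<Rightarrow> real"
  assumes q: "\<And>j. j < k \<Longrightarrow> q j \<in> {\<delta>..1}"
  shows "(\<lambda>m. char (distr (M m) borel (\<lambda>\<omega>. \<Sum>j<k. c j * Y m (q j) \<omega>)) 1) \<longlonglongrightarrow>
    complex_of_real (exp (- (\<Sum>i<k. \<Sum>j<k. c i * c j * fdp_kernel a F (q i) (q j)) / 2))"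
proof -
  let ?Y = "\<lambda>m. char (distr (M m) borel (\<lambda>\<omega>. \<Sum>j<k. c j * Y m (q j) \<omega>)) 1"
  let ?X = "\<lambda>m. char (distr (M m) borel (\<lambda>\<omega>. \<Sum>j<k. c j * X m (q j) \<omega>)) 1"
  define s where "s = (\<Sum>j<k. \<bar>c j\<bar>)"
  have s: "s \<ge> 0" unfolding s_def by (intro sum_nonneg) auto
  have "(\<lambda>m. ?Y m - ?X m) \<longlonglongrightarrow> 0"
  proof (rule LIMSEQ_I)
    fix e :: real assume e: "e > 0"
    define e' where "e' = e / (s + 3)"
    have e': "e' > 0" using e s by (simp add: e'_def)
    have "(s + 2) * e' < (s + 3) * e'" using e' by simp
    also have "\<dots> = e" using s by (simp add: e'_def)
    finally have e'_e: "s * e' + 2 * e' < e" by (simp add: algebra_simps)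
    have "eventually (\<lambda>m. norm (?Y m - ?X m - 0) < e) sequentially"
      using Y_close_X[OF e'] unfolding nearly_surely_def
    proof eventually_elim
      case (elim m)
      then obtain A where A: "A \<in> sets (M m)" "measure (M m) A \<le> e'"
        "\<And>\<omega> t. \<omega> \<in> space (M m) - A \<Longrightarrow> t \<in> {\<delta>..1} \<Longrightarrow> \<bar>Y m t \<omega> - X m t \<omega>\<bar> \<le> e'" by blast
      have "norm (?Y m - ?X m) \<le> s * e' + 2 * measure (M m) A"
      proof (rule S.char_close[OF _ _ A(1)])
        show "(\<lambda>\<omega>. \<Sum>j<k. c j * Y m (q j) \<omega>) \<in> borel_measurable (M m)"
          by (intro borel_measurable_sum borel_measurable_times Y_measurable) auto
        show "(\<lambda>\<omega>. \<Sum>j<k. c j * X m (q j) \<omega>) \<in> borel_measurable (M m)"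
          using q by (intro borel_measurable_sum borel_measurable_times X_measurable) auto
        show "0 \<le> s * e'" using s e' by simp
        fix \<omega> assume \<omega>: "\<omega> \<in> space (M m) - A"
        have "\<bar>(\<Sum>j<k. c j * Y m (q j) \<omega>) - (\<Sum>j<k. c j * X m (q j) \<omega>)\<bar> = \<bar>\<Sum>j<k. c j * (Y m (q j) \<omega> - X m (q j) \<omega>)\<bar>"
          by (simp add: sum_subtractf[symmetric] right_diff_distrib)
        also have "\<dots> \<le> (\<Sum>j<k. \<bar>c j\<bar> * e')"
          using A(3)[OF \<omega>] q by (intro order_trans[OF sum_abs] sum_mono) (auto simp: abs_mult intro: mult_left_mono)
        finally show "\<bar>(\<Sum>j<k. c j * Y m (q j) \<omega>) - (\<Sum>j<k. c j * X m (q j) \<omega>)\<bar> \<le> s * e'"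
          by (simp add: s_def sum_distrib_right)
      qed
      then show ?case using A(2) e'_e by simp
    qed
    then show "\<exists>no. \<forall>m\<ge>no. norm (?Y m - ?X m - 0) < e" by (simp add: eventually_sequentially)
  qed
  from tendsto_add[OF this X_fidi[of k q c, OF q]] show ?thesis by simp
qed

end

theorem theorem4p2:
  fixes a \<delta> :: real and F g :: "real \<Rightarrow> real"
    and M :: "nat \<Rightarrow> 'w measure"
    and P :: "nat \<Rightarrow> nat \<Rightarrow> 'w \<Rightarrow> real" and H :: "nat \<Rightarrow> nat \<Rightarrow> 'w \<Rightarrow> bool"
    and N :: "'z measure" and Z :: "real \<Rightarrow> 'z \<Rightarrow> real"
  assumes "0 \<le> a" "a \<le> 1"
    and "distribution_function_01 F"
    and "\<And>t. t \<in> {0..1} \<Longrightarrow> F t \<ge> t"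
    and "\<And>m. fdr_mixture_sample (M m) m a F (P m) (H m)"
    and "strictly_concave_on {0..1} (mixture_cdf a F)"
    and "set_integrable lborel {0..1} g"
    and "\<And>t. t \<in> {0..1} \<Longrightarrow> mixture_cdf a F t = (LBINT x:{0..t}. g x)"
    and "\<And>t. t \<in> {0<..<1} \<Longrightarrow> (mixture_cdf a F has_real_derivative g t) (at t)"
    and "0 < \<delta>" "\<delta> < 1"
    and "gaussian_process N {0<..1} Z (\<lambda>_. 0) (fdp_kernel a F)"
  shows "weak_conv_process {\<delta>..1} M
           (\<lambda>m t \<omega>. sqrt (real m) * (fdp m (P m) (H m) t \<omega> - fdp_limit a F t)) N Z"
proof -
  have "0 < a" using assms(1) not_strictly_concave_identity[OF assms(6)] by simp
  interpret fdr_asymptotics a \<delta> F M P H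
    by (rule fdr_asymptotics.intro[OF \<open>0 < a\<close> assms(2,3,4,5,6,10,11)])
  have sub: "{\<delta>..1} \<subseteq> {0<..1}" using \<delta> by auto
  have "weak_conv_process {\<delta>..1} M Y N Z"
  proof (rule weak_conv_process_if_equicontinuous)
    show "prob_space (M m)" for m by (rule S.prob_space_axioms)
    show "prob_space N" using assms(12) by (simp add: gaussian_process_def)
    show "Y m t \<in> borel_measurable (M m)" for m t by (rule Y_measurable)
    show "Z t \<in> borel_measurable N" if "t \<in> {\<delta>..1}" for t
      using assms(12) that sub unfolding gaussian_process_def by blast
    show "bounded ((\<lambda>t. Y m t \<omega>) ` {\<delta>..1})" for m \<omega> by (rule Y_bounded)
    show "(\<lambda>m. char (distr (M m) borel (\<lambda>\<omega>. \<Sum>j<k. c j * Y m (q j) \<omega>)) 1)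
          \<longlonglongrightarrow> char (distr N borel (\<lambda>\<omega>. \<Sum>j<k. c j * Z (q j) \<omega>)) 1"
      if "\<And>j. q j \<in> {\<delta>..1}" for k :: nat and q c
    proof -
      have "char (distr N borel (\<lambda>\<omega>. \<Sum>j<k. c j * Z (q j) \<omega>)) 1 =
          complex_of_real (exp (- (\<Sum>i<k. \<Sum>j<k. c i * c j * fdp_kernel a F (q i) (q j)) / 2))"
        by (rule gaussian_process_char[OF assms(12)]) (use that sub in blast)
      then show ?thesis using Y_fidi[of k q c] that by simp
    qed
    show "\<exists>(k::nat) p \<iota>. (\<forall>j. p j \<in> {\<delta>..1}) \<and> (\<forall>t\<in>{\<delta>..1}. \<iota> t < k) \<and>
        eventually (\<lambda>m. nearly_surely (M m) e (\<lambda>\<omega>. \<forall>t\<in>{\<delta>..1}. \<bar>Y m t \<omega> - Y m (p (\<iota> t)) \<omega>\<bar> \<le> e)) sequentially"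
      if e: "e > 0" for e
    proof -
      obtain k where
        k: "eventually (\<lambda>m. nearly_surely (M m) e (\<lambda>\<omega>. \<forall>t\<in>{\<delta>..1}. \<bar>Y m t \<omega> - Y m (grid_floor \<delta> k t) \<omega>\<bar> \<le> e)) sequentially"
        using Y_equicontinuous[OF e] by blast
      have \<delta>0: "0 \<le> \<delta>" using \<delta> by simp
      \<comment> \<open>the witness for the grid has to map every index into the interval\<close>
      define p where "p j = grid_point \<delta> k (min j (2 ^ k))" for j
      have p: "p (grid_index \<delta> k t) = grid_floor \<delta> k t" if "t \<in> {\<delta>..1}" for t
        using grid_index_le[OF \<delta>0 \<delta>(2) that, of k] by (simp add: p_def min_def)
      show ?thesis
      proof (intro exI[of _ "Suc (2 ^ k)"] exI[of _ p] exI[of _ "grid_index \<delta> k"] conjI allI ballI)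
        show "p j \<in> {\<delta>..1}" for j unfolding p_def by (rule grid_point_in[OF \<delta>0 \<delta>(2)]) simp
        show "grid_index \<delta> k t < Suc (2 ^ k)" if "t \<in> {\<delta>..1}" for t
          using grid_index_le[OF \<delta>0 \<delta>(2) that, of k] by simp
        show "eventually (\<lambda>m. nearly_surely (M m) e (\<lambda>\<omega>. \<forall>t\<in>{\<delta>..1}. \<bar>Y m t \<omega> - Y m (p (grid_index \<delta> k t)) \<omega>\<bar> \<le> e)) sequentially"
          using k by (simp only: p cong: ball_cong)
      qed
    qed
  qed
  then show ?thesis unfolding Y_def[abs_def] .
qed

end
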